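(* Let $T$ be a complete affine $L$-theory which has a compact model. Then a model $M\vDash T$ is separable and extremal if and only if it is compact and minimal. Moreover, $T$ has a unique such model (up to isomorphism).
   Context: Affine (linear) continuous logic. A language $L$ consists of constant symbols, function symbols $F$ (each with an arity and a Lipschitz constant $\lambda_F\geqslant0$) and relation symbols $R$ (each with an arity and a Lipschitz constant $\lambda_R\geqslant 0$), always including a distinguished binary relation symbol $d$ for the metric. An $L$-structure is a complete metric space $(M,d)$ with $c^M\in M$, $F^M:M^n\to M$ $\lambda_F$-Lipschitz, and $R^M:M^n\to\mathbb R$ $\lambda_R$-Lipschitz with $\|R^M\|_\infty\leqslant1$ (so $d\leqslant 1$); $M^n$ carries the metric $\sum_{i<n}2^{-i}d(x_i,y_i)$. Affine formulas are generated by $r$, $d(t_1,t_2)$, $R(t_1,\dots,t_n)$, $r\phi$, $\phi+\psi$, $\sup_x\phi$, $\inf_x\phi$ ($r\in\mathbb R$, $t_i$ terms) and are interpreted as real-valued functions $\phi^M$. A condition is an expression $\phi\leqslant\psi$ (and $\phi=\psi$ abbreviates the two inequalities); an (affine) theory is a set of conditions between sentences; $M\vDash T$ means all conditions of $T$ hold in $M$. $T$ is complete if it has a model and for every sentence $\sigma$ there is a unique $r\in\mathbb R$ with $\sigma=r$ in $T$. $M\preccurlyeq N$ ($M$ is an elementary submodel of $N$) means $M$ is a substructure of $N$ and $\phi^M(\bar a)=\phi^N(\bar a)$ for all affine formulas $\phi$ and $\bar a\in M$. A model is minimal if it has no proper elementary submodel. For complete $T$, $\mathbb D_n(T)$ is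 the ordered vector space of formulas $\phi(x_1,\dots,x_n)$ modulo $T$-equivalence, i.e. $\{\phi^M\}$ for any $M\vDash T$, with pointwise order and sup-norm. An $n$-type is a positive linear functional $p:\mathbb D_n(T)\to\mathbb R$ with $p(1)=1$; $S_n(T)$ is the compact convex set of all $n$-types, and $E_n(T)$ is its set of extreme points, called extreme types. For $\bar a\in M^n$, $tp(\bar a)(\phi)=\phi^M(\bar a)$. A model $M\vDash T$ is extremal if $tp(\bar a)\in E_n(T)$ for every $n$ and every $\bar a\in M^n$. *)

theory Defs
  imports "HOL-Analysis.Analysis"
begin

section \<open>Languages, terms and affine formulas\<close>

text \<open>The symbols of a language are elements of the types \<open>'c\<close>, \<open>'f\<close>, \<open>'r\<close>; the three sets select
  those that occur, so that there may be no constant (function, relation) symbols at all.  The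
  distinguished symbol for the metric is not among them: it is the constructor \<open>Dist\<close> below.\<close>

record ('c, 'f, 'r) language =
  const_syms :: "'c set"
  fun_syms :: "'f set"
  fun_arity :: "'f \<Rightarrow> nat"
  fun_lip :: "'f \<Rightarrow> real"
  rel_syms :: "'r set"
  rel_arity :: "'r \<Rightarrow> nat"
  rel_lip :: "'r \<Rightarrow> real"

definition is_language :: "('c, 'f, 'r) language \<Rightarrow> bool" where
  "is_language L \<longleftrightarrow> (\<forall>F\<in>fun_syms L. 0 \<le> fun_lip L F) \<and> (\<forall>R\<in>rel_syms L. 0 \<le> rel_lip L R)"

datatype ('c, 'f) trm =
    Var nat
  | Cst 'c
  | App 'f "('c, 'f) trm list"

datatype ('c, 'f, 'r) fm =
    Const real
  | Dist "('c, 'f) trm" "('c, 'f) trm"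
  | Rel 'r "('c, 'f) trm list"
  | Scale real "('c, 'f, 'r) fm"
  | Add "('c, 'f, 'r) fm" "('c, 'f, 'r) fm"
  | SupQ nat "('c, 'f, 'r) fm"
  | InfQ nat "('c, 'f, 'r) fm"

fun wf_trm :: "('c, 'f, 'r) language \<Rightarrow> ('c, 'f) trm \<Rightarrow> bool" where
  "wf_trm L (Var i) \<longleftrightarrow> True"
| "wf_trm L (Cst c) \<longleftrightarrow> c \<in> const_syms L"
| "wf_trm L (App F ts) \<longleftrightarrow>
     F \<in> fun_syms L \<and> length ts = fun_arity L F \<and> (\<forall>t\<in>set ts. wf_trm L t)"

fun wf_fm :: "('c, 'f, 'r) language \<Rightarrow> ('c, 'f, 'r) fm \<Rightarrow> bool" where
  "wf_fm L (Const r) \<longleftrightarrow> True"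
| "wf_fm L (Dist t u) \<longleftrightarrow> wf_trm L t \<and> wf_trm L u"
| "wf_fm L (Rel R ts) \<longleftrightarrow>
     R \<in> rel_syms L \<and> length ts = rel_arity L R \<and> (\<forall>t\<in>set ts. wf_trm L t)"
| "wf_fm L (Scale r \<phi>) \<longleftrightarrow> wf_fm L \<phi>"
| "wf_fm L (Add \<phi> \<psi>) \<longleftrightarrow> wf_fm L \<phi> \<and> wf_fm L \<psi>"
| "wf_fm L (SupQ i \<phi>) \<longleftrightarrow> wf_fm L \<phi>"
| "wf_fm L (InfQ i \<phi>) \<longleftrightarrow> wf_fm L \<phi>"

fun vars_trm :: "('c, 'f) trm \<Rightarrow> nat set" where
  "vars_trm (Var i) = {i}"
| "vars_trm (Cst c) = {}"
| "vars_trm (App F ts) = (\<Union>t\<in>set ts. vars_trm t)"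

fun free_vars :: "('c, 'f, 'r) fm \<Rightarrow> nat set" where
  "free_vars (Const r) = {}"
| "free_vars (Dist t u) = vars_trm t \<union> vars_trm u"
| "free_vars (Rel R ts) = (\<Union>t\<in>set ts. vars_trm t)"
| "free_vars (Scale r \<phi>) = free_vars \<phi>"
| "free_vars (Add \<phi> \<psi>) = free_vars \<phi> \<union> free_vars \<psi>"
| "free_vars (SupQ i \<phi>) = free_vars \<phi> - {i}"
| "free_vars (InfQ i \<phi>) = free_vars \<phi> - {i}"

text \<open>The \<open>L\<close>-formulas \<open>\<phi>(x\<^sub>1,\<dots>,x\<^sub>n)\<close>; the variable \<open>x\<^sub>i\<close> is \<open>Var (i - 1)\<close>.\<close>

definition formulas :: "('c, 'f, 'r) language \<Rightarrow> nat \<Rightarrow> ('c, 'f, 'r) fm set" where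
  "formulas L n = {\<phi>. wf_fm L \<phi> \<and> free_vars \<phi> \<subseteq> {..<n}}"

abbreviation sentences :: "('c, 'f, 'r) language \<Rightarrow> ('c, 'f, 'r) fm set" where
  "sentences L \<equiv> formulas L 0"


section \<open>Structures\<close>

record ('a, 'c, 'f, 'r) lstruct =
  metr :: "'a metric"
  const_int :: "'c \<Rightarrow> 'a"
  fun_int :: "'f \<Rightarrow> 'a list \<Rightarrow> 'a"
  rel_int :: "'r \<Rightarrow> 'a list \<Rightarrow> real"

abbreviation carr :: "('a, 'c, 'f, 'r) lstruct \<Rightarrow> 'a set" where
  "carr M \<equiv> mspace (metr M)"

definition tuples :: "('a, 'c, 'f, 'r) lstruct \<Rightarrow> nat \<Rightarrow> 'a list set" where
  "tuples M n = {as. length as = n \<and> set as \<subseteq> carr M}"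

definition tuple_dist :: "('a, 'c, 'f, 'r) lstruct \<Rightarrow> nat \<Rightarrow> 'a list \<Rightarrow> 'a list \<Rightarrow> real" where
  "tuple_dist M n as bs = (\<Sum>i<n. (1 / 2) ^ i * mdist (metr M) (as ! i) (bs ! i))"

definition is_structure ::
  "('c, 'f, 'r) language \<Rightarrow> ('a, 'c, 'f, 'r) lstruct \<Rightarrow> bool" where
  "is_structure L M \<longleftrightarrow>
     carr M \<noteq> {} \<and>
     mcomplete_of (metr M) \<and>
     (\<forall>a\<in>carr M. \<forall>b\<in>carr M. mdist (metr M) a b \<le> 1) \<and>
     (\<forall>c\<in>const_syms L. const_int M c \<in> carr M) \<and>
     (\<forall>F\<in>fun_syms L. \<forall>as\<in>tuples M (fun_arity L F). fun_int M F as \<in> carr M) \<and>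
     (\<forall>F\<in>fun_syms L. \<forall>as\<in>tuples M (fun_arity L F). \<forall>bs\<in>tuples M (fun_arity L F).
        mdist (metr M) (fun_int M F as) (fun_int M F bs)
          \<le> fun_lip L F * tuple_dist M (fun_arity L F) as bs) \<and>
     (\<forall>R\<in>rel_syms L. \<forall>as\<in>tuples M (rel_arity L R). \<bar>rel_int M R as\<bar> \<le> 1) \<and>
     (\<forall>R\<in>rel_syms L. \<forall>as\<in>tuples M (rel_arity L R). \<forall>bs\<in>tuples M (rel_arity L R).
        \<bar>rel_int M R as - rel_int M R bs\<bar>
          \<le> rel_lip L R * tuple_dist M (rel_arity L R) as bs)"

fun eval_trm :: "('a, 'c, 'f, 'r) lstruct \<Rightarrow> (nat \<Rightarrow> 'a) \<Rightarrow> ('c, 'f) trm \<Rightarrow> 'a" where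
  "eval_trm M v (Var i) = v i"
| "eval_trm M v (Cst c) = const_int M c"
| "eval_trm M v (App F ts) = fun_int M F (map (eval_trm M v) ts)"

fun eval_fm :: "('a, 'c, 'f, 'r) lstruct \<Rightarrow> (nat \<Rightarrow> 'a) \<Rightarrow> ('c, 'f, 'r) fm \<Rightarrow> real" where
  "eval_fm M v (Const r) = r"
| "eval_fm M v (Dist t u) = mdist (metr M) (eval_trm M v t) (eval_trm M v u)"
| "eval_fm M v (Rel R ts) = rel_int M R (map (eval_trm M v) ts)"
| "eval_fm M v (Scale r \<phi>) = r * eval_fm M v \<phi>"
| "eval_fm M v (Add \<phi> \<psi>) = eval_fm M v \<phi> + eval_fm M v \<psi>"
| "eval_fm M v (SupQ i \<phi>) = (SUP a\<in>carr M. eval_fm M (v(i := a)) \<phi>)"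
| "eval_fm M v (InfQ i \<phi>) = (INF a\<in>carr M. eval_fm M (v(i := a)) \<phi>)"

text \<open>\<open>\<phi>\<^sup>M(a\<^sub>1,\<dots>,a\<^sub>n)\<close>.  Only used for \<open>\<phi> \<in> formulas L (length as)\<close>, where the values of the
  assignment beyond the end of the list do not matter.\<close>

definition value_at :: "('a, 'c, 'f, 'r) lstruct \<Rightarrow> ('c, 'f, 'r) fm \<Rightarrow> 'a list \<Rightarrow> real" where
  "value_at M \<phi> as = eval_fm M (\<lambda>i. as ! i) \<phi>"

definition compact_structure :: "('a, 'c, 'f, 'r) lstruct \<Rightarrow> bool" where
  "compact_structure M \<longleftrightarrow> compact_space (mtopology_of (metr M))"

definition separable_structure :: "('a, 'c, 'f, 'r) lstruct \<Rightarrow> bool" where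
  "separable_structure M \<longleftrightarrow> separable_space (mtopology_of (metr M))"

definition isomorphic_structures ::
  "('c, 'f, 'r) language \<Rightarrow> ('a, 'c, 'f, 'r) lstruct \<Rightarrow> ('b, 'c, 'f, 'r) lstruct \<Rightarrow> bool" where
  "isomorphic_structures L M N \<longleftrightarrow>
     (\<exists>h. bij_betw h (carr M) (carr N) \<and>
        (\<forall>a\<in>carr M. \<forall>b\<in>carr M. mdist (metr N) (h a) (h b) = mdist (metr M) a b) \<and>
        (\<forall>c\<in>const_syms L. h (const_int M c) = const_int N c) \<and>
        (\<forall>F\<in>fun_syms L. \<forall>as\<in>tuples M (fun_arity L F).
           h (fun_int M F as) = fun_int N F (map h as)) \<and>
        (\<forall>R\<in>rel_syms L. \<forall>as\<in>tuples M (rel_arity L R).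
           rel_int M R as = rel_int N R (map h as)))"

definition substructure ::
  "('c, 'f, 'r) language \<Rightarrow> ('a, 'c, 'f, 'r) lstruct \<Rightarrow> ('a, 'c, 'f, 'r) lstruct \<Rightarrow> bool" where
  "substructure L M N \<longleftrightarrow>
     is_structure L M \<and> is_structure L N \<and> carr M \<subseteq> carr N \<and>
     (\<forall>a\<in>carr M. \<forall>b\<in>carr M. mdist (metr M) a b = mdist (metr N) a b) \<and>
     (\<forall>c\<in>const_syms L. const_int M c = const_int N c) \<and>
     (\<forall>F\<in>fun_syms L. \<forall>as\<in>tuples M (fun_arity L F). fun_int M F as = fun_int N F as) \<and>
     (\<forall>R\<in>rel_syms L. \<forall>as\<in>tuples M (rel_arity L R). rel_int M R as = rel_int N R as)"

definition elementary_submodel ::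
  "('c, 'f, 'r) language \<Rightarrow> ('a, 'c, 'f, 'r) lstruct \<Rightarrow> ('a, 'c, 'f, 'r) lstruct \<Rightarrow> bool" where
  "elementary_submodel L M N \<longleftrightarrow>
     substructure L M N \<and>
     (\<forall>n. \<forall>\<phi>\<in>formulas L n. \<forall>as\<in>tuples M n. value_at M \<phi> as = value_at N \<phi> as)"

definition minimal_structure ::
  "('c, 'f, 'r) language \<Rightarrow> ('a, 'c, 'f, 'r) lstruct \<Rightarrow> bool" where
  "minimal_structure L M \<longleftrightarrow> \<not> (\<exists>K. elementary_submodel L K M \<and> carr K \<noteq> carr M)"


section \<open>Theories\<close>

text \<open>The pair \<open>(\<phi>, \<psi>)\<close> stands for the condition \<open>\<phi> \<le> \<psi>\<close>.\<close>

definition is_theory ::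
  "('c, 'f, 'r) language \<Rightarrow> (('c, 'f, 'r) fm \<times> ('c, 'f, 'r) fm) set \<Rightarrow> bool" where
  "is_theory L T \<longleftrightarrow> T \<subseteq> sentences L \<times> sentences L"

definition is_model ::
  "('c, 'f, 'r) language \<Rightarrow> (('c, 'f, 'r) fm \<times> ('c, 'f, 'r) fm) set \<Rightarrow>
     ('a, 'c, 'f, 'r) lstruct \<Rightarrow> bool" where
  "is_model L T M \<longleftrightarrow>
     is_structure L M \<and> (\<forall>(\<sigma>, \<tau>)\<in>T. value_at M \<sigma> [] \<le> value_at M \<tau> [])"

text \<open>A definition cannot quantify over the models of \<open>T\<close> in all types.  Notions that refer to all
  models of \<open>T\<close> use those whose points are elements of the type \<open>nat \<Rightarrow> ('c, 'f, 'r) fm\<close>, which is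
  large enough: with \<open>\<kappa>\<close> the number of formulas, every structure has, by downward
  Loewenheim-Skolem, an elementary submodel containing any given finite tuple with a dense subset of
  size at most \<open>\<kappa>\<close>, hence with at most \<open>\<kappa>\<^sup>\<omega>\<close> points.\<close>

type_synonym ('c, 'f, 'r) universal_struct =
  "(nat \<Rightarrow> ('c, 'f, 'r) fm, 'c, 'f, 'r) lstruct"

text \<open>\<open>entails_le L T n \<phi> \<psi>\<close>: the inequality \<open>\<phi>(x\<^sub>1,\<dots>,x\<^sub>n) \<le> \<psi>(x\<^sub>1,\<dots>,x\<^sub>n)\<close> holds in every model of
  \<open>T\<close>, at all points.\<close>

definition entails_le ::
  "('c, 'f, 'r) language \<Rightarrow> (('c, 'f, 'r) fm \<times> ('c, 'f, 'r) fm) set \<Rightarrow> nat \<Rightarrow>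
     ('c, 'f, 'r) fm \<Rightarrow> ('c, 'f, 'r) fm \<Rightarrow> bool" where
  "entails_le L T n \<phi> \<psi> \<longleftrightarrow>
     (\<forall>M :: ('c, 'f, 'r) universal_struct. is_model L T M \<longrightarrow>
        (\<forall>as\<in>tuples M n. value_at M \<phi> as \<le> value_at M \<psi> as))"

definition entails_eq ::
  "('c, 'f, 'r) language \<Rightarrow> (('c, 'f, 'r) fm \<times> ('c, 'f, 'r) fm) set \<Rightarrow> nat \<Rightarrow>
     ('c, 'f, 'r) fm \<Rightarrow> ('c, 'f, 'r) fm \<Rightarrow> bool" where
  "entails_eq L T n \<phi> \<psi> \<longleftrightarrow> entails_le L T n \<phi> \<psi> \<and> entails_le L T n \<psi> \<phi>"

definition complete_theory ::
  "('c, 'f, 'r) language \<Rightarrow> (('c, 'f, 'r) fm \<times> ('c, 'f, 'r) fm) set \<Rightarrow> bool" where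
  "complete_theory L T \<longleftrightarrow>
     (\<exists>M :: ('c, 'f, 'r) universal_struct. is_model L T M) \<and>
     (\<forall>\<sigma>\<in>sentences L. \<exists>!r. entails_eq L T 0 \<sigma> (Const r))"


section \<open>Types, extreme types and extremal models\<close>

text \<open>A positive linear functional on \<open>\<bbbD>\<^sub>n(T)\<close> is represented by the function on formulas obtained by
  composing it with the quotient map; the value \<open>0\<close> outside \<open>formulas L n\<close> makes the
  representation unique.\<close>

definition types_of ::
  "('c, 'f, 'r) language \<Rightarrow> (('c, 'f, 'r) fm \<times> ('c, 'f, 'r) fm) set \<Rightarrow> nat \<Rightarrow>
     (('c, 'f, 'r) fm \<Rightarrow> real) set" where
  "types_of L T n =
     {p. (\<forall>\<phi>. \<phi> \<notin> formulas L n \<longrightarrow> p \<phi> = 0) \<and>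
         (\<forall>\<phi>\<in>formulas L n. \<forall>\<psi>\<in>formulas L n. entails_eq L T n \<phi> \<psi> \<longrightarrow> p \<phi> = p \<psi>) \<and>
         (\<forall>\<phi>\<in>formulas L n. \<forall>\<psi>\<in>formulas L n. p (Add \<phi> \<psi>) = p \<phi> + p \<psi>) \<and>
         (\<forall>r. \<forall>\<phi>\<in>formulas L n. p (Scale r \<phi>) = r * p \<phi>) \<and>
         (\<forall>\<phi>\<in>formulas L n. entails_le L T n (Const 0) \<phi> \<longrightarrow> 0 \<le> p \<phi>) \<and>
         p (Const 1) = 1}"

text \<open>Extreme points in the sense of \<open>extreme_point_of\<close>, spelled out because the function space is
  not an instance of \<open>real_vector\<close>.\<close>

definition extreme_types_of ::
  "('c, 'f, 'r) language \<Rightarrow> (('c, 'f, 'r) fm \<times> ('c, 'f, 'r) fm) set \<Rightarrow> nat \<Rightarrow>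
     (('c, 'f, 'r) fm \<Rightarrow> real) set" where
  "extreme_types_of L T n =
     {p \<in> types_of L T n.
        \<not> (\<exists>q\<in>types_of L T n. \<exists>s\<in>types_of L T n. \<exists>u. q \<noteq> s \<and> 0 < u \<and> u < 1 \<and>
             p = (\<lambda>\<phi>. (1 - u) * q \<phi> + u * s \<phi>))}"

definition tp ::
  "('c, 'f, 'r) language \<Rightarrow> ('a, 'c, 'f, 'r) lstruct \<Rightarrow> 'a list \<Rightarrow> ('c, 'f, 'r) fm \<Rightarrow> real" where
  "tp L M as = (\<lambda>\<phi>. if \<phi> \<in> formulas L (length as) then value_at M \<phi> as else 0)"

definition extremal ::
  "('c, 'f, 'r) language \<Rightarrow> (('c, 'f, 'r) fm \<times> ('c, 'f, 'r) fm) set \<Rightarrow>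
     ('a, 'c, 'f, 'r) lstruct \<Rightarrow> bool" where
  "extremal L T M \<longleftrightarrow> (\<forall>n. \<forall>as\<in>tuples M n. tp L M as \<in> extreme_types_of L T n)"

end

theory Submission
  imports Defs
begin

text \<open>The theorem rests on two facts about a complete affine theory \<open>T\<close>.

  \<^item> Every extremal model \<open>M\<close> has an elementary embedding into every compact model \<open>N\<close>
    (\<open>extremal_embeds_into_compact\<close>).
  \<^item> Every compact model has an elementary submodel that is extremal
    (\<open>compact_model_has_extremal_submodel\<close>).

  Suppose these are known, and let \<open>C\<close> be a compact model.  An extremal model \<open>M\<close> embeds isometrically
  into \<open>C\<close>, so it is compact, being complete.  It also embeds into each of its elementary submodels,
  which are compact too; but an isometry of a compact metric space into itself is onto, so \<open>M\<close> is
  minimal.  Conversely, a compact minimal model coincides with the extremal elementary submodel that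
  it has.  Two extremal models embed into each other, and the same property of isometries makes
  these embeddings isomorphisms.  Compact metric spaces are separable.

  For the first fact, let \<open>p\<close> be an extreme \<open>n\<close>-type.  By Hahn--Banach \<open>p\<close> extends to a positive
  functional \<open>\<mu>\<close> on the bounded functions on the \<open>n\<close>-tuples of \<open>N\<close>.  If \<open>0 \<le> h \<le> 1\<close>, then \<open>p\<close> is the sum of
  \<open>\<phi> \<mapsto> \<mu> (h \<phi>)\<close> and \<open>\<phi> \<mapsto> \<mu> ((1 - h) \<phi>)\<close>, so by extremality \<open>\<mu> (h \<phi>) = \<mu> h * p \<phi>\<close>.  It follows that
  \<open>\<mu> ((\<phi> - p \<phi>)\<^sup>2) = 0\<close> for all \<open>\<phi>\<close>, which forces tuples at which finitely many given \<open>\<phi>\<close> come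
  arbitrarily close to \<open>p \<phi>\<close>.  Compactness of the space of all maps from \<open>M\<close> to \<open>N\<close> turns these
  approximations into one elementary embedding.

  For the second fact, consider the space of all maps from \<open>C\<close> to \<open>C\<close>, with the functions given by
  formulas about finitely many values of a map.  The maps that respect a fixed choice of maximum
  points for the suprema are the common zeros of nonnegative functions.  A version of Krein--Milman
  gives one of them, \<open>h\<close>, whose evaluation is an extreme state; the closure of its range is an
  elementary submodel by the Tarski--Vaught test.  That each tuple in this closure has an extreme
  type needs an argument, since neither restrictions nor limits of extreme points are extreme in
  general.  Here a decomposition of the type of a tuple lifts to a decomposition of the evaluation at \<open>h\<close>
  together with the tuple, because suprema provide a least formula about the tuple alone above any
  formula about both; and formulas are Lipschitz, so that what the two parts do near the range of \<open>h\<close>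
  decides what they do on its closure.

  Finally, entailment refers to models whose points are sequences of formulas.  By downward
  Loewenheim--Skolem it can be tested in any one model, on any type (\<open>entails_le_iff\<close>).\<close>

section \<open>Formulas as bounded Lipschitz functions of valuations\<close>

definition valns :: "('a, 'c, 'f, 'r) lstruct \<Rightarrow> (nat \<Rightarrow> 'a) set" where
  "valns M = {v. \<forall>k. v k \<in> carr M}"

lemma valns_app: "v \<in> valns M \<Longrightarrow> v k \<in> carr M"
  by (simp add: valns_def)

lemma valns_upd: "v \<in> valns M \<Longrightarrow> a \<in> carr M \<Longrightarrow> v(i := a) \<in> valns M"
  by (simp add: valns_def)

lemma structure_nonempty: "is_structure L M \<Longrightarrow> carr M \<noteq> {}"
  by (simp add: is_structure_def)

lemma structure_mcomplete: "is_structure L M \<Longrightarrow> mcomplete_of (metr M)"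
  by (simp add: is_structure_def)

lemma structure_mdist_le_1:
  "is_structure L M \<Longrightarrow> a \<in> carr M \<Longrightarrow> b \<in> carr M \<Longrightarrow> mdist (metr M) a b \<le> 1"
  by (simp add: is_structure_def)

lemma structure_const: "is_structure L M \<Longrightarrow> c \<in> const_syms L \<Longrightarrow> const_int M c \<in> carr M"
  by (simp add: is_structure_def)

lemma structure_fun:
  "is_structure L M \<Longrightarrow> F \<in> fun_syms L \<Longrightarrow> as \<in> tuples M (fun_arity L F) \<Longrightarrow> fun_int M F as \<in> carr M"
  by (simp add: is_structure_def)

lemma structure_fun_lipschitz:
  "is_structure L M \<Longrightarrow> F \<in> fun_syms L \<Longrightarrow>
    as \<in> tuples M (fun_arity L F) \<Longrightarrow> bs \<in> tuples M (fun_arity L F) \<Longrightarrow>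
    mdist (metr M) (fun_int M F as) (fun_int M F bs) \<le> fun_lip L F * tuple_dist M (fun_arity L F) as bs"
  by (simp add: is_structure_def)

lemma structure_rel_le_1:
  "is_structure L M \<Longrightarrow> R \<in> rel_syms L \<Longrightarrow> as \<in> tuples M (rel_arity L R) \<Longrightarrow> \<bar>rel_int M R as\<bar> \<le> 1"
  by (simp add: is_structure_def)

lemma structure_rel_lipschitz:
  "is_structure L M \<Longrightarrow> R \<in> rel_syms L \<Longrightarrow>
    as \<in> tuples M (rel_arity L R) \<Longrightarrow> bs \<in> tuples M (rel_arity L R) \<Longrightarrow>
    \<bar>rel_int M R as - rel_int M R bs\<bar> \<le> rel_lip L R * tuple_dist M (rel_arity L R) as bs"
  by (simp add: is_structure_def)

lemma structureI:
  assumes "carr M \<noteq> {}" and "mcomplete_of (metr M)"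
    and "\<And>a b. a \<in> carr M \<Longrightarrow> b \<in> carr M \<Longrightarrow> mdist (metr M) a b \<le> 1"
    and "\<And>c. c \<in> const_syms L \<Longrightarrow> const_int M c \<in> carr M"
    and "\<And>F as. F \<in> fun_syms L \<Longrightarrow> as \<in> tuples M (fun_arity L F) \<Longrightarrow> fun_int M F as \<in> carr M"
    and "\<And>F as bs. F \<in> fun_syms L \<Longrightarrow>
      as \<in> tuples M (fun_arity L F) \<Longrightarrow> bs \<in> tuples M (fun_arity L F) \<Longrightarrow>
      mdist (metr M) (fun_int M F as) (fun_int M F bs) \<le> fun_lip L F * tuple_dist M (fun_arity L F) as bs"
    and "\<And>R as. R \<in> rel_syms L \<Longrightarrow> as \<in> tuples M (rel_arity L R) \<Longrightarrow> \<bar>rel_int M R as\<bar> \<le> 1"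
    and "\<And>R as bs. R \<in> rel_syms L \<Longrightarrow>
      as \<in> tuples M (rel_arity L R) \<Longrightarrow> bs \<in> tuples M (rel_arity L R) \<Longrightarrow>
      \<bar>rel_int M R as - rel_int M R bs\<bar> \<le> rel_lip L R * tuple_dist M (rel_arity L R) as bs"
  shows "is_structure L M"
  unfolding is_structure_def using assms by simp

lemma finite_vars_trm: "finite (vars_trm t)"
  by (induction t) auto

lemma finite_free_vars: "finite (free_vars \<phi>)"
  by (induction \<phi>) (auto simp: finite_vars_trm)

lemma eval_trm_cong:
  "(\<And>k. k \<in> vars_trm t \<Longrightarrow> v k = w k) \<Longrightarrow> eval_trm M v t = eval_trm M w t"
proof (induction t)
  case (App F ts)
  then have "map (eval_trm M v) ts = map (eval_trm M w) ts" by auto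
  then show ?case by (simp only: eval_trm.simps)
qed auto

lemma map_eval_trm_cong:
  "(\<And>k. k \<in> (\<Union>t\<in>set ts. vars_trm t) \<Longrightarrow> v k = w k) \<Longrightarrow> map (eval_trm M v) ts = map (eval_trm M w) ts"
  by (auto intro!: eval_trm_cong)

lemma eval_fm_cong:
  "(\<And>k. k \<in> free_vars \<phi> \<Longrightarrow> v k = w k) \<Longrightarrow> eval_fm M v \<phi> = eval_fm M w \<phi>"
proof (induction \<phi> arbitrary: v w)
  case (Dist t u)
  then show ?case using eval_trm_cong[of t v w M] eval_trm_cong[of u v w M] by simp
next
  case (Rel R ts)
  have "map (eval_trm M v) ts = map (eval_trm M w) ts"
    by (rule map_eval_trm_cong, rule Rel) (simp only: free_vars.simps)
  then show ?case by (simp only: eval_fm.simps)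
next
  case (Add \<phi> \<psi>)
  have "eval_fm M v \<phi> = eval_fm M w \<phi>" by (rule Add.IH(1), rule Add.prems) simp
  moreover have "eval_fm M v \<psi> = eval_fm M w \<psi>" by (rule Add.IH(2), rule Add.prems) simp
  ultimately show ?case by simp
next
  case (Scale r \<phi>)
  have "eval_fm M v \<phi> = eval_fm M w \<phi>" by (rule Scale.IH, rule Scale.prems) simp
  then show ?case by simp
next
  case (SupQ i \<phi>)
  then have "eval_fm M (v(i := a)) \<phi> = eval_fm M (w(i := a)) \<phi>" for a
    by (intro SupQ.IH) auto
  then show ?case by simp
next
  case (InfQ i \<phi>)
  then have "eval_fm M (v(i := a)) \<phi> = eval_fm M (w(i := a)) \<phi>" for a
    by (intro InfQ.IH) auto
  then show ?case by simp
qed auto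

lemma eval_trm_in:
  assumes "is_structure L M"
  shows "wf_trm L t \<Longrightarrow> v \<in> valns M \<Longrightarrow> eval_trm M v t \<in> carr M"
proof (induction t)
  case (App F ts)
  then have "map (eval_trm M v) ts \<in> tuples M (fun_arity L F)"
    by (auto simp: tuples_def)
  with App.prems assms show ?case by (auto simp: is_structure_def)
next
  case (Var i)
  then show ?case by (simp add: valns_app)
next
  case (Cst c)
  then show ?case using assms by (simp add: is_structure_def)
qed

lemma map_eval_trm_in:
  assumes "is_structure L M" "\<forall>t\<in>set ts. wf_trm L t" "v \<in> valns M"
  shows "map (eval_trm M v) ts \<in> tuples M (length ts)"
  using eval_trm_in[OF assms(1) _ assms(3)] assms(2) by (auto simp: tuples_def)

lemma tuple_dist_le:
  assumes "\<And>i. i < n \<Longrightarrow> mdist (metr M) (as ! i) (bs ! i) \<le> l i * \<delta>"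
  shows "tuple_dist M n as bs \<le> (\<Sum>i<n. (1/2)^i * l i) * \<delta>"
  unfolding tuple_dist_def sum_distrib_right
  by (intro sum_mono) (use assms in \<open>simp add: mult.assoc mult_left_mono\<close>)

text \<open>The coordinate distances are bounded by one \<open>\<delta>\<close> instead of being summed with the weights of the
  tuple metric: in this form the estimate passes through quantifiers unchanged, and through tuples
  of terms with a change of the constant \<open>l\<close> only.\<close>

definition lip_bound ::
  "('a, 'c, 'f, 'r) lstruct \<Rightarrow> nat set \<Rightarrow> ((nat \<Rightarrow> 'a) \<Rightarrow> (nat \<Rightarrow> 'a) \<Rightarrow> real) \<Rightarrow> real \<Rightarrow> bool" where
  "lip_bound M X D l \<longleftrightarrow> 0 \<le> l \<and> (\<forall>v\<in>valns M. \<forall>w\<in>valns M. \<forall>\<delta>\<ge>0.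
     (\<forall>k\<in>X. mdist (metr M) (v k) (w k) \<le> \<delta>) \<longrightarrow> D v w \<le> l * \<delta>)"

lemma lip_boundI:
  assumes "0 \<le> l"
    and "\<And>v w \<delta>. v \<in> valns M \<Longrightarrow> w \<in> valns M \<Longrightarrow> 0 \<le> \<delta> \<Longrightarrow>
      (\<forall>k\<in>X. mdist (metr M) (v k) (w k) \<le> \<delta>) \<Longrightarrow> D v w \<le> l * \<delta>"
  shows "lip_bound M X D l"
  using assms by (simp add: lip_bound_def)

lemma lip_boundD:
  assumes "lip_bound M X D l"
  shows "0 \<le> l"
    and "v \<in> valns M \<Longrightarrow> w \<in> valns M \<Longrightarrow> 0 \<le> \<delta> \<Longrightarrow>
      (\<forall>k\<in>X. mdist (metr M) (v k) (w k) \<le> \<delta>) \<Longrightarrow> D v w \<le> l * \<delta>"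
  using assms by (simp_all add: lip_bound_def)

abbreviation trm_lip :: "('a, 'c, 'f, 'r) lstruct \<Rightarrow> ('c, 'f) trm \<Rightarrow> real \<Rightarrow> bool" where
  "trm_lip M t \<equiv> lip_bound M (vars_trm t) (\<lambda>v w. mdist (metr M) (eval_trm M v t) (eval_trm M w t))"

abbreviation fm_lip :: "('a, 'c, 'f, 'r) lstruct \<Rightarrow> ('c, 'f, 'r) fm \<Rightarrow> real \<Rightarrow> bool" where
  "fm_lip M \<phi> \<equiv> lip_bound M (free_vars \<phi>) (\<lambda>v w. \<bar>eval_fm M v \<phi> - eval_fm M w \<phi>\<bar>)"

lemma map_eval_trm_lipschitz:
  assumes "\<forall>t\<in>set ts. \<exists>l. trm_lip M t l"
  shows "\<exists>l. lip_bound M (\<Union>t\<in>set ts. vars_trm t)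
    (\<lambda>v w. tuple_dist M (length ts) (map (eval_trm M v) ts) (map (eval_trm M w) ts)) l"
proof -
  obtain l where l: "\<And>t. t \<in> set ts \<Longrightarrow> trm_lip M t (l t)" using assms by metis
  have "lip_bound M (\<Union>t\<in>set ts. vars_trm t)
      (\<lambda>v w. tuple_dist M (length ts) (map (eval_trm M v) ts) (map (eval_trm M w) ts))
      (\<Sum>i<length ts. (1/2)^i * l (ts ! i))"
  proof (rule lip_boundI)
    show "0 \<le> (\<Sum>i<length ts. (1/2)^i * l (ts ! i))"
      using lip_boundD(1)[OF l] by (intro sum_nonneg) auto
    fix v w \<delta> assume vw: "v \<in> valns M" "w \<in> valns M" "0 \<le> \<delta>"
      and k: "\<forall>k\<in>(\<Union>t\<in>set ts. vars_trm t). mdist (metr M) (v k) (w k) \<le> \<delta>"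
    show "tuple_dist M (length ts) (map (eval_trm M v) ts) (map (eval_trm M w) ts)
        \<le> (\<Sum>i<length ts. (1/2)^i * l (ts ! i)) * \<delta>"
    proof (rule tuple_dist_le)
      fix i assume i: "i < length ts"
      then have t: "ts ! i \<in> set ts" by simp
      then have "mdist (metr M) (eval_trm M v (ts ! i)) (eval_trm M w (ts ! i)) \<le> l (ts ! i) * \<delta>"
        using k by (intro lip_boundD(2)[OF l[OF t] vw]) blast
      then show "mdist (metr M) (map (eval_trm M v) ts ! i) (map (eval_trm M w) ts ! i) \<le> l (ts ! i) * \<delta>"
        using i by simp
    qed
  qed
  then show ?thesis by blast
qed

lemma eval_trm_lipschitz:
  assumes L: "is_language L" and M: "is_structure L M"
  shows "wf_trm L t \<Longrightarrow> \<exists>l. trm_lip M t l"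
proof (induction t)
  case (Var i)
  show ?case by (rule exI[of _ 1], rule lip_boundI) auto
next
  case (Cst c)
  then have "mdist (metr M) (const_int M c) (const_int M c) = 0"
    using M by (simp add: is_structure_def)
  then show ?case by (intro exI[of _ 0] lip_boundI) auto
next
  case (App F ts)
  then have F: "F \<in> fun_syms L" "length ts = fun_arity L F" and wf: "\<forall>t\<in>set ts. wf_trm L t"
    by auto
  have F0: "fun_lip L F \<ge> 0" using L F by (auto simp: is_language_def)
  obtain l where l: "lip_bound M (\<Union>t\<in>set ts. vars_trm t)
      (\<lambda>v w. tuple_dist M (length ts) (map (eval_trm M v) ts) (map (eval_trm M w) ts)) l"
    using map_eval_trm_lipschitz[of ts M] App.IH wf by blast
  have "trm_lip M (App F ts) (fun_lip L F * l)"
  proof (rule lip_boundI)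
    show "0 \<le> fun_lip L F * l" using F0 lip_boundD(1)[OF l] by simp
    fix v w \<delta> assume v: "v \<in> valns M" and w: "w \<in> valns M" and \<delta>: "0 \<le> \<delta>"
      and k: "\<forall>k\<in>vars_trm (App F ts). mdist (metr M) (v k) (w k) \<le> \<delta>"
    have "mdist (metr M) (eval_trm M v (App F ts)) (eval_trm M w (App F ts))
      \<le> fun_lip L F * tuple_dist M (length ts) (map (eval_trm M v) ts) (map (eval_trm M w) ts)"
      using structure_fun_lipschitz[OF M F(1)] F(2) map_eval_trm_in[OF M wf v] map_eval_trm_in[OF M wf w]
      by simp
    also have "\<dots> \<le> fun_lip L F * (l * \<delta>)"
      using k by (intro mult_left_mono[OF lip_boundD(2)[OF l v w \<delta>] F0]) simp
    finally show "mdist (metr M) (eval_trm M v (App F ts)) (eval_trm M w (App F ts)) \<le> fun_lip L F * l * \<delta>"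
      by (simp add: mult.assoc)
  qed
  then show ?case by blast
qed

lemma mdist_diff_le:
  assumes "a \<in> mspace m" "a' \<in> mspace m" "b \<in> mspace m" "b' \<in> mspace m"
  shows "\<bar>mdist m a b - mdist m a' b'\<bar> \<le> mdist m a a' + mdist m b b'"
proof -
  have "mdist m a b \<le> mdist m a a' + mdist m a' b" "mdist m a' b \<le> mdist m a' b' + mdist m b' b"
    "mdist m a' b' \<le> mdist m a' a + mdist m a b'" "mdist m a b' \<le> mdist m a b + mdist m b b'"
    using assms by (auto intro!: mdist_triangle)
  then show ?thesis
    by (simp add: abs_le_iff mdist_commute[of m a' a] mdist_commute[of m b' b])
qed

text \<open>Infima are treated as negated suprema from here on, so that the Tarski--Vaught test and the
  Skolem witnesses below deal with \<open>SupQ\<close> alone.\<close>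

lemma eval_InfQ: "eval_fm M v (InfQ i \<phi>) = - eval_fm M v (SupQ i (Scale (-1) \<phi>))"
proof -
  have "uminus ` (\<lambda>a. - eval_fm M (v(i := a)) \<phi>) ` carr M = (\<lambda>a. eval_fm M (v(i := a)) \<phi>) ` carr M"
    by (auto simp: image_image)
  then show ?thesis by (simp add: Inf_real_def image_image)
qed

lemma eval_fm_bounded:
  assumes M: "is_structure L M"
  shows "wf_fm L \<phi> \<Longrightarrow> \<exists>b. \<forall>v\<in>valns M. \<bar>eval_fm M v \<phi>\<bar> \<le> b"
proof (induction \<phi>)
  case (Dist t u)
  then show ?case using M eval_trm_in[OF M, of t] eval_trm_in[OF M, of u]
    by (intro exI[of _ 1]) (auto simp: is_structure_def)
next
  case (Rel R ts)
  then have "\<forall>v\<in>valns M. map (eval_trm M v) ts \<in> tuples M (rel_arity L R)"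
    using map_eval_trm_in[OF M, of ts] by auto
  with Rel M show ?case by (intro exI[of _ 1]) (auto simp: is_structure_def)
next
  case (Scale r \<phi>)
  then obtain b where "\<forall>v\<in>valns M. \<bar>eval_fm M v \<phi>\<bar> \<le> b" by auto
  then show ?case by (intro exI[of _ "\<bar>r\<bar> * b"]) (auto simp: abs_mult mult_left_mono)
next
  case (Add \<phi> \<psi>)
  then obtain b c where "\<forall>v\<in>valns M. \<bar>eval_fm M v \<phi>\<bar> \<le> b" "\<forall>v\<in>valns M. \<bar>eval_fm M v \<psi>\<bar> \<le> c"
    by auto
  then show ?case by (intro exI[of _ "b + c"]) (auto intro: order_trans[OF abs_triangle_ineq] add_mono)
next
  case (SupQ i \<phi>)
  then obtain b where b: "\<forall>v\<in>valns M. \<bar>eval_fm M v \<phi>\<bar> \<le> b" by auto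
  have "\<bar>eval_fm M v (SupQ i \<phi>)\<bar> \<le> b" if "v \<in> valns M" for v
    unfolding eval_fm.simps
    by (rule cSup_abs_le) (use structure_nonempty[OF M] b valns_upd[OF that] in blast)+
  then show ?case by blast
next
  case (InfQ i \<phi>)
  then obtain b where b: "\<forall>v\<in>valns M. \<bar>eval_fm M v \<phi>\<bar> \<le> b" by auto
  have "\<bar>eval_fm M v (InfQ i \<phi>)\<bar> \<le> b" if "v \<in> valns M" for v
    unfolding eval_fm.simps
    by (rule cInf_abs_ge) (use structure_nonempty[OF M] b valns_upd[OF that] in blast)+
  then show ?case by blast
qed auto

lemma eval_SupQ_upper:
  assumes M: "is_structure L M" and "wf_fm L \<phi>" and v: "v \<in> valns M" and a: "a \<in> carr M"
  shows "eval_fm M (v(i := a)) \<phi> \<le> eval_fm M v (SupQ i \<phi>)"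
proof -
  obtain b where b: "\<forall>v\<in>valns M. \<bar>eval_fm M v \<phi>\<bar> \<le> b"
    using eval_fm_bounded[OF assms(1,2)] by auto
  have "bdd_above ((\<lambda>a. eval_fm M (v(i := a)) \<phi>) ` carr M)"
    using b valns_upd[OF v] by (intro bdd_aboveI2[of _ _ b]) (auto simp: abs_le_iff)
  then show ?thesis unfolding eval_fm.simps by (rule cSUP_upper[OF a])
qed

lemma eval_SupQ_least:
  assumes "is_structure L M" "\<And>a. a \<in> carr M \<Longrightarrow> eval_fm M (v(i := a)) \<phi> \<le> c"
  shows "eval_fm M v (SupQ i \<phi>) \<le> c"
  using structure_nonempty[OF assms(1)] assms(2) by (simp add: cSUP_least)

lemma SupQ_lipschitz:
  assumes M: "is_structure L M" and wf: "wf_fm L \<phi>" and l: "fm_lip M \<phi> l"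
  shows "fm_lip M (SupQ i \<phi>) l"
proof (rule lip_boundI)
  have le: "eval_fm M v (SupQ i \<phi>) \<le> eval_fm M w (SupQ i \<phi>) + l * \<delta>"
    if v: "v \<in> valns M" and w: "w \<in> valns M" and \<delta>: "\<delta> \<ge> 0"
      and k: "\<forall>k\<in>free_vars (SupQ i \<phi>). mdist (metr M) (v k) (w k) \<le> \<delta>" for v w \<delta>
  proof (rule eval_SupQ_least[OF M])
    fix a assume a: "a \<in> carr M"
    have "\<forall>k\<in>free_vars \<phi>. mdist (metr M) ((v(i := a)) k) ((w(i := a)) k) \<le> \<delta>"
      using k \<delta> mdist_zero[OF a a] by auto
    from lip_boundD(2)[OF l valns_upd[OF v a] valns_upd[OF w a] \<delta> this] eval_SupQ_upper[OF M wf w a, of i]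
    show "eval_fm M (v(i := a)) \<phi> \<le> eval_fm M w (SupQ i \<phi>) + l * \<delta>" by linarith
  qed
  show "0 \<le> l" by (rule lip_boundD(1)[OF l])
  fix v w \<delta> assume *: "v \<in> valns M" "w \<in> valns M" "0 \<le> \<delta>"
    "\<forall>k\<in>free_vars (SupQ i \<phi>). mdist (metr M) (v k) (w k) \<le> \<delta>"
  moreover from this have "\<forall>k\<in>free_vars (SupQ i \<phi>). mdist (metr M) (w k) (v k) \<le> \<delta>"
    by (metis mdist_commute)
  ultimately show "\<bar>eval_fm M v (SupQ i \<phi>) - eval_fm M w (SupQ i \<phi>)\<bar> \<le> l * \<delta>"
    using le[OF *] le[of w v \<delta>] by linarith
qed

lemma Scale_lipschitz:
  assumes l: "fm_lip M \<phi> l"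
  shows "fm_lip M (Scale r \<phi>) (\<bar>r\<bar> * l)"
proof (rule lip_boundI)
  show "0 \<le> \<bar>r\<bar> * l" using lip_boundD(1)[OF l] by simp
  fix v w \<delta> assume "v \<in> valns M" "w \<in> valns M" "0 \<le> \<delta>"
    "\<forall>k\<in>free_vars (Scale r \<phi>). mdist (metr M) (v k) (w k) \<le> \<delta>"
  then have "\<bar>r\<bar> * \<bar>eval_fm M v \<phi> - eval_fm M w \<phi>\<bar> \<le> \<bar>r\<bar> * (l * \<delta>)"
    by (intro mult_left_mono lip_boundD(2)[OF l]) auto
  then show "\<bar>eval_fm M v (Scale r \<phi>) - eval_fm M w (Scale r \<phi>)\<bar> \<le> \<bar>r\<bar> * l * \<delta>"
    by (simp add: abs_mult[symmetric] algebra_simps)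
qed

lemma eval_fm_lipschitz:
  assumes L: "is_language L" and M: "is_structure L M"
  shows "wf_fm L \<phi> \<Longrightarrow> \<exists>l. fm_lip M \<phi> l"
proof (induction \<phi>)
  case (Const r)
  then show ?case by (intro exI[of _ 0] lip_boundI) auto
next
  case (Dist t u)
  then have t: "wf_trm L t" and u: "wf_trm L u" by auto
  obtain l1 l2 where l1: "trm_lip M t l1" and l2: "trm_lip M u l2"
    using eval_trm_lipschitz[OF L M] t u by blast
  have "fm_lip M (Dist t u) (l1 + l2)"
  proof (rule lip_boundI)
    show "0 \<le> l1 + l2" using lip_boundD(1)[OF l1] lip_boundD(1)[OF l2] by simp
    fix v w \<delta> assume v: "v \<in> valns M" and w: "w \<in> valns M" and \<delta>: "0 \<le> \<delta>"
      and k: "\<forall>k\<in>free_vars (Dist t u). mdist (metr M) (v k) (w k) \<le> \<delta>"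
    note in_carr = eval_trm_in[OF M t v] eval_trm_in[OF M t w] eval_trm_in[OF M u v] eval_trm_in[OF M u w]
    show "\<bar>eval_fm M v (Dist t u) - eval_fm M w (Dist t u)\<bar> \<le> (l1 + l2) * \<delta>"
      using mdist_diff_le[OF in_carr] lip_boundD(2)[OF l1 v w \<delta>] lip_boundD(2)[OF l2 v w \<delta>] k
      by (simp add: distrib_right)
  qed
  then show ?case by blast
next
  case (Rel R ts)
  then have R: "R \<in> rel_syms L" "length ts = rel_arity L R" and wf: "\<forall>t\<in>set ts. wf_trm L t"
    by auto
  have R0: "rel_lip L R \<ge> 0" using L R by (auto simp: is_language_def)
  obtain l where l: "lip_bound M (\<Union>t\<in>set ts. vars_trm t)
      (\<lambda>v w. tuple_dist M (length ts) (map (eval_trm M v) ts) (map (eval_trm M w) ts)) l"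
    using map_eval_trm_lipschitz[of ts M] eval_trm_lipschitz[OF L M] wf by blast
  have "fm_lip M (Rel R ts) (rel_lip L R * l)"
  proof (rule lip_boundI)
    show "0 \<le> rel_lip L R * l" using R0 lip_boundD(1)[OF l] by simp
    fix v w \<delta> assume v: "v \<in> valns M" and w: "w \<in> valns M" and \<delta>: "0 \<le> \<delta>"
      and k: "\<forall>k\<in>free_vars (Rel R ts). mdist (metr M) (v k) (w k) \<le> \<delta>"
    have "\<bar>eval_fm M v (Rel R ts) - eval_fm M w (Rel R ts)\<bar>
      \<le> rel_lip L R * tuple_dist M (length ts) (map (eval_trm M v) ts) (map (eval_trm M w) ts)"
      using structure_rel_lipschitz[OF M R(1)] R(2) map_eval_trm_in[OF M wf v] map_eval_trm_in[OF M wf w]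
      by simp
    also have "\<dots> \<le> rel_lip L R * (l * \<delta>)"
      using k by (intro mult_left_mono[OF lip_boundD(2)[OF l v w \<delta>] R0]) simp
    finally show "\<bar>eval_fm M v (Rel R ts) - eval_fm M w (Rel R ts)\<bar> \<le> rel_lip L R * l * \<delta>"
      by (simp add: mult.assoc)
  qed
  then show ?case by blast
next
  case (Scale r \<phi>)
  then show ?case using Scale_lipschitz[of M \<phi>] by auto
next
  case (Add \<phi> \<psi>)
  then obtain l1 l2 where l1: "fm_lip M \<phi> l1" and l2: "fm_lip M \<psi> l2" by auto
  have "fm_lip M (Add \<phi> \<psi>) (l1 + l2)"
  proof (rule lip_boundI)
    show "0 \<le> l1 + l2" using lip_boundD(1)[OF l1] lip_boundD(1)[OF l2] by simp
    fix v w \<delta> assume vw: "v \<in> valns M" "w \<in> valns M" "0 \<le> \<delta>"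
      "\<forall>k\<in>free_vars (Add \<phi> \<psi>). mdist (metr M) (v k) (w k) \<le> \<delta>"
    show "\<bar>eval_fm M v (Add \<phi> \<psi>) - eval_fm M w (Add \<phi> \<psi>)\<bar> \<le> (l1 + l2) * \<delta>"
      using lip_boundD(2)[OF l1 vw(1-3)] lip_boundD(2)[OF l2 vw(1-3)] vw(4) by (simp add: distrib_right)
  qed
  then show ?case by blast
next
  case (SupQ i \<phi>)
  then show ?case using SupQ_lipschitz[OF M, of \<phi>] by auto
next
  case (InfQ i \<phi>)
  then have wf: "wf_fm L (Scale (-1) \<phi>)" by simp
  obtain l where "fm_lip M \<phi> l" using InfQ by auto
  from SupQ_lipschitz[OF M wf Scale_lipschitz[OF this], of i]
  show ?case unfolding eval_InfQ by (intro exI[of _ "\<bar>-1\<bar> * l"]) (simp add: lip_bound_def abs_minus_commute)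
qed

section \<open>Renaming and closing formulas\<close>

fun rename_trm :: "(nat \<Rightarrow> nat) \<Rightarrow> ('c, 'f) trm \<Rightarrow> ('c, 'f) trm" where
  "rename_trm f (Var i) = Var (f i)"
| "rename_trm f (Cst c) = Cst c"
| "rename_trm f (App F ts) = App F (map (rename_trm f) ts)"

definition fresh_for :: "(nat \<Rightarrow> nat) \<Rightarrow> ('c, 'f, 'r) fm \<Rightarrow> nat" where
  "fresh_for f \<phi> = Suc (Max (insert 0 (f ` free_vars \<phi>)))"

text \<open>The map \<open>f\<close> need not be injective: identifying free variables is what turns a formula evaluated
  along \<open>\<sigma>\<close> into one in which variables with the same value under \<open>\<sigma>\<close> coincide.  Capture is avoided by
  binding a variable beyond all images of free variables.\<close>

fun rename :: "(nat \<Rightarrow> nat) \<Rightarrow> ('c, 'f, 'r) fm \<Rightarrow> ('c, 'f, 'r) fm" where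
  "rename f (Const r) = Const r"
| "rename f (Dist t u) = Dist (rename_trm f t) (rename_trm f u)"
| "rename f (Rel R ts) = Rel R (map (rename_trm f) ts)"
| "rename f (Scale r \<phi>) = Scale r (rename f \<phi>)"
| "rename f (Add \<phi> \<psi>) = Add (rename f \<phi>) (rename f \<psi>)"
| "rename f (SupQ i \<phi>) = SupQ (fresh_for f \<phi>) (rename (f(i := fresh_for f \<phi>)) \<phi>)"
| "rename f (InfQ i \<phi>) = InfQ (fresh_for f \<phi>) (rename (f(i := fresh_for f \<phi>)) \<phi>)"

lemma less_fresh_for: "k \<in> free_vars \<phi> \<Longrightarrow> f k < fresh_for f \<phi>"
  unfolding fresh_for_def using finite_free_vars[of \<phi>] by (simp add: less_Suc_eq_le)

lemma wf_rename_trm: "wf_trm L t \<Longrightarrow> wf_trm L (rename_trm f t)"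
  by (induction t) auto

lemma wf_rename: "wf_fm L \<phi> \<Longrightarrow> wf_fm L (rename f \<phi>)"
  by (induction \<phi> arbitrary: f) (auto simp: wf_rename_trm)

lemma vars_rename_trm: "vars_trm (rename_trm f t) = f ` vars_trm t"
  by (induction t) auto

lemma free_vars_rename: "free_vars (rename f \<phi>) \<subseteq> f ` free_vars \<phi>"
proof (induction \<phi> arbitrary: f)
  case (SupQ i \<phi>)
  let ?g = "f(i := fresh_for f \<phi>)"
  have "free_vars (rename ?g \<phi>) \<subseteq> ?g ` free_vars \<phi>" by (rule SupQ)
  moreover have "?g ` free_vars \<phi> - {fresh_for f \<phi>} \<subseteq> f ` (free_vars \<phi> - {i})" by auto
  ultimately show ?case by auto
next
  case (InfQ i \<phi>)
  let ?g = "f(i := fresh_for f \<phi>)"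
  have "free_vars (rename ?g \<phi>) \<subseteq> ?g ` free_vars \<phi>" by (rule InfQ)
  moreover have "?g ` free_vars \<phi> - {fresh_for f \<phi>} \<subseteq> f ` (free_vars \<phi> - {i})" by auto
  ultimately show ?case by auto
next
  case (Add \<phi> \<psi>)
  then show ?case by (simp add: image_Un) blast
qed (auto simp: vars_rename_trm)

lemma eval_rename_trm: "eval_trm M v (rename_trm f t) = eval_trm M (v \<circ> f) t"
proof (induction t)
  case (App F ts)
  then have "map (eval_trm M v) (map (rename_trm f) ts) = map (eval_trm M (v \<circ> f)) ts"
    by (simp add: comp_def)
  then show ?case by (simp only: eval_trm.simps rename_trm.simps)
qed auto

lemma eval_rename_upd:
  "eval_fm M (v(fresh_for f \<phi> := a) \<circ> f(i := fresh_for f \<phi>)) \<phi> = eval_fm M ((v \<circ> f)(i := a)) \<phi>"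
proof (rule eval_fm_cong)
  fix k assume "k \<in> free_vars \<phi>"
  then have "f k < fresh_for f \<phi>" by (rule less_fresh_for)
  then show "(v(fresh_for f \<phi> := a) \<circ> f(i := fresh_for f \<phi>)) k = ((v \<circ> f)(i := a)) k" by simp
qed

lemma eval_rename: "eval_fm M v (rename f \<phi>) = eval_fm M (v \<circ> f) \<phi>"
proof (induction \<phi> arbitrary: v f)
  case (Rel R ts)
  have "map (eval_trm M v) (map (rename_trm f) ts) = map (eval_trm M (v \<circ> f)) ts"
    by (simp add: eval_rename_trm)
  then show ?case by (simp only: eval_fm.simps rename.simps)
next
  case (SupQ i \<phi>)
  then show ?case by (simp only: rename.simps eval_fm.simps eval_rename_upd)
next
  case (InfQ i \<phi>)
  then show ?case by (simp only: rename.simps eval_fm.simps eval_rename_upd)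
qed (simp_all add: eval_rename_trm)

text \<open>Closing a formula under suprema over all variables from \<open>n\<close> on gives the least formula in the
  first \<open>n\<close> variables above it.  For \<open>n = 0\<close> this turns inequalities between formulas into sentences;
  for general \<open>n\<close> it is the reason why decompositions of types lift to more variables.\<close>

primrec sup_range :: "nat \<Rightarrow> nat \<Rightarrow> ('c, 'f, 'r) fm \<Rightarrow> ('c, 'f, 'r) fm" where
  "sup_range n 0 \<phi> = \<phi>"
| "sup_range n (Suc k) \<phi> = SupQ (n + k) (sup_range n k \<phi>)"

definition sup_above :: "nat \<Rightarrow> ('c, 'f, 'r) fm \<Rightarrow> ('c, 'f, 'r) fm" where
  "sup_above n \<phi> = sup_range n (fresh_for id \<phi>) \<phi>"

lemma wf_sup_range: "wf_fm L \<phi> \<Longrightarrow> wf_fm L (sup_range n k \<phi>)"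
  by (induction k) auto

lemma free_vars_sup_range: "free_vars (sup_range n k \<phi>) = free_vars \<phi> - {n..<n + k}"
proof (induction k)
  case (Suc k)
  have "{n..<n + Suc k} = insert (n + k) {n..<n + k}" by auto
  then show ?case by (simp only: sup_range.simps free_vars.simps Suc) blast
qed simp

lemma sup_above_formulas: "wf_fm L \<phi> \<Longrightarrow> sup_above n \<phi> \<in> formulas L n"
proof -
  have "k < n" if "k \<in> free_vars \<phi>" "k \<notin> {n..<n + fresh_for id \<phi>}" for k
  proof -
    have "k < fresh_for id \<phi>" using less_fresh_for[OF that(1), of id] by (simp only: id_apply)
    with that(2) show ?thesis by auto
  qed
  then show "wf_fm L \<phi> \<Longrightarrow> sup_above n \<phi> \<in> formulas L n"
    by (auto simp: formulas_def sup_above_def wf_sup_range free_vars_sup_range)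
qed

lemma sup_range_upper:
  assumes M: "is_structure L M" and wf: "wf_fm L \<phi>"
  shows "v \<in> valns M \<Longrightarrow> w \<in> valns M \<Longrightarrow> (\<And>i. i \<notin> {n..<n + k} \<Longrightarrow> v i = w i) \<Longrightarrow>
    eval_fm M w \<phi> \<le> eval_fm M v (sup_range n k \<phi>)"
proof (induction k arbitrary: v)
  case 0
  then have "v = w" by auto
  then show ?case by simp
next
  case (Suc k)
  have "eval_fm M w \<phi> \<le> eval_fm M (v(n + k := w (n + k))) (sup_range n k \<phi>)"
    using Suc.prems by (intro Suc.IH valns_upd) (auto simp: valns_app)
  also have "\<dots> \<le> eval_fm M v (sup_range n (Suc k) \<phi>)"
    unfolding sup_range.simps
    by (rule eval_SupQ_upper[OF M wf_sup_range[OF wf] Suc.prems(1) valns_app[OF Suc.prems(2)]])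
  finally show ?case .
qed

lemma sup_range_least:
  assumes M: "is_structure L M"
  shows "v \<in> valns M \<Longrightarrow>
    (\<And>w. w \<in> valns M \<Longrightarrow> (\<forall>i. i \<notin> {n..<n + k} \<longrightarrow> v i = w i) \<Longrightarrow> eval_fm M w \<phi> \<le> c) \<Longrightarrow>
    eval_fm M v (sup_range n k \<phi>) \<le> c"
proof (induction k arbitrary: v)
  case 0
  then show ?case by simp
next
  case (Suc k)
  show ?case
    unfolding sup_range.simps
  proof (rule eval_SupQ_least[OF M])
    fix a assume a: "a \<in> carr M"
    show "eval_fm M (v(n + k := a)) (sup_range n k \<phi>) \<le> c"
    proof (rule Suc.IH)
      fix w assume "w \<in> valns M" and w: "\<forall>i. i \<notin> {n..<n + k} \<longrightarrow> (v(n + k := a)) i = w i"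
      moreover have "\<forall>i. i \<notin> {n..<n + Suc k} \<longrightarrow> v i = w i"
      proof (intro allI impI)
        fix i assume "i \<notin> {n..<n + Suc k}"
        then show "v i = w i" using w[rule_format, of i] by auto
      qed
      ultimately show "eval_fm M w \<phi> \<le> c" by (intro Suc.prems(2))
    qed (rule valns_upd[OF Suc.prems(1) a])
  qed
qed

lemma sup_above_upper:
  assumes M: "is_structure L M" and wf: "wf_fm L \<phi>" and v: "v \<in> valns M" and w: "w \<in> valns M"
    and agree: "\<And>i. i < n \<Longrightarrow> v i = w i"
  shows "eval_fm M w \<phi> \<le> eval_fm M v (sup_above n \<phi>)"
proof -
  let ?k = "fresh_for id \<phi>"
  let ?w = "\<lambda>i. if i \<in> {n..<n + ?k} then w i else v i"
  have "eval_fm M w \<phi> = eval_fm M ?w \<phi>"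
  proof (rule eval_fm_cong)
    fix i assume "i \<in> free_vars \<phi>"
    then show "w i = ?w i" using less_fresh_for[of i \<phi> id] agree[of i] by auto
  qed
  also have "\<dots> \<le> eval_fm M v (sup_above n \<phi>)"
    unfolding sup_above_def
    by (rule sup_range_upper[OF M wf v]) (use v w in \<open>auto simp: valns_def\<close>)
  finally show ?thesis .
qed

lemma sup_above_least:
  assumes M: "is_structure L M" and v: "v \<in> valns M"
    and le: "\<And>w. w \<in> valns M \<Longrightarrow> (\<forall>i<n. v i = w i) \<Longrightarrow> eval_fm M w \<phi> \<le> c"
  shows "eval_fm M v (sup_above n \<phi>) \<le> c"
  unfolding sup_above_def by (rule sup_range_least[OF M v]) (auto intro!: le)

text \<open>Padding with a point \<open>d\<close> of the carrier keeps all values of the valuation in the carrier, as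
  membership in \<open>valns\<close> requires; the entries beyond the end of a list are unspecified.\<close>

definition valuation_of :: "'a \<Rightarrow> 'a list \<Rightarrow> nat \<Rightarrow> 'a" where
  "valuation_of d as = (\<lambda>i. if i < length as then as ! i else d)"

lemma valuation_of_valns: "d \<in> carr M \<Longrightarrow> set as \<subseteq> carr M \<Longrightarrow> valuation_of d as \<in> valns M"
  by (auto simp: valns_def valuation_of_def)

lemma value_at_valuation_of:
  assumes "\<phi> \<in> formulas L (length as)"
  shows "value_at M \<phi> as = eval_fm M (valuation_of d as) \<phi>"
  unfolding value_at_def
  by (rule eval_fm_cong) (use assms in \<open>auto simp: formulas_def valuation_of_def\<close>)

lemma value_at_eval:
  assumes "\<phi> \<in> formulas L n" "length as = n" "\<And>i. i < n \<Longrightarrow> v i = as ! i"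
  shows "value_at M \<phi> as = eval_fm M v \<phi>"
  unfolding value_at_def
  by (rule eval_fm_cong) (use assms in \<open>auto simp: formulas_def\<close>)

section \<open>The Tarski--Vaught test\<close>

definition closed_substructure ::
  "('a, 'c, 'f, 'r) lstruct \<Rightarrow> 'a set \<Rightarrow> ('a, 'c, 'f, 'r) lstruct" where
  "closed_substructure M D = M\<lparr>metr := submetric (metr M) (mtopology_of (metr M) closure_of D)\<rparr>"

lemma closure_of_metric:
  "x \<in> mtopology_of m closure_of D \<longleftrightarrow>
     x \<in> mspace m \<and> (\<forall>r>0. \<exists>y\<in>D. y \<in> mspace m \<and> mdist m x y < r)"
proof -
  interpret Metric_space "mspace m" "mdist m" by (rule Metric_space_mspace_mdist)
  show ?thesis unfolding mtopology_of_def metric_closure_of by (auto simp: in_mball)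
qed

lemma carr_closed_substructure:
  "carr (closed_substructure M D) = mtopology_of (metr M) closure_of D"
  by (auto simp: closed_substructure_def closure_of_metric)

lemma closed_substructure_simps [simp]:
  "mdist (metr (closed_substructure M D)) = mdist (metr M)"
  "const_int (closed_substructure M D) = const_int M"
  "fun_int (closed_substructure M D) = fun_int M"
  "rel_int (closed_substructure M D) = rel_int M"
  by (auto simp: closed_substructure_def)

lemma tuple_dist_closed_substructure [simp]:
  "tuple_dist (closed_substructure M D) = tuple_dist M"
  by (auto simp: tuple_dist_def fun_eq_iff)

lemma eval_trm_closed_substructure [simp]:
  "eval_trm (closed_substructure M D) v t = eval_trm M v t"
proof (induction t)
  case (App F ts)
  then have "map (eval_trm (closed_substructure M D) v) ts = map (eval_trm M v) ts" by simp
  then show ?case by (simp only: eval_trm.simps closed_substructure_simps)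
qed auto

text \<open>Witnesses are only asked to be approximate, and only for parameters in \<open>D\<close>: Lipschitz continuity
  extends both to the closure of \<open>D\<close>, which is then the carrier of an elementary submodel.\<close>

definition tarski_vaught_set ::
  "('c, 'f, 'r) language \<Rightarrow> ('a, 'c, 'f, 'r) lstruct \<Rightarrow> 'a set \<Rightarrow> bool" where
  "tarski_vaught_set L M D \<longleftrightarrow> D \<subseteq> carr M \<and> D \<noteq> {} \<and>
     (\<forall>\<phi> i v \<epsilon>. wf_fm L \<phi> \<longrightarrow> range v \<subseteq> D \<longrightarrow> 0 < \<epsilon> \<longrightarrow>
        (\<exists>d\<in>D. eval_fm M v (SupQ i \<phi>) - \<epsilon> \<le> eval_fm M (v(i := d)) \<phi>))"

lemma tarski_vaught_closure:
  assumes L: "is_language L" and M: "is_structure L M" and tv: "tarski_vaught_set L M D"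
    and wf: "wf_fm L \<phi>" and v: "range v \<subseteq> mtopology_of (metr M) closure_of D" and \<epsilon>: "0 < \<epsilon>"
  shows "\<exists>d\<in>D. eval_fm M v (SupQ i \<phi>) - \<epsilon> \<le> eval_fm M (v(i := d)) \<phi>"
proof -
  have D: "D \<subseteq> carr M" using tv by (simp add: tarski_vaught_set_def)
  have vM: "v \<in> valns M" using v by (auto simp: valns_def closure_of_metric subset_iff image_iff)
  obtain l1 l2 where lip1: "fm_lip M (SupQ i \<phi>) l1" and lip2: "fm_lip M \<phi> l2"
    using eval_fm_lipschitz[OF L M, of "SupQ i \<phi>"] eval_fm_lipschitz[OF L M wf] wf by auto
  note l1 = lip_boundD[OF lip1] and l2 = lip_boundD[OF lip2]
  \<comment> \<open>Half of \<open>\<epsilon>\<close> is spent on moving the parameters into \<open>D\<close>, half on the witness there.\<close>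
  define \<delta> where "\<delta> = \<epsilon> / (2 * (1 + l1 + l2))"
  have \<delta>: "\<delta> > 0" using l1(1) l2(1) \<epsilon> by (simp add: \<delta>_def)
  have "(1 + l1 + l2) * \<delta> = \<epsilon> / 2" using l1(1) l2(1) by (simp add: \<delta>_def field_simps)
  then have sum: "l1 * \<delta> + l2 * \<delta> \<le> \<epsilon> / 2" using \<delta> by (simp add: distrib_right)
  have "\<forall>k. \<exists>y. y \<in> D \<and> mdist (metr M) (v k) y < \<delta>"
    using v \<delta> unfolding closure_of_metric subset_iff by blast
  then obtain w where w: "\<And>k. w k \<in> D" "\<And>k. mdist (metr M) (v k) (w k) < \<delta>"
    by metis
  have wM: "w \<in> valns M" using w(1) D by (auto simp: valns_def)
  obtain d where d: "d \<in> D" "eval_fm M w (SupQ i \<phi>) - \<epsilon> / 2 \<le> eval_fm M (w(i := d)) \<phi>"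
    using tv wf w(1) half_gt_zero[OF \<epsilon>] unfolding tarski_vaught_set_def by (meson image_subsetI)
  have dM: "d \<in> carr M" using d(1) D by auto
  have "\<bar>eval_fm M v (SupQ i \<phi>) - eval_fm M w (SupQ i \<phi>)\<bar> \<le> l1 * \<delta>"
    by (rule l1(2)[OF vM wM]) (use \<delta> w(2) in \<open>auto intro: less_imp_le\<close>)
  moreover have "\<bar>eval_fm M (v(i := d)) \<phi> - eval_fm M (w(i := d)) \<phi>\<bar> \<le> l2 * \<delta>"
    by (rule l2(2)[OF valns_upd[OF vM dM] valns_upd[OF wM dM]])
      (use \<delta> w(2) mdist_zero[OF dM dM] in \<open>auto intro: less_imp_le\<close>)
  ultimately show ?thesis using d sum by (intro bexI[of _ d]) linarith+
qed

text \<open>The distance to the value of a term is minimized by that value, so witnesses for the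
  supremum of \<open>- d(t, x)\<close> approximate it.\<close>

lemma eval_trm_in_closure:
  fixes L :: "('c, 'f, 'r) language"
  assumes L: "is_language L" and M: "is_structure L M" and tv: "tarski_vaught_set L M D"
    and wf: "wf_trm L t" and v: "range v \<subseteq> mtopology_of (metr M) closure_of D"
  shows "eval_trm M v t \<in> mtopology_of (metr M) closure_of D"
proof -
  have D: "D \<subseteq> carr M" using tv by (simp add: tarski_vaught_set_def)
  obtain i where i: "i \<notin> vars_trm t" using finite_vars_trm ex_new_if_finite by (metis infinite_UNIV_nat)
  let ?\<phi> = "Scale (-1) (Dist t (Var i)) :: ('c, 'f, 'r) fm"
  have wf': "wf_fm L ?\<phi>" using wf by simp
  have vM: "v \<in> valns M" using v by (auto simp: valns_def closure_of_metric subset_iff image_iff)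
  have e: "eval_trm M v t \<in> carr M" by (rule eval_trm_in[OF M wf vM])
  have upd: "eval_trm M (v(i := a)) t = eval_trm M v t" for a
    by (rule eval_trm_cong) (use i in auto)
  have "0 \<le> eval_fm M v (SupQ i ?\<phi>)"
    using eval_SupQ_upper[OF M wf' vM e, of i] mdist_zero[OF e e] by (simp only: eval_fm.simps upd) simp
  have "\<exists>d\<in>D. d \<in> carr M \<and> mdist (metr M) (eval_trm M v t) d < r" if "r > 0" for r
  proof -
    obtain d where d: "d \<in> D" "eval_fm M v (SupQ i ?\<phi>) - r / 2 \<le> eval_fm M (v(i := d)) ?\<phi>"
      using tarski_vaught_closure[OF L M tv wf' v, of "r/2" i] half_gt_zero[of r] \<open>r > 0\<close> by blast
    have "eval_fm M (v(i := d)) ?\<phi> = - mdist (metr M) (eval_trm M v t) d"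
      by (simp only: eval_fm.simps upd eval_trm.simps fun_upd_same)
    with d \<open>0 \<le> eval_fm M v (SupQ i ?\<phi>)\<close> that D show ?thesis by (intro bexI[of _ d]) auto
  qed
  with e show ?thesis unfolding closure_of_metric by blast
qed

lemma closed_substructure_structure:
  assumes L: "is_language L" and M: "is_structure L M" and tv: "tarski_vaught_set L M D"
  shows "is_structure L (closed_substructure M D)"
proof -
  let ?S = "mtopology_of (metr M) closure_of D"
  have D: "D \<subseteq> carr M" "D \<noteq> {}" using tv by (simp_all add: tarski_vaught_set_def)
  have DS: "D \<subseteq> ?S" using D(1) by (simp add: closure_of_subset)
  then obtain d where d: "d \<in> ?S" using D(2) by auto
  have SM: "?S \<subseteq> carr M" by (auto simp: closure_of_metric)
  note trm = eval_trm_in_closure[OF L M tv]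
  have const: "const_int M c \<in> ?S" if "c \<in> const_syms L" for c
    using trm[of "Cst c" "\<lambda>_. d"] that d by auto
  have func: "fun_int M F as \<in> ?S"
    if F: "F \<in> fun_syms L" and as: "as \<in> tuples (closed_substructure M D) (fun_arity L F)" for F as
  proof -
    have len: "length as = fun_arity L F" and sub: "set as \<subseteq> ?S"
      using as by (auto simp: tuples_def carr_closed_substructure)
    have "eval_trm M (valuation_of d as) (App F (map Var [0..<length as])) \<in> ?S"
      by (rule trm) (use F len sub d in \<open>auto simp: valuation_of_def\<close>)
    moreover have "map (eval_trm M (valuation_of d as)) (map Var [0..<length as]) = as"
      by (rule nth_equalityI) (auto simp: valuation_of_def)
    ultimately show ?thesis by (simp only: eval_trm.simps)
  qed
  have compl: "mcomplete_of (metr (closed_substructure M D))"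
  proof -
    interpret Metric_space "carr M" "mdist (metr M)" by (rule Metric_space_mspace_mdist)
    interpret S: Submetric "carr M" "mdist (metr M)" ?S by unfold_locales (rule SM)
    have "S.sub.mcomplete"
      using M by (intro S.closedin_mcomplete_imp_mcomplete)
        (auto simp: is_structure_def mcomplete_of_def mtopology_of_def)
    then show ?thesis by (simp add: mcomplete_of_def carr_closed_substructure)
  qed
  have tup: "as \<in> tuples M n" if "as \<in> tuples (closed_substructure M D) n" for as n
    using SM that by (auto simp: tuples_def carr_closed_substructure)
  show ?thesis
  proof (rule structureI, unfold closed_substructure_simps tuple_dist_closed_substructure
      carr_closed_substructure)
    show "?S \<noteq> {}" using d by blast
    show "mcomplete_of (metr (closed_substructure M D))" by (rule compl)
    show "mdist (metr M) a b \<le> 1" if "a \<in> ?S" "b \<in> ?S" for a b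
      using structure_mdist_le_1[OF M] SM that by blast
  qed (fact const func structure_fun_lipschitz[OF M _ tup tup] structure_rel_le_1[OF M _ tup]
      structure_rel_lipschitz[OF M _ tup tup])+
qed

lemma eval_fm_closed_substructure:
  assumes L: "is_language L" and M: "is_structure L M" and tv: "tarski_vaught_set L M D"
  shows "wf_fm L \<phi> \<Longrightarrow> v \<in> valns (closed_substructure M D) \<Longrightarrow>
    eval_fm (closed_substructure M D) v \<phi> = eval_fm M v \<phi>"
proof (induction \<phi> arbitrary: v)
  let ?K = "closed_substructure M D"
  have D: "D \<subseteq> carr M" using tv by (simp add: tarski_vaught_set_def)
  have K: "is_structure L ?K" by (rule closed_substructure_structure[OF assms])
  have KM: "v \<in> valns M" if "v \<in> valns ?K" for v
    using that by (auto simp: valns_def carr_closed_substructure closure_of_metric)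
  have DK: "d \<in> carr ?K" if "d \<in> D" for d
    using closure_of_subset[of D "mtopology_of (metr M)"] that D
    by (auto simp: carr_closed_substructure)
  have sup: "eval_fm ?K v (SupQ i \<phi>) = eval_fm M v (SupQ i \<phi>)"
    if wf: "wf_fm L \<phi>" and v: "v \<in> valns ?K"
      and eq: "\<And>w. w \<in> valns ?K \<Longrightarrow> eval_fm ?K w \<phi> = eval_fm M w \<phi>" for \<phi> i v
  proof (rule antisym)
    show "eval_fm ?K v (SupQ i \<phi>) \<le> eval_fm M v (SupQ i \<phi>)"
    proof (rule eval_SupQ_least[OF K])
      fix a assume a: "a \<in> carr ?K"
      then have "a \<in> carr M" by (auto simp: carr_closed_substructure closure_of_metric)
      then show "eval_fm ?K (v(i := a)) \<phi> \<le> eval_fm M v (SupQ i \<phi>)"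
        unfolding eq[OF valns_upd[OF v a]] by (rule eval_SupQ_upper[OF M wf KM[OF v]])
    qed
    show "eval_fm M v (SupQ i \<phi>) \<le> eval_fm ?K v (SupQ i \<phi>)"
    proof (rule field_le_epsilon)
      fix \<epsilon> :: real assume \<epsilon>: "0 < \<epsilon>"
      have "range v \<subseteq> mtopology_of (metr M) closure_of D"
        using v by (auto simp: valns_def carr_closed_substructure)
      then obtain d where d: "d \<in> D" "eval_fm M v (SupQ i \<phi>) - \<epsilon> \<le> eval_fm M (v(i := d)) \<phi>"
        using tarski_vaught_closure[OF L M tv wf _ \<epsilon>] by blast
      have "eval_fm M (v(i := d)) \<phi> \<le> eval_fm ?K v (SupQ i \<phi>)"
        using eval_SupQ_upper[OF K wf v DK[OF d(1)], of i] unfolding eq[OF valns_upd[OF v DK[OF d(1)]]] .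
      with d(2) show "eval_fm M v (SupQ i \<phi>) \<le> eval_fm ?K v (SupQ i \<phi>) + \<epsilon>" by linarith
    qed
  qed
  {
    case (Const r) show ?case by simp
  next
    case (Dist t u) show ?case by simp
  next
    case (Rel R ts)
    have "map (eval_trm ?K v) ts = map (eval_trm M v) ts" by simp
    then show ?case by (simp only: eval_fm.simps closed_substructure_simps)
  next
    case (Scale r \<phi>) then show ?case by simp
  next
    case (Add \<phi> \<psi>) then show ?case by simp
  next
    case (SupQ i \<phi>)
    then show ?case by (intro sup) auto
  next
    case (InfQ i \<phi>)
    then have wf: "wf_fm L \<phi>" by simp
    have "eval_fm ?K v (SupQ i (Scale (-1) \<phi>)) = eval_fm M v (SupQ i (Scale (-1) \<phi>))"
      using InfQ wf by (intro sup) (simp_all del: eval_fm.simps add: eval_fm.simps(4))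
    then show ?case
      unfolding eval_InfQ by simp
  }
qed

theorem tarski_vaught:
  assumes L: "is_language L" and M: "is_structure L M" and tv: "tarski_vaught_set L M D"
  shows "elementary_submodel L (closed_substructure M D) M"
proof -
  let ?K = "closed_substructure M D"
  have K: "is_structure L ?K" by (rule closed_substructure_structure[OF assms])
  obtain d where d: "d \<in> carr ?K" using structure_nonempty[OF K] by auto
  have "value_at ?K \<phi> as = value_at M \<phi> as" if "\<phi> \<in> formulas L n" "as \<in> tuples ?K n" for \<phi> n as
  proof -
    have "\<phi> \<in> formulas L (length as)" "valuation_of d as \<in> valns ?K"
      using that d by (auto simp: tuples_def intro!: valuation_of_valns)
    then show ?thesis
      using eval_fm_closed_substructure[OF assms, of \<phi> "valuation_of d as"]
      by (metis (mono_tags) value_at_valuation_of formulas_def mem_Collect_eq)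
  qed
  moreover have "substructure L ?K M"
    using K M unfolding substructure_def closed_substructure_simps
    by (auto simp: carr_closed_substructure closure_of_metric)
  ultimately show ?thesis by (auto simp: elementary_submodel_def)
qed

section \<open>Copying a structure into another type\<close>

text \<open>The definitions of entailment and completeness speak of models on one particular type.
  Transporting along an injection brings a small enough model to that type.\<close>

definition transport ::
  "('a \<Rightarrow> 'b) \<Rightarrow> ('a, 'c, 'f, 'r) lstruct \<Rightarrow> ('b, 'c, 'f, 'r) lstruct" where
  "transport e M =
     (let g = inv_into (carr M) e in
      \<lparr>metr = metric (e ` carr M, \<lambda>x y. mdist (metr M) (g x) (g y)),
       const_int = (\<lambda>c. e (const_int M c)),
       fun_int = (\<lambda>F as. e (fun_int M F (map g as))),
       rel_int = (\<lambda>R as. rel_int M R (map g as))\<rparr>)"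

context
  fixes L :: "('c, 'f, 'r) language" and M :: "('a, 'c, 'f, 'r) lstruct" and e :: "'a \<Rightarrow> 'b"
  assumes M: "is_structure L M" and inj: "inj_on e (carr M)"
begin

private abbreviation "g \<equiv> inv_into (carr M) e"
private abbreviation "U \<equiv> transport e M"

private lemma g_in: "x \<in> e ` carr M \<Longrightarrow> g x \<in> carr M"
  by (rule inv_into_into)

private lemma e_g: "x \<in> e ` carr M \<Longrightarrow> e (g x) = x"
  by (rule f_inv_into_f)

private lemma g_e: "x \<in> carr M \<Longrightarrow> g (e x) = x"
  by (rule inv_into_f_f[OF inj])

private lemma metric_space_U:
  "Metric_space (e ` carr M) (\<lambda>x y. mdist (metr M) (g x) (g y))"
proof
  fix x y assume x: "x \<in> e ` carr M" and y: "y \<in> e ` carr M"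
  then show "(mdist (metr M) (g x) (g y) = 0) = (x = y)"
    using mdist_zero[OF g_in g_in, of x y] e_g by metis
qed (auto simp: mdist_commute g_in intro!: mdist_triangle)

lemma carr_transport: "carr U = e ` carr M"
  by (simp add: transport_def Let_def Metric_space.mspace_metric[OF metric_space_U])

lemma mdist_transport:
  "x \<in> e ` carr M \<Longrightarrow> y \<in> e ` carr M \<Longrightarrow> mdist (metr U) x y = mdist (metr M) (g x) (g y)"
  by (simp add: transport_def Let_def Metric_space.mdist_metric[OF metric_space_U])

private lemma ints_U:
  "const_int U c = e (const_int M c)" "fun_int U F as = e (fun_int M F (map g as))"
  "rel_int U R as = rel_int M R (map g as)"
  by (simp_all add: transport_def Let_def)

private lemma tuples_U: "as \<in> tuples U n \<Longrightarrow> map g as \<in> tuples M n"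
  unfolding tuples_def carr_transport using g_in by auto

private lemma tuple_dist_U:
  assumes "as \<in> tuples U n" "bs \<in> tuples U n"
  shows "tuple_dist U n as bs = tuple_dist M n (map g as) (map g bs)"
  unfolding tuple_dist_def
proof (rule sum.cong)
  fix i assume "i \<in> {..<n}"
  then have "as ! i \<in> e ` carr M" "bs ! i \<in> e ` carr M" "i < length as" "i < length bs"
    using assms unfolding tuples_def carr_transport by (auto simp: subset_iff)
  then show "(1 / 2) ^ i * mdist (metr U) (as ! i) (bs ! i) =
      (1 / 2) ^ i * mdist (metr M) (map g as ! i) (map g bs ! i)"
    by (simp add: mdist_transport)
qed simp

lemma transport_structure: "is_structure L U"
proof (rule structureI)
  show "carr U \<noteq> {}" using structure_nonempty[OF M] by (simp add: carr_transport)
  show "mcomplete_of (metr U)"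
  proof -
    interpret U: Metric_space "carr U" "mdist (metr U)" by (rule Metric_space_mspace_mdist)
    interpret M: Metric_space "carr M" "mdist (metr M)" by (rule Metric_space_mspace_mdist)
    have "\<exists>x. limitin U.mtopology s x sequentially" if s: "U.MCauchy s" for s
    proof -
      have "range s \<subseteq> carr U" using s unfolding U.MCauchy_def by blast
      then have ran: "s k \<in> e ` carr M" for k unfolding carr_transport by blast
      have "M.MCauchy (g \<circ> s)"
        unfolding M.MCauchy_def
      proof (intro conjI allI impI)
        show "range (g \<circ> s) \<subseteq> carr M" using g_in[OF ran] by auto
        fix r :: real assume "r > 0"
        with s show "\<exists>N. \<forall>n n'. N \<le> n \<longrightarrow> N \<le> n' \<longrightarrow> mdist (metr M) ((g \<circ> s) n) ((g \<circ> s) n') < r"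
          unfolding U.MCauchy_def mdist_transport[OF ran ran] comp_apply by blast
      qed
      moreover have "M.mcomplete" using structure_mcomplete[OF M] by (simp add: mcomplete_of_def)
      ultimately obtain x where x: "limitin M.mtopology (g \<circ> s) x sequentially"
        unfolding M.mcomplete_def by blast
      then have xM: "x \<in> carr M" by (rule M.limitin_mspace)
      have "mdist (metr U) (s n) (e x) = mdist (metr M) ((g \<circ> s) n) x" for n
        using mdist_transport[OF ran, of "e x"] xM g_e[OF xM] by simp
      then have "limitin U.mtopology s (e x) sequentially"
        using x xM ran unfolding U.limit_metric_sequentially M.limit_metric_sequentially
        by (auto simp: carr_transport) meson
      then show ?thesis by blast
    qed
    then show ?thesis by (auto simp: mcomplete_of_def U.mcomplete_def)
  qed
  show "mdist (metr U) a b \<le> 1" if "a \<in> carr U" "b \<in> carr U" for a b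
    using that structure_mdist_le_1[OF M g_in g_in] by (simp add: carr_transport mdist_transport)
  show "const_int U c \<in> carr U" if "c \<in> const_syms L" for c
    using structure_const[OF M that] by (simp add: ints_U carr_transport)
  have F: "fun_int M F (map g as) \<in> carr M" if "F \<in> fun_syms L" "as \<in> tuples U (fun_arity L F)" for F as
    using structure_fun[OF M that(1) tuples_U[OF that(2)]] .
  then show "fun_int U F as \<in> carr U" if "F \<in> fun_syms L" "as \<in> tuples U (fun_arity L F)" for F as
    using that by (simp add: ints_U carr_transport)
  show "mdist (metr U) (fun_int U F as) (fun_int U F bs) \<le> fun_lip L F * tuple_dist U (fun_arity L F) as bs"
    if "F \<in> fun_syms L" "as \<in> tuples U (fun_arity L F)" "bs \<in> tuples U (fun_arity L F)" for F as bs
    using structure_fun_lipschitz[OF M that(1) tuples_U[OF that(2)] tuples_U[OF that(3)]]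
      F[OF that(1,2)] F[OF that(1,3)]
    by (simp add: ints_U mdist_transport g_e tuple_dist_U[OF that(2,3)])
  show "\<bar>rel_int U R as\<bar> \<le> 1" if "R \<in> rel_syms L" "as \<in> tuples U (rel_arity L R)" for R as
    using structure_rel_le_1[OF M that(1) tuples_U[OF that(2)]] by (simp add: ints_U)
  show "\<bar>rel_int U R as - rel_int U R bs\<bar> \<le> rel_lip L R * tuple_dist U (rel_arity L R) as bs"
    if "R \<in> rel_syms L" "as \<in> tuples U (rel_arity L R)" "bs \<in> tuples U (rel_arity L R)" for R as bs
    using structure_rel_lipschitz[OF M that(1) tuples_U[OF that(2)] tuples_U[OF that(3)]]
    by (simp add: ints_U tuple_dist_U[OF that(2,3)])
qed

private lemma eval_trm_U:
  "wf_trm L t \<Longrightarrow> v \<in> valns U \<Longrightarrow> eval_trm U v t = e (eval_trm M (g \<circ> v) t)"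
proof (induction t)
  case (Var i)
  then show ?case using e_g by (simp add: valns_def carr_transport)
next
  case (Cst c)
  then show ?case by (simp add: ints_U)
next
  case (App F ts)
  have "g \<circ> v \<in> valns M" using App.prems g_in by (auto simp: valns_def carr_transport)
  then have "map g (map (eval_trm U v) ts) = map (eval_trm M (g \<circ> v)) ts"
    using App eval_trm_in[OF M, of _ "g \<circ> v"] by (simp add: g_e comp_def)
  then show ?case by (simp only: eval_trm.simps ints_U)
qed

lemma eval_fm_transport:
  "wf_fm L \<phi> \<Longrightarrow> v \<in> valns U \<Longrightarrow> eval_fm U v \<phi> = eval_fm M (g \<circ> v) \<phi>"
proof (induction \<phi> arbitrary: v)
  case (Dist t u)
  have "g \<circ> v \<in> valns M" using Dist.prems g_in by (auto simp: valns_def carr_transport)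
  then show ?case
    using Dist eval_trm_in[OF M, of t "g \<circ> v"] eval_trm_in[OF M, of u "g \<circ> v"]
    by (simp add: eval_trm_U mdist_transport g_e comp_def)
next
  case (Rel R ts)
  have "g \<circ> v \<in> valns M" using Rel.prems g_in by (auto simp: valns_def carr_transport)
  then have "map g (map (eval_trm U v) ts) = map (eval_trm M (g \<circ> v)) ts"
    using Rel eval_trm_in[OF M, of _ "g \<circ> v"] by (simp add: g_e eval_trm_U comp_def)
  then show ?case by (simp only: eval_fm.simps ints_U)
next
  case (SupQ i \<phi>)
  have "eval_fm U (v(i := e a)) \<phi> = eval_fm M ((g \<circ> v)(i := a)) \<phi>" if a: "a \<in> carr M" for a
  proof -
    have "g \<circ> v(i := e a) = (g \<circ> v)(i := a)" using g_e[OF a] by auto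
    moreover have "eval_fm U (v(i := e a)) \<phi> = eval_fm M (g \<circ> v(i := e a)) \<phi>"
      using SupQ.prems a by (intro SupQ.IH valns_upd) (simp_all add: carr_transport)
    ultimately show ?thesis by (simp only:)
  qed
  then show ?case by (simp add: carr_transport image_image comp_def)
next
  case (InfQ i \<phi>)
  have "eval_fm U (v(i := e a)) \<phi> = eval_fm M ((g \<circ> v)(i := a)) \<phi>" if a: "a \<in> carr M" for a
  proof -
    have "g \<circ> v(i := e a) = (g \<circ> v)(i := a)" using g_e[OF a] by auto
    moreover have "eval_fm U (v(i := e a)) \<phi> = eval_fm M (g \<circ> v(i := e a)) \<phi>"
      using InfQ.prems a by (intro InfQ.IH valns_upd) (simp_all add: carr_transport)
    ultimately show ?thesis by (simp only:)
  qed
  then show ?case by (simp add: carr_transport image_image comp_def)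
qed simp_all

end

section \<open>Downward Loewenheim--Skolem\<close>

text \<open>The guard makes the description satisfiable for all arguments, so that the value always lies
  in the carrier.\<close>

definition witness ::
  "('c, 'f, 'r) language \<Rightarrow> ('a, 'c, 'f, 'r) lstruct \<Rightarrow> real \<Rightarrow> nat \<Rightarrow> ('c, 'f, 'r) fm \<Rightarrow>
     (nat \<Rightarrow> 'a) \<Rightarrow> 'a" where
  "witness L M \<epsilon> i \<phi> v = (SOME d. d \<in> carr M \<and>
     (wf_fm L \<phi> \<and> v \<in> valns M \<and> 0 < \<epsilon> \<longrightarrow> eval_fm M v (SupQ i \<phi>) - \<epsilon> \<le> eval_fm M (v(i := d)) \<phi>))"

lemma witness:
  assumes M: "is_structure L M"
  shows "witness L M \<epsilon> i \<phi> v \<in> carr M"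
    and "wf_fm L \<phi> \<Longrightarrow> v \<in> valns M \<Longrightarrow> 0 < \<epsilon> \<Longrightarrow>
      eval_fm M v (SupQ i \<phi>) - \<epsilon> \<le> eval_fm M (v(i := witness L M \<epsilon> i \<phi> v)) \<phi>"
proof -
  have "\<exists>d. d \<in> carr M \<and>
     (wf_fm L \<phi> \<and> v \<in> valns M \<and> 0 < \<epsilon> \<longrightarrow> eval_fm M v (SupQ i \<phi>) - \<epsilon> \<le> eval_fm M (v(i := d)) \<phi>)"
  proof (cases "0 < \<epsilon>")
    case True
    have "\<exists>d\<in>carr M. eval_fm M v (SupQ i \<phi>) - \<epsilon> \<le> eval_fm M (v(i := d)) \<phi>"
    proof (rule ccontr)
      assume "\<not> ?thesis"
      then have "eval_fm M v (SupQ i \<phi>) \<le> eval_fm M v (SupQ i \<phi>) - \<epsilon>"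
        by (intro eval_SupQ_least[OF M]) force
      with True show False by simp
    qed
    then show ?thesis by blast
  next
    case False
    then show ?thesis using structure_nonempty[OF M] by blast
  qed
  from someI_ex[OF this] show "witness L M \<epsilon> i \<phi> v \<in> carr M"
    "wf_fm L \<phi> \<Longrightarrow> v \<in> valns M \<Longrightarrow> 0 < \<epsilon> \<Longrightarrow>
      eval_fm M v (SupQ i \<phi>) - \<epsilon> \<le> eval_fm M (v(i := witness L M \<epsilon> i \<phi> v)) \<phi>"
    unfolding witness_def by blast+
qed

definition base_point :: "('a, 'c, 'f, 'r) lstruct \<Rightarrow> 'a" where
  "base_point M = (SOME a. a \<in> carr M)"

lemma base_point: "is_structure L M \<Longrightarrow> base_point M \<in> carr M"
  unfolding base_point_def using structure_nonempty by (metis some_in_eq)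

text \<open>A dense subset of the copy has to be indexed by formulas, so the iterated Skolem witnesses are
  coded by formulas: \<open>Add\<close> and \<open>Const 0\<close> serve as list constructors, and
  \<open>Scale r (Add (SupQ i \<phi>) \<xi>)\<close> codes a witness, up to the error \<open>r\<close>, for the supremum of \<open>\<phi>\<close> over
  its variable \<open>i\<close>, with the points coded by the list \<open>\<xi>\<close> as parameters.\<close>

fun skolem ::
  "('c, 'f, 'r) language \<Rightarrow> ('a, 'c, 'f, 'r) lstruct \<Rightarrow> ('c, 'f, 'r) fm \<Rightarrow> 'a list" where
  "skolem L M (Scale r (Add (SupQ i \<phi>) \<xi>)) =
     [witness L M r i \<phi> (valuation_of (base_point M) (skolem L M \<xi>))]"
| "skolem L M (Add \<xi> \<psi>) = valuation_of (base_point M) (skolem L M \<xi>) 0 # skolem L M \<psi>"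
| "skolem L M _ = []"

definition skolem_point ::
  "('c, 'f, 'r) language \<Rightarrow> ('a, 'c, 'f, 'r) lstruct \<Rightarrow> ('c, 'f, 'r) fm \<Rightarrow> 'a" where
  "skolem_point L M \<xi> = valuation_of (base_point M) (skolem L M \<xi>) 0"

primrec code_list :: "('c, 'f, 'r) fm list \<Rightarrow> ('c, 'f, 'r) fm" where
  "code_list [] = Const 0"
| "code_list (\<xi> # \<xi>s) = Add \<xi> (code_list \<xi>s)"

lemma skolem_code_list: "skolem L M (code_list \<xi>s) = map (skolem_point L M) \<xi>s"
  by (induction \<xi>s) (auto simp: skolem_point_def)

lemma skolem_in: "is_structure L M \<Longrightarrow> set (skolem L M \<xi>) \<subseteq> carr M"
proof (induction L M \<xi> rule: skolem.induct)
  case (1 L M r i \<phi> \<xi>)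
  then show ?case by (simp add: witness(1))
next
  case (2 L M \<xi> \<psi>)
  then show ?case using base_point[of L M] by (auto simp: valuation_of_def)
qed simp_all

lemma skolem_point_in: "is_structure L M \<Longrightarrow> skolem_point L M \<xi> \<in> carr M"
  using skolem_in[of L M \<xi>] base_point[of L M] by (auto simp: skolem_point_def valuation_of_def)

lemma tarski_vaught_skolem_points:
  fixes L :: "('c, 'f, 'r) language" and M :: "('a, 'c, 'f, 'r) lstruct"
  assumes M: "is_structure L M"
  shows "tarski_vaught_set L M (range (skolem_point L M))"
  unfolding tarski_vaught_set_def
proof (intro conjI allI impI)
  fix \<phi> :: "('c, 'f, 'r) fm" and i :: nat and v :: "nat \<Rightarrow> 'a" and \<epsilon> :: real
  assume wf: "wf_fm L \<phi>" and v: "range v \<subseteq> range (skolem_point L M)" and \<epsilon>: "0 < \<epsilon>"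
  have "\<forall>k. \<exists>\<xi>. v k = skolem_point L M \<xi>" using v by blast
  then obtain c where c: "\<And>k. v k = skolem_point L M (c k)" by metis
  define m where "m = fresh_for id \<phi>"
  define \<xi>s where "\<xi>s = map c [0..<m]"
  define w where "w = valuation_of (base_point M) (map (skolem_point L M) \<xi>s)"
  have w: "w \<in> valns M"
    unfolding w_def using skolem_point_in[OF M] by (intro valuation_of_valns base_point[OF M]) auto
  have "w k = v k" if "k < m" for k
    using that c by (simp add: w_def \<xi>s_def valuation_of_def)
  moreover have "k < m" if "k \<in> free_vars \<phi>" for k
    using less_fresh_for[OF that, of id] by (simp add: m_def)
  ultimately have "eval_fm M (w(i := a)) \<phi> = eval_fm M (v(i := a)) \<phi>" for a
    by (intro eval_fm_cong) simp
  then have eq: "eval_fm M (w(i := a)) \<phi> = eval_fm M (v(i := a)) \<phi>"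
    "eval_fm M w (SupQ i \<phi>) = eval_fm M v (SupQ i \<phi>)" for a
    by simp_all
  have "skolem_point L M (Scale \<epsilon> (Add (SupQ i \<phi>) (code_list \<xi>s))) = witness L M \<epsilon> i \<phi> w"
    by (simp add: skolem_point_def valuation_of_def skolem_code_list w_def)
  then show "\<exists>d\<in>range (skolem_point L M). eval_fm M v (SupQ i \<phi>) - \<epsilon> \<le> eval_fm M (v(i := d)) \<phi>"
    using witness(2)[OF M wf w \<epsilon>, of i] unfolding eq by (metis rangeI)
qed (use skolem_point_in[OF M] in auto)

text \<open>The closure of the Skolem points is an elementary submodel.  Each of its points is determined by
  a sequence of codes whose points converge to it, hence the injection into sequences of formulas.\<close>

theorem downward_loewenheim_skolem:
  fixes L :: "('c, 'f, 'r) language" and M :: "('a, 'c, 'f, 'r) lstruct"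
  assumes L: "is_language L" and M: "is_structure L M"
  obtains U :: "('c, 'f, 'r) universal_struct"
  where "is_structure L U" "\<And>\<sigma>. \<sigma> \<in> sentences L \<Longrightarrow> value_at U \<sigma> [] = value_at M \<sigma> []"
proof -
  define K where "K = closed_substructure M (range (skolem_point L M))"
  have el: "elementary_submodel L K M"
    unfolding K_def by (rule tarski_vaught[OF L M tarski_vaught_skolem_points[OF M]])
  then have K: "is_structure L K" by (simp add: elementary_submodel_def substructure_def)
  have "\<forall>x\<in>carr K. \<exists>s. \<forall>n. mdist (metr M) x (skolem_point L M (s n)) < 1 / Suc n"
  proof
    fix x assume "x \<in> carr K"
    then have "\<exists>\<xi>. mdist (metr M) x (skolem_point L M \<xi>) < 1 / Suc n" for n
      unfolding K_def carr_closed_substructure closure_of_metric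
      by (auto dest!: conjunct2 spec[of _ "1 / Suc n"])
    then show "\<exists>s. \<forall>n. mdist (metr M) x (skolem_point L M (s n)) < 1 / Suc n" by metis
  qed
  then obtain e where e: "\<And>x n. x \<in> carr K \<Longrightarrow> mdist (metr M) x (skolem_point L M (e x n)) < 1 / Suc n"
    by metis
  have KM: "carr K \<subseteq> carr M" by (auto simp: K_def carr_closed_substructure closure_of_metric)
  have "inj_on e (carr K)"
  proof (rule inj_onI, rule ccontr)
    fix x y assume x: "x \<in> carr K" and y: "y \<in> carr K" and eq: "e x = e y" and neq: "x \<noteq> y"
    have "x \<in> carr M" "y \<in> carr M" using KM x y by auto
    with neq have "mdist (metr M) x y > 0" by (simp add: less_le)
    then obtain n where n: "1 / Suc n < mdist (metr M) x y / 2"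
      using nat_approx_posE[of "mdist (metr M) x y / 2"] by auto
    let ?z = "skolem_point L M (e x n)"
    have "mdist (metr M) x y \<le> mdist (metr M) x ?z + mdist (metr M) ?z y"
      using KM x y skolem_point_in[OF M] by (intro mdist_triangle) auto
    then show False using e[OF x, of n] e[OF y, of n] eq n mdist_commute[of "metr M" ?z y] by simp
  qed
  note U = transport_structure[OF K this] eval_fm_transport[OF K this]
  obtain d where d: "d \<in> carr K" using structure_nonempty[OF K] by auto
  have "value_at (transport e K) \<sigma> [] = value_at M \<sigma> []" if \<sigma>: "\<sigma> \<in> sentences L" for \<sigma>
  proof -
    have wf: "wf_fm L \<sigma>" using \<sigma> by (simp add: formulas_def)
    have v: "(\<lambda>_. e d) \<in> valns (transport e K)"
      using d by (simp add: valns_def carr_transport[OF K \<open>inj_on e (carr K)\<close>])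
    have "value_at (transport e K) \<sigma> [] = eval_fm (transport e K) (\<lambda>_. e d) \<sigma>"
      by (rule value_at_eval[OF \<sigma>]) simp_all
    also have "\<dots> = value_at K \<sigma> []"
      unfolding U(2)[OF wf v] by (rule value_at_eval[OF \<sigma>, symmetric]) simp_all
    also have "\<dots> = value_at M \<sigma> []"
      using el \<sigma> by (simp add: elementary_submodel_def tuples_def)
    finally show ?thesis .
  qed
  with U(1) that show thesis by blast
qed

section \<open>Complete theories are decided by any one model\<close>

lemma value_at_Add: "value_at M (Add \<phi> \<psi>) as = value_at M \<phi> as + value_at M \<psi> as"
  by (simp add: value_at_def)

lemma value_at_Scale: "value_at M (Scale r \<phi>) as = r * value_at M \<phi> as"
  by (simp add: value_at_def)

lemma value_at_Const: "value_at M (Const r) as = r"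
  by (simp add: value_at_def)

lemma formulas_intros:
  "Const r \<in> formulas L n"
  "\<phi> \<in> formulas L n \<Longrightarrow> \<psi> \<in> formulas L n \<Longrightarrow> Add \<phi> \<psi> \<in> formulas L n"
  "\<phi> \<in> formulas L n \<Longrightarrow> Scale r \<phi> \<in> formulas L n"
  by (auto simp: formulas_def)

lemma le_iff_sentence:
  assumes M: "is_structure L M" and \<phi>: "\<phi> \<in> formulas L n" and \<psi>: "\<psi> \<in> formulas L n"
  shows "(\<forall>as\<in>tuples M n. value_at M \<phi> as \<le> value_at M \<psi> as) \<longleftrightarrow>
    value_at M (sup_above 0 (Add \<phi> (Scale (-1) \<psi>))) [] \<le> 0"
proof -
  let ?\<theta> = "Add \<phi> (Scale (-1) \<psi>)"
  have wf: "wf_fm L ?\<theta>" and form: "?\<theta> \<in> formulas L n" using \<phi> \<psi> by (auto simp: formulas_def)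
  note base = base_point[OF M]
  let ?b = "\<lambda>_::nat. base_point M"
  have b: "?b \<in> valns M" using base by (simp add: valns_def)
  have val: "value_at M (sup_above 0 ?\<theta>) [] = eval_fm M ?b (sup_above 0 ?\<theta>)"
    using value_at_eval[OF sup_above_formulas[OF wf, of 0], of "[]" ?b M] by simp
  show ?thesis
  proof
    assume le: "\<forall>as\<in>tuples M n. value_at M \<phi> as \<le> value_at M \<psi> as"
    show "value_at M (sup_above 0 ?\<theta>) [] \<le> 0"
      unfolding val
    proof (rule sup_above_least[OF M b])
      fix w assume w: "w \<in> valns M"
      then have t: "map w [0..<n] \<in> tuples M n" by (auto simp: tuples_def valns_def)
      have "value_at M \<phi> (map w [0..<n]) = eval_fm M w \<phi>" "value_at M \<psi> (map w [0..<n]) = eval_fm M w \<psi>"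
        by (rule value_at_eval[OF \<phi>] value_at_eval[OF \<psi>]; simp)+
      with le t show "eval_fm M w ?\<theta> \<le> 0" by fastforce
    qed
  next
    assume le: "value_at M (sup_above 0 ?\<theta>) [] \<le> 0"
    show "\<forall>as\<in>tuples M n. value_at M \<phi> as \<le> value_at M \<psi> as"
    proof
      fix as assume as: "as \<in> tuples M n"
      let ?w = "valuation_of (base_point M) as"
      have w: "?w \<in> valns M" using as base by (auto simp: tuples_def intro!: valuation_of_valns)
      have "eval_fm M ?w ?\<theta> \<le> eval_fm M ?b (sup_above 0 ?\<theta>)"
        by (rule sup_above_upper[OF M wf b w]) simp
      moreover have "value_at M ?\<theta> as = eval_fm M ?w ?\<theta>"
        by (rule value_at_eval[OF form]) (use as in \<open>auto simp: tuples_def valuation_of_def\<close>)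
      ultimately show "value_at M \<phi> as \<le> value_at M \<psi> as"
        using le unfolding val by (simp add: value_at_Add value_at_Scale)
    qed
  qed
qed

lemma universal_copy:
  fixes L :: "('c, 'f, 'r) language"
  assumes L: "is_language L" and T: "is_theory L T" and M: "is_model L T M"
  obtains U :: "('c, 'f, 'r) universal_struct"
  where "is_model L T U" "\<And>\<sigma>. \<sigma> \<in> sentences L \<Longrightarrow> value_at U \<sigma> [] = value_at M \<sigma> []"
proof -
  have "is_structure L M" using M by (simp add: is_model_def)
  then obtain U :: "('c, 'f, 'r) universal_struct" where U: "is_structure L U"
    "\<And>\<sigma>. \<sigma> \<in> sentences L \<Longrightarrow> value_at U \<sigma> [] = value_at M \<sigma> []"
    using downward_loewenheim_skolem[OF L] by metis
  have "is_model L T U"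
    unfolding is_model_def
  proof (intro conjI U(1) ballI, clarify)
    fix \<sigma> \<tau> assume "(\<sigma>, \<tau>) \<in> T"
    then show "value_at U \<sigma> [] \<le> value_at U \<tau> []"
      using M T U(2)[of \<sigma>] U(2)[of \<tau>] by (fastforce simp: is_model_def is_theory_def)
  qed
  with U(2) that show thesis by blast
qed

lemma complete_theory_value:
  fixes L :: "('c, 'f, 'r) language" and U :: "('c, 'f, 'r) universal_struct"
  assumes L: "is_language L" and T: "is_theory L T" "complete_theory L T"
    and M: "is_model L T M" and U: "is_model L T U" and \<sigma>: "\<sigma> \<in> sentences L"
  shows "value_at M \<sigma> [] = value_at U \<sigma> []"
proof -
  obtain V :: "('c, 'f, 'r) universal_struct" where V: "is_model L T V" "value_at V \<sigma> [] = value_at M \<sigma> []"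
    using universal_copy[OF L T(1) M] \<sigma> by metis
  obtain r where "entails_eq L T 0 \<sigma> (Const r)"
    using T(2) \<sigma> by (auto simp: complete_theory_def)
  then have "value_at W \<sigma> [] = r" if "is_model L T W" for W :: "('c, 'f, 'r) universal_struct"
    using that by (force simp: entails_eq_def entails_le_def tuples_def value_at_Const intro: antisym)
  with V U show ?thesis by metis
qed

text \<open>The inequality says that a certain sentence is at most \<open>0\<close>, and the value of a sentence is the
  same in all models on the type of \<open>universal_struct\<close>, one of which agrees with \<open>M\<close> on sentences.
  Through this lemma, everything below takes place in a single model on an arbitrary type.\<close>

theorem entails_le_iff:
  fixes L :: "('c, 'f, 'r) language"
  assumes L: "is_language L" and T: "is_theory L T" "complete_theory L T"
    and M: "is_model L T M" and \<phi>: "\<phi> \<in> formulas L n" and \<psi>: "\<psi> \<in> formulas L n"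
  shows "entails_le L T n \<phi> \<psi> \<longleftrightarrow> (\<forall>as\<in>tuples M n. value_at M \<phi> as \<le> value_at M \<psi> as)"
proof -
  let ?\<sigma> = "sup_above 0 (Add \<phi> (Scale (-1) \<psi>))"
  have \<sigma>: "?\<sigma> \<in> sentences L" using \<phi> \<psi> by (intro sup_above_formulas) (simp add: formulas_def)
  have iff: "(\<forall>as\<in>tuples W n. value_at W \<phi> as \<le> value_at W \<psi> as) \<longleftrightarrow> value_at M ?\<sigma> [] \<le> 0"
    if W: "is_model L T W" for W :: "('c, 'f, 'r) universal_struct"
    using le_iff_sentence[OF _ \<phi> \<psi>, of W] W complete_theory_value[OF L T M W \<sigma>]
    by (simp add: is_model_def)
  obtain U :: "('c, 'f, 'r) universal_struct" where "is_model L T U"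
    using T(2) by (auto simp: complete_theory_def)
  then have "entails_le L T n \<phi> \<psi> \<longleftrightarrow> value_at M ?\<sigma> [] \<le> 0"
    unfolding entails_le_def using iff by blast
  also have "\<dots> \<longleftrightarrow> (\<forall>as\<in>tuples M n. value_at M \<phi> as \<le> value_at M \<psi> as)"
    using le_iff_sentence[OF _ \<phi> \<psi>, of M] M by (simp add: is_model_def)
  finally show ?thesis .
qed

section \<open>Sublinear functionals on spaces of functions\<close>

definition function_space :: "('x \<Rightarrow> real) set \<Rightarrow> bool" where
  "function_space V \<longleftrightarrow> (\<lambda>_. 0) \<in> V \<and>
     (\<forall>f\<in>V. \<forall>g\<in>V. (\<lambda>x. f x + g x) \<in> V) \<and> (\<forall>c. \<forall>f\<in>V. (\<lambda>x. c * f x) \<in> V)"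

definition linear_functional :: "('x \<Rightarrow> real) set \<Rightarrow> (('x \<Rightarrow> real) \<Rightarrow> real) \<Rightarrow> bool" where
  "linear_functional V p \<longleftrightarrow>
     (\<forall>f\<in>V. \<forall>g\<in>V. p (\<lambda>x. f x + g x) = p f + p g) \<and> (\<forall>c. \<forall>f\<in>V. p (\<lambda>x. c * f x) = c * p f)"

definition sublinear_functional :: "('x \<Rightarrow> real) set \<Rightarrow> (('x \<Rightarrow> real) \<Rightarrow> real) \<Rightarrow> bool" where
  "sublinear_functional V P \<longleftrightarrow>
     (\<forall>f\<in>V. \<forall>g\<in>V. P (\<lambda>x. f x + g x) \<le> P f + P g) \<and>
     (\<forall>c\<ge>0. \<forall>f\<in>V. P (\<lambda>x. c * f x) = c * P f)"

lemma function_spaceD: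
  assumes "function_space V"
  shows "(\<lambda>_. 0) \<in> V" "f \<in> V \<Longrightarrow> g \<in> V \<Longrightarrow> (\<lambda>x. f x + g x) \<in> V" "f \<in> V \<Longrightarrow> (\<lambda>x. c * f x) \<in> V"
  using assms by (auto simp: function_space_def)

lemma linear_functionalD:
  assumes "linear_functional V p"
  shows "f \<in> V \<Longrightarrow> g \<in> V \<Longrightarrow> p (\<lambda>x. f x + g x) = p f + p g"
    "f \<in> V \<Longrightarrow> p (\<lambda>x. c * f x) = c * p f"
  using assms by (auto simp: linear_functional_def)

lemma sublinear_functionalD:
  assumes "sublinear_functional V P"
  shows "f \<in> V \<Longrightarrow> g \<in> V \<Longrightarrow> P (\<lambda>x. f x + g x) \<le> P f + P g"
    "0 \<le> c \<Longrightarrow> f \<in> V \<Longrightarrow> P (\<lambda>x. c * f x) = c * P f"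
  using assms by (auto simp: sublinear_functional_def)

lemma sublinear_zero: "function_space V \<Longrightarrow> sublinear_functional V P \<Longrightarrow> P (\<lambda>_. 0) = 0"
  using sublinear_functionalD(2)[of V P 0 "\<lambda>_. 0"] by (simp add: function_spaceD)

lemma function_space_sum:
  assumes V: "function_space V"
  shows "finite I \<Longrightarrow> (\<And>i. i \<in> I \<Longrightarrow> f i \<in> V) \<Longrightarrow> (\<lambda>x. \<Sum>i\<in>I. f i x) \<in> V"
  by (induction I rule: finite_induct) (auto simp: function_spaceD[OF V])

lemma linear_functional_sum:
  assumes V: "function_space V" and p: "linear_functional V p"
  shows "finite I \<Longrightarrow> (\<And>i. i \<in> I \<Longrightarrow> f i \<in> V) \<Longrightarrow> p (\<lambda>x. \<Sum>i\<in>I. f i x) = (\<Sum>i\<in>I. p (f i))"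
proof (induction I rule: finite_induct)
  case empty
  show ?case using linear_functionalD(2)[OF p function_spaceD(1)[OF V], of 0] by simp
next
  case (insert i I)
  then show ?case
    using linear_functionalD(1)[OF p, of "f i" "\<lambda>x. \<Sum>i\<in>I. f i x"] function_space_sum[OF V, of I f]
    by simp
qed

lemma sublinear_scale:
  assumes "sublinear_functional V P" "0 \<le> c"
  shows "sublinear_functional V (\<lambda>f. c * P f)"
  using assms by (auto simp: sublinear_functional_def mult_left_mono distrib_left[symmetric])

text \<open>Sublinear functionals arise below as infima of sets \<open>A f\<close> of numbers: over a chain of
  functionals, over shifts of the argument, over splittings of it, and over formulas that lie above
  it.  Lower bounds come for free, since \<open>A f\<close> and \<open>A (- f)\<close> add up to something in \<open>A 0\<close>.\<close>

lemma sublinear_Inf: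
  assumes V: "function_space V"
    and ne: "\<And>f. f \<in> V \<Longrightarrow> A f \<noteq> {}"
    and add: "\<And>f g a b. f \<in> V \<Longrightarrow> g \<in> V \<Longrightarrow> a \<in> A f \<Longrightarrow> b \<in> A g \<Longrightarrow>
      \<exists>c\<in>A (\<lambda>x. f x + g x). c \<le> a + b"
    and scale: "\<And>c f a. 0 < c \<Longrightarrow> f \<in> V \<Longrightarrow> a \<in> A f \<Longrightarrow> \<exists>b\<in>A (\<lambda>x. c * f x). b \<le> c * a"
    and zero: "\<exists>a\<in>A (\<lambda>_. 0). a \<le> 0" and nonneg: "\<And>a. a \<in> A (\<lambda>_. 0) \<Longrightarrow> 0 \<le> a"
  shows "sublinear_functional V (\<lambda>f. Inf (A f)) \<and> (\<forall>f\<in>V. \<forall>a\<in>A f. Inf (A f) \<le> a)"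
proof -
  have bdd: "bdd_below (A f)" if f: "f \<in> V" for f
  proof -
    have f': "(\<lambda>x. -1 * f x) \<in> V" using f V by (intro function_spaceD)
    then obtain b where b: "b \<in> A (\<lambda>x. -1 * f x)" using ne by blast
    have "- b \<le> a" if a: "a \<in> A f" for a
    proof -
      obtain c where "c \<in> A (\<lambda>x. f x + -1 * f x)" "c \<le> a + b" using add[OF f f' a b] by blast
      with nonneg[of c] show ?thesis by simp
    qed
    then show ?thesis by (rule bdd_belowI)
  qed
  have lower: "Inf (A f) \<le> a" if "f \<in> V" "a \<in> A f" for f a
    using bdd that by (intro cInf_lower)
  have sc: "Inf (A (\<lambda>x. c * f x)) \<le> c * Inf (A f)" if c: "0 < c" and f: "f \<in> V" for c f
  proof -
    have "Inf (A (\<lambda>x. c * f x)) / c \<le> Inf (A f)"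
    proof (rule cInf_greatest[OF ne[OF f]])
      fix a assume "a \<in> A f"
      then obtain b where b: "b \<in> A (\<lambda>x. c * f x)" "b \<le> c * a" using scale[OF c f] by blast
      then have "Inf (A (\<lambda>x. c * f x)) \<le> c * a"
        using lower[OF function_spaceD(3)[OF V f] b(1)] by simp
      with c show "Inf (A (\<lambda>x. c * f x)) / c \<le> a" by (simp add: field_simps)
    qed
    with c show ?thesis by (simp add: field_simps)
  qed
  have "sublinear_functional V (\<lambda>f. Inf (A f))"
    unfolding sublinear_functional_def
  proof (intro conjI ballI allI impI)
    fix f g assume f: "f \<in> V" and g: "g \<in> V"
    let ?I = "Inf (A (\<lambda>x. f x + g x))"
    have "?I - b \<le> Inf (A f)" if b: "b \<in> A g" for b
    proof (rule cInf_greatest[OF ne[OF f]])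
      fix a assume "a \<in> A f"
      then obtain c where "c \<in> A (\<lambda>x. f x + g x)" "c \<le> a + b" using add[OF f g _ b] by blast
      then show "?I - b \<le> a" using lower[OF function_spaceD(2)[OF V f g], of c] by simp
    qed
    then have "?I - Inf (A f) \<le> Inf (A g)"
      by (intro cInf_greatest[OF ne[OF g]]) (simp add: algebra_simps)
    then show "?I \<le> Inf (A f) + Inf (A g)" by simp
  next
    fix c :: real and f assume c: "0 \<le> c" and f: "f \<in> V"
    show "Inf (A (\<lambda>x. c * f x)) = c * Inf (A f)"
    proof (cases "c = 0")
      case True
      have "Inf (A (\<lambda>_. 0)) \<le> 0" using zero lower[OF function_spaceD(1)[OF V]] by force
      moreover have "0 \<le> Inf (A (\<lambda>_. 0))"
        using nonneg by (intro cInf_greatest[OF ne[OF function_spaceD(1)[OF V]]])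
      ultimately show ?thesis using True by simp
    next
      case False
      with c have c: "0 < c" by simp
      have "Inf (A f) \<le> 1 / c * Inf (A (\<lambda>x. c * f x))"
        using sc[of "1 / c" "\<lambda>x. c * f x"] c function_spaceD(3)[OF V f] by simp
      with sc[OF c f] c show ?thesis by (simp add: field_simps)
    qed
  qed
  with lower show ?thesis by blast
qed

text \<open>For fixed \<open>g\<close> the infimum of \<open>P (f + t g) - t P g\<close> over \<open>t \<ge> 0\<close> is sublinear in \<open>f\<close> and below \<open>P\<close>.
  By minimality it equals \<open>P\<close>, and \<open>t = 1\<close> gives the missing half of additivity.\<close>

lemma minimal_sublinear_is_linear:
  assumes V: "function_space V" and P: "sublinear_functional V P"
    and min: "\<And>Q. sublinear_functional V Q \<Longrightarrow> (\<forall>f\<in>V. Q f \<le> P f) \<Longrightarrow> \<forall>f\<in>V. Q f = P f"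
  shows "linear_functional V P"
proof -
  note V' = function_spaceD[OF V] and P' = sublinear_functionalD[OF P]
  have add: "P f + P g \<le> P (\<lambda>x. f x + g x)" if f: "f \<in> V" and g: "g \<in> V" for f g
  proof -
    define A where "A = (\<lambda>f. {P (\<lambda>x. f x + t * g x) - t * P g | t. 0 \<le> t})"
    have A': "sublinear_functional V (\<lambda>f. Inf (A f)) \<and> (\<forall>f\<in>V. \<forall>a\<in>A f. Inf (A f) \<le> a)"
    proof (rule sublinear_Inf[OF V, of A])
      show "A f \<noteq> {}" for f by (auto simp: A_def)
      show "\<exists>c\<in>A (\<lambda>x. f x + h x). c \<le> a + b"
        if f: "f \<in> V" and h: "h \<in> V" and a: "a \<in> A f" and b: "b \<in> A h" for f h a b
      proof -
        obtain s t where s: "0 \<le> s" "a = P (\<lambda>x. f x + s * g x) - s * P g"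
          and t: "0 \<le> t" "b = P (\<lambda>x. h x + t * g x) - t * P g"
          using a b by (auto simp: A_def)
        have "(\<lambda>x. (f x + h x) + (s + t) * g x) = (\<lambda>x. (f x + s * g x) + (h x + t * g x))"
          by (auto simp: algebra_simps)
        then have "P (\<lambda>x. (f x + h x) + (s + t) * g x) \<le> P (\<lambda>x. f x + s * g x) + P (\<lambda>x. h x + t * g x)"
          using f h g by (simp only: P' V')
        then have "P (\<lambda>x. (f x + h x) + (s + t) * g x) - (s + t) * P g \<le> a + b"
          using s t by (simp add: algebra_simps)
        moreover have "P (\<lambda>x. (f x + h x) + (s + t) * g x) - (s + t) * P g \<in> A (\<lambda>x. f x + h x)"
          using s t by (auto simp: A_def intro!: exI[of _ "s + t"])
        ultimately show ?thesis by blast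
      qed
      show "\<exists>b\<in>A (\<lambda>x. c * f x). b \<le> c * a" if c: "0 < c" and f: "f \<in> V" and a: "a \<in> A f" for c f a
      proof -
        obtain s where s: "0 \<le> s" "a = P (\<lambda>x. f x + s * g x) - s * P g" using a by (auto simp: A_def)
        have "(\<lambda>x. c * f x + (c * s) * g x) = (\<lambda>x. c * (f x + s * g x))" by (auto simp: algebra_simps)
        then have "P (\<lambda>x. c * f x + (c * s) * g x) = c * P (\<lambda>x. f x + s * g x)"
          using f g c by (simp add: P' V')
        then have "P (\<lambda>x. c * f x + (c * s) * g x) - (c * s) * P g = c * a"
          unfolding s(2) by (simp add: right_diff_distrib)
        moreover have "P (\<lambda>x. c * f x + (c * s) * g x) - (c * s) * P g \<in> A (\<lambda>x. c * f x)"
          using s c by (auto simp: A_def intro!: exI[of _ "c * s"])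
        ultimately show ?thesis by auto
      qed
      show "\<exists>a\<in>A (\<lambda>_. 0). a \<le> 0"
        using sublinear_zero[OF V P] by (auto simp: A_def intro!: exI[of _ 0])
      show "0 \<le> a" if "a \<in> A (\<lambda>_. 0)" for a
        using that g by (auto simp: A_def P')
    qed
    note A = conjunct1[OF A'] conjunct2[OF A', rule_format]
    have "Inf (A f) \<le> P f" if "f \<in> V" for f
      using that by (intro A(2)) (auto simp: A_def intro!: exI[of _ 0])
    then have "Inf (A f) = P f" using min[OF A(1)] f by blast
    moreover have "Inf (A f) \<le> P (\<lambda>x. f x + g x) - P g"
      using f by (intro A(2)) (auto simp: A_def intro!: exI[of _ 1])
    ultimately show ?thesis by simp
  qed
  then have add_eq: "P (\<lambda>x. f x + g x) = P f + P g" if "f \<in> V" "g \<in> V" for f g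
    using that P'(1)[OF that] by (intro antisym) auto
  have neg: "P (\<lambda>x. - 1 * f x) = - P f" if f: "f \<in> V" for f
    using add_eq[OF f V'(3)[OF f, of "-1"]] sublinear_zero[OF V P] by simp
  have "P (\<lambda>x. c * f x) = c * P f" if f: "f \<in> V" for c f
  proof (cases "0 \<le> c")
    case True
    then show ?thesis using P'(2) f by simp
  next
    case False
    then have "P (\<lambda>x. -1 * ((-c) * f x)) = - ((-c) * P f)"
      using neg[OF V'(3)[OF f, of "-c"]] P'(2)[OF _ f, of "-c"] by simp
    then show ?thesis by simp
  qed
  with add_eq show ?thesis by (simp add: linear_functional_def)
qed

text \<open>Chains of sublinear functionals have sublinear infima, so Zorn's lemma yields a minimal one
  below \<open>P\<close>.  The value \<open>0\<close> outside \<open>V\<close> makes the pointwise order antisymmetric.\<close>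

theorem hahn_banach:
  assumes V: "function_space V" and P: "sublinear_functional V P"
  obtains l where "linear_functional V l" "\<And>f. f \<in> V \<Longrightarrow> l f \<le> P f"
proof -
  define \<Q> where "\<Q> = {Q. sublinear_functional V Q \<and> (\<forall>f\<in>V. Q f \<le> P f) \<and> (\<forall>f. f \<notin> V \<longrightarrow> Q f = 0)}"
  define below where "below = (\<lambda>Q Q' :: ('a \<Rightarrow> real) \<Rightarrow> real. \<forall>f. Q' f \<le> Q f)"
  have cut: "(\<lambda>f. if f \<in> V then Q f else 0) \<in> \<Q>"
    if "sublinear_functional V Q" "\<forall>f\<in>V. Q f \<le> P f" for Q
    using that function_spaceD[OF V] by (auto simp: \<Q>_def sublinear_functional_def)
  have "\<exists>m\<in>\<Q>. \<forall>Q\<in>\<Q>. below m Q \<longrightarrow> Q = m"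
  proof (rule predicate_Zorn)
    show "partial_order_on \<Q> (relation_of below \<Q>)"
    proof (rule partial_order_on_relation_ofI)
      show "below a a" for a by (simp add: below_def)
      show "below a c" if "below a b" "below b c" for a b c
        using that by (auto simp: below_def intro: order_trans)
      show "a = b" if "below a b" "below b a" for a b
        using that by (auto simp: below_def fun_eq_iff intro: antisym)
    qed
  next
    fix C assume C: "C \<in> Chains (relation_of below \<Q>)"
    then have CQ: "Q \<in> \<Q>" if "Q \<in> C" for Q
      using that by (auto simp: Chains_def relation_of_def)
    have chain: "below Q Q' \<or> below Q' Q" if "Q \<in> C" "Q' \<in> C" for Q Q'
      using that C by (auto simp: Chains_def relation_of_def)
    show "\<exists>u\<in>\<Q>. \<forall>Q\<in>C. below Q u"
    proof (cases "C = {}")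
      case True
      then show ?thesis using cut[OF P] by auto
    next
      case False
      define A where "A = (\<lambda>f. (\<lambda>Q. Q f) ` C)"
      have A': "sublinear_functional V (\<lambda>f. Inf (A f)) \<and> (\<forall>f\<in>V. \<forall>a\<in>A f. Inf (A f) \<le> a)"
      proof (rule sublinear_Inf[OF V, of A])
        show "A f \<noteq> {}" for f using False by (auto simp: A_def)
        show "\<exists>c\<in>A (\<lambda>x. f x + g x). c \<le> a + b"
          if fg: "f \<in> V" "g \<in> V" and a: "a \<in> A f" and b: "b \<in> A g" for f g a b
        proof -
          obtain Q1 Q2 where Q: "Q1 \<in> C" "a = Q1 f" "Q2 \<in> C" "b = Q2 g" using a b by (auto simp: A_def)
          then obtain Q where "Q \<in> C" "Q f \<le> a" "Q g \<le> b"
            using chain[of Q1 Q2] by (auto simp: below_def)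
          moreover from this CQ fg have "Q (\<lambda>x. f x + g x) \<le> Q f + Q g"
            by (auto simp: \<Q>_def sublinear_functional_def)
          ultimately show ?thesis by (intro bexI[of _ "Q (\<lambda>x. f x + g x)"]) (auto simp: A_def)
        qed
        show "\<exists>b\<in>A (\<lambda>x. c * f x). b \<le> c * a" if c: "0 < c" "f \<in> V" and a: "a \<in> A f" for c f a
        proof -
          obtain Q where Q: "Q \<in> C" "a = Q f" using a by (auto simp: A_def)
          then have "sublinear_functional V Q" using CQ by (auto simp: \<Q>_def)
          then have "Q (\<lambda>x. c * f x) = c * a" using sublinear_functionalD(2) c Q(2) by fastforce
          moreover have "Q (\<lambda>x. c * f x) \<in> A (\<lambda>x. c * f x)" using Q(1) by (auto simp: A_def)
          ultimately show ?thesis by auto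
        qed
        have zero: "Q (\<lambda>_. 0) = 0" if "Q \<in> C" for Q
          using CQ[OF that] sublinear_zero[OF V] by (auto simp: \<Q>_def)
        obtain Q0 where Q0: "Q0 \<in> C" using False by blast
        then have "Q0 (\<lambda>_. 0) \<in> A (\<lambda>_. 0)" by (auto simp: A_def)
        then show "\<exists>a\<in>A (\<lambda>_. 0). a \<le> 0" using zero[OF Q0] by auto
        show "0 \<le> a" if a: "a \<in> A (\<lambda>_. 0)" for a
        proof -
          obtain Q where Q: "Q \<in> C" "a = Q (\<lambda>_. 0)" using a by (auto simp: A_def)
          show ?thesis unfolding Q(2) zero[OF Q(1)] by simp
        qed
      qed
      note A = conjunct1[OF A'] conjunct2[OF A', rule_format]
      have le: "Inf (A f) \<le> Q f" if "f \<in> V" "Q \<in> C" for f Q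
        using A(2)[OF that(1), of "Q f"] that by (auto simp: A_def)
      obtain Q0 where Q0: "Q0 \<in> C" using False by blast
      have "\<forall>f\<in>V. Inf (A f) \<le> P f"
        using le[OF _ Q0] CQ[OF Q0] by (force simp: \<Q>_def)
      then have "(\<lambda>f. if f \<in> V then Inf (A f) else 0) \<in> \<Q>" by (rule cut[OF A(1)])
      moreover have "below Q (\<lambda>f. if f \<in> V then Inf (A f) else 0)" if "Q \<in> C" for Q
        using le[OF _ that] CQ[OF that] by (auto simp: below_def \<Q>_def)
      ultimately show ?thesis by blast
    qed
  qed
  then obtain m where m: "m \<in> \<Q>" "\<And>Q. Q \<in> \<Q> \<Longrightarrow> below m Q \<Longrightarrow> Q = m" by blast
  have "linear_functional V m"
  proof (rule minimal_sublinear_is_linear[OF V])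
    show "sublinear_functional V m" using m(1) by (simp add: \<Q>_def)
    fix Q assume Q: "sublinear_functional V Q" "\<forall>f\<in>V. Q f \<le> m f"
    let ?Q = "\<lambda>f. if f \<in> V then Q f else 0"
    have "?Q \<in> \<Q>" using Q m(1) by (intro cut) (auto simp: \<Q>_def intro: order_trans)
    moreover have "below m ?Q" using Q m(1) by (auto simp: below_def \<Q>_def)
    ultimately have "?Q = m" by (rule m(2))
    then show "\<forall>f\<in>V. Q f = m f" by (auto dest: fun_cong)
  qed
  with m(1) that show thesis by (auto simp: \<Q>_def)
qed

text \<open>A linear \<open>p1\<close> works if and only if \<open>p1 f \<le> P1 (f + g) + P2 g - p g\<close> for all \<open>f\<close> and \<open>g\<close>, and the
  infimum of the right-hand side over \<open>g\<close> is sublinear in \<open>f\<close>.\<close>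

theorem sublinear_decomposition:
  assumes V: "function_space V" and p: "linear_functional V p"
    and P: "sublinear_functional V P1" "sublinear_functional V P2"
    and le: "\<And>f. f \<in> V \<Longrightarrow> p f \<le> P1 f + P2 f"
  obtains p1 p2 where "linear_functional V p1" "linear_functional V p2"
    "\<And>f. f \<in> V \<Longrightarrow> p1 f \<le> P1 f" "\<And>f. f \<in> V \<Longrightarrow> p2 f \<le> P2 f" "\<And>f. f \<in> V \<Longrightarrow> p f = p1 f + p2 f"
proof -
  note V' = function_spaceD[OF V] and P1 = sublinear_functionalD[OF P(1)]
    and P2 = sublinear_functionalD[OF P(2)] and p' = linear_functionalD[OF p]
  define A where "A = (\<lambda>f. (\<lambda>g. P1 (\<lambda>x. f x + g x) + P2 g - p g) ` V)"
  have A': "sublinear_functional V (\<lambda>f. Inf (A f)) \<and> (\<forall>f\<in>V. \<forall>a\<in>A f. Inf (A f) \<le> a)"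
  proof (rule sublinear_Inf[OF V, of A])
    show "A f \<noteq> {}" for f using V'(1) by (auto simp: A_def)
    show "\<exists>c\<in>A (\<lambda>x. f x + h x). c \<le> a + b"
      if fh: "f \<in> V" "h \<in> V" and a: "a \<in> A f" and b: "b \<in> A h" for f h a b
    proof -
      obtain g k where g: "g \<in> V" "a = P1 (\<lambda>x. f x + g x) + P2 g - p g"
        and k: "k \<in> V" "b = P1 (\<lambda>x. h x + k x) + P2 k - p k"
        using a b by (auto simp: A_def)
      have "(\<lambda>x. (f x + h x) + (g x + k x)) = (\<lambda>x. (f x + g x) + (h x + k x))"
        by (auto simp: algebra_simps)
      then have "P1 (\<lambda>x. (f x + h x) + (g x + k x)) \<le> P1 (\<lambda>x. f x + g x) + P1 (\<lambda>x. h x + k x)"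
        using fh g k by (simp only: P1 V')
      then have "P1 (\<lambda>x. (f x + h x) + (g x + k x)) + P2 (\<lambda>x. g x + k x) - p (\<lambda>x. g x + k x) \<le> a + b"
        using P2(1)[OF g(1) k(1)] p'(1)[OF g(1) k(1)] g k by simp
      then show ?thesis using V'(2)[OF g(1) k(1)] by (auto simp: A_def)
    qed
    show "\<exists>b\<in>A (\<lambda>x. c * f x). b \<le> c * a" if c: "0 < c" and f: "f \<in> V" and a: "a \<in> A f" for c f a
    proof -
      obtain g where g: "g \<in> V" "a = P1 (\<lambda>x. f x + g x) + P2 g - p g" using a by (auto simp: A_def)
      have "(\<lambda>x. c * f x + c * g x) = (\<lambda>x. c * (f x + g x))" by (auto simp: algebra_simps)
      then have "P1 (\<lambda>x. c * f x + c * g x) = c * P1 (\<lambda>x. f x + g x)"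
        using f g c by (simp add: P1 V')
      then have "P1 (\<lambda>x. c * f x + c * g x) + P2 (\<lambda>x. c * g x) - p (\<lambda>x. c * g x) = c * a"
        unfolding g(2) using g(1) c by (simp add: P2 p' right_diff_distrib distrib_left)
      then show ?thesis using V'(3)[OF g(1), of c] by (auto simp: A_def intro!: bexI)
    qed
    show "\<exists>a\<in>A (\<lambda>_. 0). a \<le> 0"
      using sublinear_zero[OF V P(1)] sublinear_zero[OF V P(2)] p'(2)[OF V'(1), of 0] V'(1)
      by (intro bexI[of _ 0]) (auto simp: A_def image_iff intro!: bexI[of _ "\<lambda>_. 0"])
    show "0 \<le> a" if "a \<in> A (\<lambda>_. 0)" for a
      using that le by (auto simp: A_def)
  qed
  note A = conjunct1[OF A'] conjunct2[OF A', rule_format]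
  obtain p1 where p1: "linear_functional V p1" "\<And>f. f \<in> V \<Longrightarrow> p1 f \<le> Inf (A f)"
    using hahn_banach[OF V A(1)] by metis
  show thesis
  proof (rule that[of p1 "\<lambda>f. p f - p1 f"])
    show "linear_functional V (\<lambda>f. p f - p1 f)"
      using p p1(1) by (simp add: linear_functional_def algebra_simps)
    show "p1 f \<le> P1 f" if f: "f \<in> V" for f
    proof -
      have "P1 f \<in> A f"
        using sublinear_zero[OF V P(2)] p'(2)[OF V'(1), of 0] V'(1)
        by (auto simp: A_def image_iff intro!: bexI[of _ "\<lambda>_. 0"])
      with A(2)[OF f] p1(2)[OF f] show ?thesis by force
    qed
    show "p f - p1 f \<le> P2 f" if f: "f \<in> V" for f
    proof -
      have "P2 f - p f \<in> A (\<lambda>x. -1 * f x)"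
        using sublinear_zero[OF V P(1)] f by (auto simp: A_def image_iff intro!: bexI[of _ f])
      with A(2)[OF V'(3)[OF f, of "-1"]] p1(2)[OF V'(3)[OF f, of "-1"]]
      have "p1 (\<lambda>x. -1 * f x) \<le> P2 f - p f" by force
      then show ?thesis using linear_functionalD(2)[OF p1(1) f, of "-1"] by simp
    qed
  qed (use p1(1) in auto)
qed

section \<open>Extreme evaluations on compact spaces\<close>

text \<open>The evaluation at a point \<open>z\<close> is a state.  The aim of this section is a point, subject to
  prescribed equations, whose evaluation is an extreme state.  Such points are found by shrinking
  closed sets that play the role of faces: if a proper mean of two states is supported on such a
  set, then so are both states.\<close>

definition state_on :: "'x set \<Rightarrow> ('x \<Rightarrow> real) set \<Rightarrow> (('x \<Rightarrow> real) \<Rightarrow> real) \<Rightarrow> bool" where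
  "state_on Z V p \<longleftrightarrow> linear_functional V p \<and>
     (\<forall>f\<in>V. (\<forall>z\<in>Z. 0 \<le> f z) \<longrightarrow> 0 \<le> p f) \<and> p (\<lambda>_. 1) = 1"

definition extreme_evaluation :: "'x set \<Rightarrow> ('x \<Rightarrow> real) set \<Rightarrow> 'x \<Rightarrow> bool" where
  "extreme_evaluation Z V z \<longleftrightarrow>
     (\<forall>q s u. state_on Z V q \<longrightarrow> state_on Z V s \<longrightarrow> 0 < u \<longrightarrow> u < 1 \<longrightarrow>
        (\<forall>f\<in>V. f z = (1 - u) * q f + u * s f) \<longrightarrow> (\<forall>f\<in>V. q f = f z))"

lemma chain_Inter_nonempty:
  assumes X: "compact_space X" and C: "\<C> \<noteq> {}" "\<And>Y. Y \<in> \<C> \<Longrightarrow> closedin X Y" "\<And>Y. Y \<in> \<C> \<Longrightarrow> Y \<noteq> {}"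
    and chain: "\<And>A B. A \<in> \<C> \<Longrightarrow> B \<in> \<C> \<Longrightarrow> A \<subseteq> B \<or> B \<subseteq> A"
  shows "\<Inter>\<C> \<noteq> {}"
proof -
  have "\<F> \<noteq> {} \<Longrightarrow> \<Inter>\<F> \<in> \<C>" if "finite \<F>" "\<F> \<subseteq> \<C>" for \<F>
    using that
  proof (induction \<F> rule: finite_induct)
    case (insert Y \<F>)
    show ?case
    proof (cases "\<F> = {}")
      case False
      then have "\<Inter>\<F> \<in> \<C>" "Y \<in> \<C>" using insert by auto
      then show ?thesis using chain[of Y "\<Inter>\<F>"] by (auto simp: Int_absorb1 Int_absorb2)
    qed (use insert in simp)
  qed simp
  then have "\<Inter>\<F> \<noteq> {}" if "finite \<F>" "\<F> \<subseteq> \<C>" for \<F>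
    using that C(3) by (cases "\<F> = {}") auto
  with X C(2) show ?thesis unfolding compact_space_fip by blast
qed

lemma continuous_attains_sup_closedin:
  fixes f :: "'x \<Rightarrow> real"
  assumes "compact_space X" "closedin X Y" "Y \<noteq> {}" "continuous_map X euclideanreal f"
  obtains z where "z \<in> Y" "\<And>w. w \<in> Y \<Longrightarrow> f w \<le> f z"
proof -
  have "compact (f ` Y)"
    using image_compactin[OF closedin_compact_space[OF assms(1,2)] assms(4)] by simp
  then obtain s where "s \<in> f ` Y" "\<forall>t\<in>f ` Y. t \<le> s"
    using compact_attains_sup assms(3) by blast
  with that show thesis by blast
qed

text \<open>For a state \<open>p\<close> this says that \<open>p f\<close> is at most the supremum of \<open>f\<close> over \<open>Y\<close>, that is, that
  \<open>p\<close> lies in the closed convex hull of the evaluations at points of \<open>Y\<close>.\<close>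

definition supported :: "('x \<Rightarrow> real) set \<Rightarrow> 'x set \<Rightarrow> (('x \<Rightarrow> real) \<Rightarrow> real) \<Rightarrow> bool" where
  "supported V Y p \<longleftrightarrow> (\<forall>f\<in>V. (\<forall>z\<in>Y. f z \<le> 0) \<longrightarrow> p f \<le> 0)"

definition closed_face :: "'x topology \<Rightarrow> ('x \<Rightarrow> real) set \<Rightarrow> 'x set \<Rightarrow> bool" where
  "closed_face X V Y \<longleftrightarrow> closedin X Y \<and>
     (\<forall>q s u. state_on (topspace X) V q \<longrightarrow> state_on (topspace X) V s \<longrightarrow> 0 < u \<longrightarrow> u < 1 \<longrightarrow>
        supported V Y (\<lambda>f. (1 - u) * q f + u * s f) \<longrightarrow> supported V Y q)"

context
  fixes X :: "'x topology" and V :: "('x \<Rightarrow> real) set"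
  assumes X: "compact_space X" and V: "function_space V" and const: "\<And>c. (\<lambda>_. c) \<in> V"
    and cont: "\<And>f. f \<in> V \<Longrightarrow> continuous_map X euclideanreal f"
begin

private abbreviation "state \<equiv> state_on (topspace X) V"

private lemma state_add_const:
  assumes "state q" "f \<in> V"
  shows "(\<lambda>x. f x + c) \<in> V" "q (\<lambda>x. f x + c) = q f + c"
proof -
  have q: "linear_functional V q" "q (\<lambda>_. 1) = 1" using assms(1) by (auto simp: state_on_def)
  have "q (\<lambda>_. c * 1) = c * q (\<lambda>_. 1)" by (rule linear_functionalD(2)[OF q(1) const])
  then show "(\<lambda>x. f x + c) \<in> V" "q (\<lambda>x. f x + c) = q f + c"
    using function_spaceD(2)[OF V assms(2) const[of c]]
      linear_functionalD(1)[OF q(1) assms(2) const[of c]] q(2) by simp_all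
qed

private lemma supported_le:
  assumes q: "state q" "supported V Y q" and f: "f \<in> V" "\<And>z. z \<in> Y \<Longrightarrow> f z \<le> c"
  shows "q f \<le> c"
proof -
  have "q (\<lambda>x. f x + - c) \<le> 0"
    using q(2) state_add_const(1)[OF q(1) f(1), of "- c"] f(2) unfolding supported_def by force
  then show ?thesis using state_add_const(2)[OF q(1) f(1), of "- c"] by simp
qed

private lemma supported_mono:
  "supported V Y p \<Longrightarrow> Y \<subseteq> Y' \<Longrightarrow> supported V Y' p"
  unfolding supported_def by blast

private lemma closed_faceD:
  assumes "closed_face X V Y" "state q" "state s" "0 < u" "u < 1"
    "supported V Y (\<lambda>f. (1 - u) * q f + u * s f)"
  shows "supported V Y q" "supported V Y s"
proof -
  show "supported V Y q" using assms unfolding closed_face_def by blast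
  have "(\<lambda>f. (1 - (1 - u)) * s f + (1 - u) * q f) = (\<lambda>f. (1 - u) * q f + u * s f)" by auto
  then have "supported V Y (\<lambda>f. (1 - (1 - u)) * s f + (1 - u) * q f)" using assms(6) by simp
  moreover have "0 < 1 - u" "1 - u < 1" using assms(4,5) by auto
  ultimately show "supported V Y s" using assms(1-3) unfolding closed_face_def by blast
qed

text \<open>By compactness a function that is at most \<open>0\<close> on the intersection is at most \<open>\<epsilon>\<close> on some member
  of the chain.\<close>

private lemma closed_face_Inter:
  assumes C: "\<C> \<noteq> {}" "\<And>Y. Y \<in> \<C> \<Longrightarrow> closed_face X V Y"
    and chain: "\<And>A B. A \<in> \<C> \<Longrightarrow> B \<in> \<C> \<Longrightarrow> A \<subseteq> B \<or> B \<subseteq> A"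
  shows "closed_face X V (\<Inter>\<C>)"
  unfolding closed_face_def
proof (intro conjI allI impI)
  have clo: "closedin X Y" if "Y \<in> \<C>" for Y using C(2)[OF that] by (simp add: closed_face_def)
  show "closedin X (\<Inter>\<C>)" using C(1) clo by (intro closedin_Inter)
  fix q s and u :: real
  assume qs: "state q" "state s" and u: "0 < u" "u < 1"
    and mix: "supported V (\<Inter>\<C>) (\<lambda>f. (1 - u) * q f + u * s f)"
  have sup: "supported V Y q" if "Y \<in> \<C>" for Y
    using that by (intro closed_faceD(1)[OF C(2)[OF that] qs u] supported_mono[OF mix]) auto
  show "supported V (\<Inter>\<C>) q"
    unfolding supported_def
  proof (intro ballI impI)
    fix f assume f: "f \<in> V" and le: "\<forall>z\<in>\<Inter>\<C>. f z \<le> 0"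
    show "q f \<le> 0"
    proof (rule field_le_epsilon)
      fix \<epsilon> :: real assume \<epsilon>: "0 < \<epsilon>"
      have "\<exists>Y\<in>\<C>. \<forall>z\<in>Y. f z \<le> \<epsilon>"
      proof (rule ccontr)
        assume neg: "\<not> ?thesis"
        define \<D> where "\<D> = (\<lambda>Y. Y \<inter> {z \<in> topspace X. f z \<in> {\<epsilon>..}}) ` \<C>"
        have "\<Inter>\<D> \<noteq> {}"
        proof (rule chain_Inter_nonempty[OF X])
          show "\<D> \<noteq> {}" using C(1) by (simp add: \<D>_def)
          show "closedin X D" if "D \<in> \<D>" for D
            using that clo closedin_continuous_map_preimage[OF cont[OF f], of "{\<epsilon>..}"]
            by (auto simp: \<D>_def intro!: closedin_Int)
          show "D \<noteq> {}" if D: "D \<in> \<D>" for D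
          proof -
            obtain Y where Y: "Y \<in> \<C>" "D = Y \<inter> {z \<in> topspace X. f z \<in> {\<epsilon>..}}"
              using D unfolding \<D>_def by blast
            then obtain z where "z \<in> Y" "\<epsilon> < f z" using neg by (auto simp: not_le)
            moreover have "z \<in> topspace X" using clo[OF Y(1)] \<open>z \<in> Y\<close> closedin_subset by blast
            ultimately show ?thesis using Y(2) by auto
          qed
          show "A \<subseteq> B \<or> B \<subseteq> A" if AB: "A \<in> \<D>" "B \<in> \<D>" for A B
          proof -
            obtain A' B' where "A' \<in> \<C>" "B' \<in> \<C>" "A = A' \<inter> {z \<in> topspace X. f z \<in> {\<epsilon>..}}"
              "B = B' \<inter> {z \<in> topspace X. f z \<in> {\<epsilon>..}}"
              using AB unfolding \<D>_def by blast
            then show ?thesis using chain[of A' B'] by blast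
          qed
        qed
        then obtain z where z: "z \<in> \<Inter>\<D>" by blast
        obtain Y where "Y \<in> \<C>" using C(1) by blast
        then have "Y \<inter> {z \<in> topspace X. f z \<in> {\<epsilon>..}} \<in> \<D>" unfolding \<D>_def by blast
        with z have "\<epsilon> \<le> f z" by blast
        moreover have "z \<in> \<Inter>\<C>" using z unfolding \<D>_def by blast
        then have "f z \<le> 0" using le by blast
        ultimately show False using \<epsilon> by linarith
      qed
      then obtain Y where "Y \<in> \<C>" "\<forall>z\<in>Y. f z \<le> \<epsilon>" by blast
      then show "q f \<le> 0 + \<epsilon>" using supported_le[OF qs(1) sup f] by simp
    qed
  qed
qed

text \<open>If a mean of two states is supported where \<open>\<psi>\<close> attains its maximum \<open>m\<close> on \<open>Y\<close>, both states give
  \<open>\<psi>\<close> the value \<open>m\<close>.  If \<open>f \<le> 0\<close> there, then \<open>f + t (\<psi> - m) \<le> \<epsilon>\<close> on all of \<open>Y\<close> for large \<open>t\<close>, and both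
  states ignore the added term.\<close>

private lemma closed_face_argmax:
  assumes Y: "closed_face X V Y" and \<psi>: "\<psi> \<in> V" and m: "\<And>z. z \<in> Y \<Longrightarrow> \<psi> z \<le> m"
  shows "closed_face X V {z \<in> Y. \<psi> z = m}"
  unfolding closed_face_def
proof (intro conjI allI impI)
  let ?Y = "{z \<in> Y. \<psi> z = m}"
  have clo: "closedin X Y" using Y by (simp add: closed_face_def)
  have YX: "Y \<subseteq> topspace X" using clo closedin_subset by blast
  have "?Y = Y \<inter> {z \<in> topspace X. \<psi> z \<in> {m}}" using YX by auto
  then show "closedin X ?Y"
    using closedin_continuous_map_preimage[OF cont[OF \<psi>], of "{m}"] clo by (simp add: closedin_Int)
  fix q s and u :: real
  assume qs: "state q" "state s" and u: "0 < u" "u < 1"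
    and mix: "supported V ?Y (\<lambda>f. (1 - u) * q f + u * s f)"
  have sup: "supported V Y q" "supported V Y s"
    by (rule closed_faceD[OF Y qs u supported_mono[OF mix]]; auto)+
  have le: "q \<psi> \<le> m" "s \<psi> \<le> m" using supported_le[OF qs(1) sup(1) \<psi>] supported_le[OF qs(2) sup(2) \<psi>] m by auto
  have neg: "(\<lambda>x. -1 * \<psi> x) \<in> V" using function_spaceD(3)[OF V \<psi>] .
  have "q (\<lambda>x. -1 * \<psi> x) = - q \<psi>" "s (\<lambda>x. -1 * \<psi> x) = - s \<psi>"
    using qs linear_functionalD(2)[OF _ \<psi>, of q "-1"] linear_functionalD(2)[OF _ \<psi>, of s "-1"]
    by (auto simp: state_on_def)
  then have "(1 - u) * (m - q \<psi>) + u * (m - s \<psi>) \<le> 0"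
    using mix state_add_const[OF qs(1) neg, of m] state_add_const[OF qs(2) neg, of m]
    unfolding supported_def by (auto dest!: bspec[of _ _ "\<lambda>x. -1 * \<psi> x + m"])
  moreover have "0 \<le> (1 - u) * (m - q \<psi>)" "0 \<le> u * (m - s \<psi>)" using le u by auto
  ultimately have "(1 - u) * (m - q \<psi>) = 0" by linarith
  with u have q\<psi>: "q \<psi> = m" by simp
  show "supported V ?Y q"
    unfolding supported_def
  proof (intro ballI impI)
    fix f assume f: "f \<in> V" and f0: "\<forall>z\<in>?Y. f z \<le> 0"
    show "q f \<le> 0"
    proof (rule field_le_epsilon)
      fix \<epsilon> :: real assume \<epsilon>: "0 < \<epsilon>"
      define K where "K = Y \<inter> {z \<in> topspace X. f z \<in> {\<epsilon>..}}"
      have K: "closedin X K"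
        unfolding K_def using clo closedin_continuous_map_preimage[OF cont[OF f], of "{\<epsilon>..}"]
        by (intro closedin_Int) auto
      have "\<exists>t\<ge>0. \<forall>z\<in>Y. f z + t * (\<psi> z - m) \<le> \<epsilon>"
      proof (cases "K = {}")
        case True
        then have "f z \<le> \<epsilon>" if "z \<in> Y" for z using that YX by (force simp: K_def)
        then show ?thesis by (intro exI[of _ 0]) auto
      next
        case False
        obtain z1 where z1: "z1 \<in> K" "\<And>w. w \<in> K \<Longrightarrow> \<psi> w \<le> \<psi> z1"
          using continuous_attains_sup_closedin[OF X K False cont[OF \<psi>]] by metis
        obtain z2 where z2: "z2 \<in> K" "\<And>w. w \<in> K \<Longrightarrow> f w \<le> f z2"
          using continuous_attains_sup_closedin[OF X K False cont[OF f]] by metis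
        have "f z1 > 0" "f z2 > 0" "z1 \<in> Y" using z1(1) z2(1) \<epsilon> by (auto simp: K_def)
        then have \<delta>: "m - \<psi> z1 > 0" using f0 m[of z1] by (force simp: less_le)
        define t where "t = f z2 / (m - \<psi> z1)"
        have t: "t \<ge> 0" "t * (m - \<psi> z1) = f z2" using \<delta> \<open>f z2 > 0\<close> by (auto simp: t_def)
        have "f z + t * (\<psi> z - m) \<le> \<epsilon>" if z: "z \<in> Y" for z
        proof (cases "z \<in> K")
          case True
          have "t * (m - \<psi> z1) \<le> t * (m - \<psi> z)" using z1(2)[OF True] t(1) by (intro mult_left_mono) auto
          then have "f z \<le> t * (m - \<psi> z)" using t(2) z2(2)[OF True] by simp
          then show ?thesis using \<epsilon> by (simp add: algebra_simps)
        next
          case False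
          then have "f z < \<epsilon>" using z YX by (auto simp: K_def)
          moreover have "t * (\<psi> z - m) \<le> 0" using t(1) m[OF z] by (simp add: mult_nonneg_nonpos)
          ultimately show ?thesis by simp
        qed
        with t(1) show ?thesis by blast
      qed
      then obtain t where t: "t \<ge> 0" "\<And>z. z \<in> Y \<Longrightarrow> f z + t * (\<psi> z - m) \<le> \<epsilon>" by blast
      have lin: "linear_functional V q" using qs(1) by (simp add: state_on_def)
      have t\<psi>: "(\<lambda>x. t * \<psi> x) \<in> V" by (rule function_spaceD(3)[OF V \<psi>])
      have "q (\<lambda>x. f x + t * \<psi> x) \<le> \<epsilon> + t * m"
        by (rule supported_le[OF qs(1) sup(1) function_spaceD(2)[OF V f t\<psi>]])
          (use t in \<open>simp add: algebra_simps\<close>)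
      then show "q f \<le> 0 + \<epsilon>"
        using linear_functionalD(1)[OF lin f t\<psi>] linear_functionalD(2)[OF lin \<psi>, of t] q\<psi> by simp
    qed
  qed
qed

text \<open>A minimal closed face that meets the common zero set of \<open>G\<close> is contained in that set, because
  restricting it to the zeros of some \<open>g \<in> G\<close> (where \<open>- g\<close> is maximal) does not shrink it.  For the
  same reason all functions in \<open>V\<close> are constant on it, so that every state supported on it is the
  evaluation at any of its points.\<close>

theorem extreme_evaluation_exists:
  assumes G: "G \<subseteq> V" "\<And>g z. g \<in> G \<Longrightarrow> z \<in> topspace X \<Longrightarrow> 0 \<le> g z"
    and z0: "z0 \<in> topspace X" "\<forall>g\<in>G. g z0 = 0"
  obtains z where "z \<in> topspace X" "\<forall>g\<in>G. g z = 0" "extreme_evaluation (topspace X) V z"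
proof -
  define Z where "Z = {z \<in> topspace X. \<forall>g\<in>G. g z = 0}"
  have "closedin X {z \<in> topspace X. g z \<in> {0}}" if "g \<in> G" for g
    using that G(1) by (intro closedin_continuous_map_preimage[OF cont]) auto
  moreover have "Z = (if G = {} then topspace X else (\<Inter>g\<in>G. {z \<in> topspace X. g z \<in> {0}}))"
    by (auto simp: Z_def)
  ultimately have Z: "closedin X Z" by (auto intro!: closedin_INT)
  define \<Y> where "\<Y> = {Y. closed_face X V Y \<and> Y \<inter> Z \<noteq> {}}"
  have top: "topspace X \<in> \<Y>"
  proof -
    have "q f \<le> 0" if "state q" "f \<in> V" "\<forall>z\<in>topspace X. f z \<le> 0" for q f
    proof -
      have lin: "linear_functional V q" and pos: "\<forall>f\<in>V. (\<forall>z\<in>topspace X. 0 \<le> f z) \<longrightarrow> 0 \<le> q f"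
        using that(1) by (auto simp: state_on_def)
      have "0 \<le> q (\<lambda>x. -1 * f x)"
        using pos function_spaceD(3)[OF V that(2), of "-1"] that(3) by simp
      then show ?thesis using linear_functionalD(2)[OF lin that(2), of "-1"] by simp
    qed
    then have "closed_face X V (topspace X)" by (simp add: closed_face_def supported_def)
    then show ?thesis using z0 by (auto simp: \<Y>_def Z_def)
  qed
  have "\<exists>Y\<in>\<Y>. \<forall>Y'\<in>\<Y>. Y' \<subseteq> Y \<longrightarrow> Y' = Y"
  proof (rule predicate_Zorn)
    show "partial_order_on \<Y> (relation_of (\<lambda>A B. B \<subseteq> A) \<Y>)"
      by (rule partial_order_on_relation_ofI) auto
  next
    fix C assume "C \<in> Chains (relation_of (\<lambda>A B. B \<subseteq> A) \<Y>)"
    then have CY: "C \<subseteq> \<Y>" and chain: "\<And>A B. A \<in> C \<Longrightarrow> B \<in> C \<Longrightarrow> A \<subseteq> B \<or> B \<subseteq> A"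
      by (auto simp: Chains_def relation_of_def)
    show "\<exists>U\<in>\<Y>. \<forall>A\<in>C. U \<subseteq> A"
    proof (cases "C = {}")
      case False
      have "\<Inter>((\<lambda>A. A \<inter> Z) ` C) \<noteq> {}"
      proof (rule chain_Inter_nonempty[OF X])
        show "closedin X A" "A \<noteq> {}" if "A \<in> (\<lambda>A. A \<inter> Z) ` C" for A
          using that CY Z by (auto simp: \<Y>_def closed_face_def intro!: closedin_Int)
        show "A \<subseteq> B \<or> B \<subseteq> A" if AB: "A \<in> (\<lambda>A. A \<inter> Z) ` C" "B \<in> (\<lambda>A. A \<inter> Z) ` C" for A B
        proof -
          obtain A' B' where "A' \<in> C" "B' \<in> C" "A = A' \<inter> Z" "B = B' \<inter> Z" using AB by blast
          then show ?thesis using chain[of A' B'] by blast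
        qed
      qed (use False in simp)
      then have "\<Inter>C \<inter> Z \<noteq> {}" using False by auto
      moreover have "closed_face X V (\<Inter>C)"
        using CY by (intro closed_face_Inter False chain) (auto simp: \<Y>_def)
      ultimately show ?thesis by (intro bexI[of _ "\<Inter>C"]) (auto simp: \<Y>_def)
    qed (use top in auto)
  qed
  then obtain Y where Y: "Y \<in> \<Y>" and min: "\<And>Y'. Y' \<in> \<Y> \<Longrightarrow> Y' \<subseteq> Y \<Longrightarrow> Y' = Y" by blast
  have face: "closed_face X V Y" and meets: "Y \<inter> Z \<noteq> {}" using Y by (auto simp: \<Y>_def)
  have clo: "closedin X Y" using face by (simp add: closed_face_def)
  have YX: "Y \<subseteq> topspace X" using clo closedin_subset by blast
  have argmax: "\<psi> z = m" if "\<psi> \<in> V" "\<And>z. z \<in> Y \<Longrightarrow> \<psi> z \<le> m" "{z \<in> Y. \<psi> z = m} \<inter> Z \<noteq> {}" "z \<in> Y" for \<psi> m z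
  proof -
    have "{z \<in> Y. \<psi> z = m} \<in> \<Y>" using closed_face_argmax[OF face that(1,2)] that(3) by (auto simp: \<Y>_def)
    then have "{z \<in> Y. \<psi> z = m} = Y" by (rule min) auto
    with that(4) show ?thesis by blast
  qed
  have YZ: "Y \<subseteq> Z"
  proof
    fix z assume z: "z \<in> Y"
    have "g z = 0" if g: "g \<in> G" for g
    proof -
      have "-1 * g z = 0"
      proof (rule argmax[OF _ _ _ z])
        show "(\<lambda>x. -1 * g x) \<in> V" using g G(1) by (intro function_spaceD(3)[OF V]) auto
        show "-1 * g z \<le> 0" if "z \<in> Y" for z using G(2)[OF g] that YX by auto
        show "{z \<in> Y. -1 * g z = 0} \<inter> Z \<noteq> {}" using meets g by (auto simp: Z_def)
      qed
      then show ?thesis by simp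
    qed
    then show "z \<in> Z" using z YX by (auto simp: Z_def)
  qed
  obtain z where z: "z \<in> Y" using meets by blast
  have const_on_Y: "\<psi> w = \<psi> z" if \<psi>: "\<psi> \<in> V" and w: "w \<in> Y" for \<psi> w
  proof -
    obtain y where y: "y \<in> Y" "\<And>w. w \<in> Y \<Longrightarrow> \<psi> w \<le> \<psi> y"
      using continuous_attains_sup_closedin[OF X clo _ cont[OF \<psi>]] z by blast
    have "{z \<in> Y. \<psi> z = \<psi> y} \<inter> Z \<noteq> {}" using y(1) YZ by auto
    then show ?thesis using argmax[OF \<psi> y(2)] w z by metis
  qed
  show thesis
  proof (rule that[of z])
    show "z \<in> topspace X" using z YX by auto
    show "\<forall>g\<in>G. g z = 0" using z YZ by (auto simp: Z_def)
    show "extreme_evaluation (topspace X) V z"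
      unfolding extreme_evaluation_def
    proof (intro allI impI ballI)
      fix q s f and u :: real
      assume qs: "state q" "state s" and u: "0 < u" "u < 1"
        and mix: "\<forall>f\<in>V. f z = (1 - u) * q f + u * s f" and f: "f \<in> V"
      have "supported V Y (\<lambda>f. (1 - u) * q f + u * s f)"
        unfolding supported_def using mix z by (metis)
      then have sup: "supported V Y q" by (rule closed_faceD(1)[OF face qs u])
      have "q f \<le> f z" by (rule supported_le[OF qs(1) sup f]) (simp add: const_on_Y[OF f])
      moreover have "q (\<lambda>x. -1 * f x) \<le> - f z"
        by (rule supported_le[OF qs(1) sup function_spaceD(3)[OF V f]]) (simp add: const_on_Y[OF f])
      moreover have "q (\<lambda>x. -1 * f x) = -1 * q f"
        using qs(1) by (intro linear_functionalD(2)[OF _ f]) (auto simp: state_on_def)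
      ultimately show "q f = f z" by simp
    qed
  qed
qed

end

section \<open>Types as monotone functionals on formulas\<close>

lemma value_at_bounded:
  assumes M: "is_structure L M" and \<phi>: "\<phi> \<in> formulas L n"
  obtains b where "0 < b" "\<And>as. as \<in> tuples M n \<Longrightarrow> \<bar>value_at M \<phi> as\<bar> \<le> b"
proof -
  obtain b where b: "\<forall>v\<in>valns M. \<bar>eval_fm M v \<phi>\<bar> \<le> b"
    using eval_fm_bounded[OF M, of \<phi>] \<phi> by (auto simp: formulas_def)
  have "\<bar>value_at M \<phi> as\<bar> \<le> \<bar>b\<bar> + 1" if as: "as \<in> tuples M n" for as
  proof -
    have "valuation_of (base_point M) as \<in> valns M"
      using as by (intro valuation_of_valns base_point[OF M]) (simp add: tuples_def)
    then have "\<bar>value_at M \<phi> as\<bar> \<le> b"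
      using b value_at_valuation_of[of \<phi> L as M "base_point M"] \<phi> as by (simp add: tuples_def)
    then show ?thesis by linarith
  qed
  then show thesis by (intro that[of "\<bar>b\<bar> + 1"]) auto
qed

lemma types_ofD:
  assumes "p \<in> types_of L T n"
  shows "\<phi> \<notin> formulas L n \<Longrightarrow> p \<phi> = 0"
    "\<phi> \<in> formulas L n \<Longrightarrow> \<psi> \<in> formulas L n \<Longrightarrow> p (Add \<phi> \<psi>) = p \<phi> + p \<psi>"
    "\<phi> \<in> formulas L n \<Longrightarrow> p (Scale r \<phi>) = r * p \<phi>"
  using assms by (auto simp: types_of_def)

text \<open>The largest sublinear extension of a type from the formulas, viewed as functions on \<open>Z\<close> through
  the projection \<open>\<pi>\<close> to tuples, to other functions on \<open>Z\<close>.  Linear functionals below it are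
  positive and restrict to the type.\<close>

definition upper_extension ::
  "('c, 'f, 'r) language \<Rightarrow> ('a, 'c, 'f, 'r) lstruct \<Rightarrow> nat \<Rightarrow> ('z \<Rightarrow> 'a list) \<Rightarrow> 'z set \<Rightarrow>
     (('c, 'f, 'r) fm \<Rightarrow> real) \<Rightarrow> ('z \<Rightarrow> real) \<Rightarrow> real" where
  "upper_extension L N n \<pi> Z p f =
     Inf {p \<psi> | \<psi>. \<psi> \<in> formulas L n \<and> (\<forall>z\<in>Z. f z \<le> value_at N \<psi> (\<pi> z))}"

definition bounded_on :: "'z set \<Rightarrow> ('z \<Rightarrow> real) set" where
  "bounded_on Z = {f. \<exists>b. \<forall>z\<in>Z. \<bar>f z\<bar> \<le> b}"

lemma bounded_onI: "(\<And>z. z \<in> Z \<Longrightarrow> \<bar>f z\<bar> \<le> b) \<Longrightarrow> f \<in> bounded_on Z"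
  by (auto simp: bounded_on_def)

lemma bounded_onE:
  assumes "f \<in> bounded_on Z"
  obtains b where "0 < b" "\<And>z. z \<in> Z \<Longrightarrow> \<bar>f z\<bar> \<le> b"
proof -
  obtain b where b: "\<And>z. z \<in> Z \<Longrightarrow> \<bar>f z\<bar> \<le> b" using assms by (auto simp: bounded_on_def)
  show thesis by (rule that[of "\<bar>b\<bar> + 1"]) (use b in fastforce)+
qed

lemma bounded_on_mult:
  assumes "f \<in> bounded_on Z" "g \<in> bounded_on Z"
  shows "(\<lambda>z. f z * g z) \<in> bounded_on Z"
proof -
  obtain b c where "0 < b" and b: "\<And>z. z \<in> Z \<Longrightarrow> \<bar>f z\<bar> \<le> b" and c: "\<And>z. z \<in> Z \<Longrightarrow> \<bar>g z\<bar> \<le> c"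
    using assms by (metis bounded_onE)
  show ?thesis
    by (rule bounded_onI[of _ _ "b * c"]) (use b c \<open>0 < b\<close> in \<open>auto simp: abs_mult intro!: mult_mono\<close>)
qed

lemma function_space_bounded_on: "function_space (bounded_on Z)"
  unfolding function_space_def
proof (intro conjI ballI allI)
  show "(\<lambda>_. 0) \<in> bounded_on Z" by (rule bounded_onI[of _ _ 0]) simp
  fix f assume f: "f \<in> bounded_on Z"
  show "(\<lambda>x. c * f x) \<in> bounded_on Z" for c
    using bounded_on_mult[OF bounded_onI[of Z "\<lambda>_. c" "\<bar>c\<bar>"] f] by simp
  fix g assume g: "g \<in> bounded_on Z"
  obtain b c where b: "\<And>z. z \<in> Z \<Longrightarrow> \<bar>f z\<bar> \<le> b" and c: "\<And>z. z \<in> Z \<Longrightarrow> \<bar>g z\<bar> \<le> c"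
    using f g by (metis bounded_onE)
  show "(\<lambda>x. f x + g x) \<in> bounded_on Z"
    by (rule bounded_onI[of _ _ "b + c"]) (use b c abs_triangle_ineq in \<open>fastforce intro: order_trans add_mono\<close>)
qed

context
  fixes L :: "('c, 'f, 'r) language" and T and N :: "('a, 'c, 'f, 'r) lstruct"
  assumes L: "is_language L" and T: "is_theory L T" "complete_theory L T" and N: "is_model L T N"
begin

private lemma N_structure: "is_structure L N"
  using N by (simp add: is_model_def)

lemma types_ofI:
  assumes zero: "\<And>\<phi>. \<phi> \<notin> formulas L n \<Longrightarrow> p \<phi> = 0"
    and add: "\<And>\<phi> \<psi>. \<phi> \<in> formulas L n \<Longrightarrow> \<psi> \<in> formulas L n \<Longrightarrow> p (Add \<phi> \<psi>) = p \<phi> + p \<psi>"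
    and scale: "\<And>r \<phi>. \<phi> \<in> formulas L n \<Longrightarrow> p (Scale r \<phi>) = r * p \<phi>"
    and pos: "\<And>\<phi>. \<phi> \<in> formulas L n \<Longrightarrow> (\<And>as. as \<in> tuples N n \<Longrightarrow> 0 \<le> value_at N \<phi> as) \<Longrightarrow> 0 \<le> p \<phi>"
    and one: "p (Const 1) = 1"
  shows "p \<in> types_of L T n"
proof -
  have mono: "p \<phi> \<le> p \<psi>"
    if "\<phi> \<in> formulas L n" "\<psi> \<in> formulas L n" "entails_le L T n \<phi> \<psi>" for \<phi> \<psi>
  proof -
    have "0 \<le> p (Add \<psi> (Scale (-1) \<phi>))"
      using that entails_le_iff[OF L T N that(1,2)]
      by (intro pos formulas_intros) (auto simp: value_at_Add value_at_Scale)
    then show ?thesis using that add[of \<psi> "Scale (-1) \<phi>"] scale[of \<phi> "-1"] by (simp add: formulas_intros)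
  qed
  have "0 \<le> p \<phi>" if "\<phi> \<in> formulas L n" "entails_le L T n (Const 0) \<phi>" for \<phi>
    using that entails_le_iff[OF L T N formulas_intros(1) that(1)]
    by (intro pos) (auto simp: value_at_Const)
  then show ?thesis
    using zero add scale one mono by (auto simp: types_of_def entails_eq_def intro: antisym)
qed

lemma type_mono:
  assumes p: "p \<in> types_of L T n" and \<phi>: "\<phi> \<in> formulas L n" and \<psi>: "\<psi> \<in> formulas L n"
    and le: "\<And>as. as \<in> tuples N n \<Longrightarrow> value_at N \<phi> as \<le> value_at N \<psi> as"
  shows "p \<phi> \<le> p \<psi>"
proof -
  have f: "Add \<psi> (Scale (-1) \<phi>) \<in> formulas L n" using \<phi> \<psi> by (intro formulas_intros)
  have "entails_le L T n (Const 0) (Add \<psi> (Scale (-1) \<phi>))"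
    using le entails_le_iff[OF L T N formulas_intros(1) f]
    by (auto simp: value_at_Add value_at_Scale value_at_Const)
  then have "0 \<le> p (Add \<psi> (Scale (-1) \<phi>))" using p f by (auto simp: types_of_def)
  then show ?thesis using types_ofD(2,3)[OF p] \<phi> \<psi> by (simp add: formulas_intros)
qed

lemma type_Const: assumes p: "p \<in> types_of L T n" shows "p (Const r) = r"
proof -
  have eq: "p (Const r) = p (Scale r (Const 1))"
    by (intro antisym type_mono[OF p] formulas_intros) (simp_all add: value_at_Scale value_at_Const)
  have "p (Const 1) = 1" using p by (auto simp: types_of_def)
  then show ?thesis using eq types_ofD(3)[OF p formulas_intros(1), of r 1] by simp
qed

lemma tp_type: "as \<in> tuples N n \<Longrightarrow> tp L N as \<in> types_of L T n"
  by (rule types_ofI)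
    (auto simp: tp_def tuples_def formulas_intros value_at_Add value_at_Scale value_at_Const)

lemma upper_extension_sublinear:
  assumes p: "p \<in> types_of L T n" and V: "function_space V" and onto: "\<pi> ` Z = tuples N n"
    and bdd: "V \<subseteq> bounded_on Z"
  shows "sublinear_functional V (upper_extension L N n \<pi> Z p)"
    and "f \<in> V \<Longrightarrow> \<psi> \<in> formulas L n \<Longrightarrow> (\<And>z. z \<in> Z \<Longrightarrow> f z \<le> value_at N \<psi> (\<pi> z)) \<Longrightarrow>
      upper_extension L N n \<pi> Z p f \<le> p \<psi>"
    and "f \<in> V \<Longrightarrow> (\<And>\<psi>. \<psi> \<in> formulas L n \<Longrightarrow> (\<And>z. z \<in> Z \<Longrightarrow> f z \<le> value_at N \<psi> (\<pi> z)) \<Longrightarrow> r \<le> p \<psi>) \<Longrightarrow>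
      r \<le> upper_extension L N n \<pi> Z p f"
proof -
  define A where "A f = {p \<psi> | \<psi>. \<psi> \<in> formulas L n \<and> (\<forall>z\<in>Z. f z \<le> value_at N \<psi> (\<pi> z))}" for f
  have AI: "p \<psi> \<in> A f" if "\<psi> \<in> formulas L n" "\<And>z. z \<in> Z \<Longrightarrow> f z \<le> value_at N \<psi> (\<pi> z)" for f \<psi>
    using that by (auto simp: A_def)
  have AE: "\<exists>\<psi>. a = p \<psi> \<and> \<psi> \<in> formulas L n \<and> (\<forall>z\<in>Z. f z \<le> value_at N \<psi> (\<pi> z))" if "a \<in> A f" for a f
    using that by (auto simp: A_def)
  have ne: "A f \<noteq> {}" if f: "f \<in> V" for f
  proof -
    obtain b where "\<And>z. z \<in> Z \<Longrightarrow> \<bar>f z\<bar> \<le> b" using f bdd by (metis bounded_onE subsetD)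
    then have "p (Const b) \<in> A f" by (intro AI formulas_intros) (simp add: value_at_Const abs_le_iff)
    then show ?thesis by blast
  qed
  have *: "sublinear_functional V (\<lambda>f. Inf (A f)) \<and> (\<forall>f\<in>V. \<forall>a\<in>A f. Inf (A f) \<le> a)"
  proof (rule sublinear_Inf[OF V ne])
    show "\<exists>c\<in>A (\<lambda>x. f x + g x). c \<le> a + b" if ab: "a \<in> A f" "b \<in> A g" for f g a b
    proof -
      obtain \<phi> \<psi> where \<phi>: "a = p \<phi>" "\<phi> \<in> formulas L n" "\<forall>z\<in>Z. f z \<le> value_at N \<phi> (\<pi> z)"
        and \<psi>: "b = p \<psi>" "\<psi> \<in> formulas L n" "\<forall>z\<in>Z. g z \<le> value_at N \<psi> (\<pi> z)"
        using AE[OF ab(1)] AE[OF ab(2)] by blast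
      have "p (Add \<phi> \<psi>) \<in> A (\<lambda>x. f x + g x)"
        using \<phi> \<psi> by (intro AI formulas_intros) (auto simp: value_at_Add add_mono)
      then show ?thesis using types_ofD(2)[OF p \<phi>(2) \<psi>(2)] \<phi>(1) \<psi>(1) by (intro bexI[of _ "p (Add \<phi> \<psi>)"]) auto
    qed
    show "\<exists>b\<in>A (\<lambda>x. c * f x). b \<le> c * a" if c: "0 < c" and a: "a \<in> A f" for c f a
    proof -
      obtain \<phi> where \<phi>: "a = p \<phi>" "\<phi> \<in> formulas L n" "\<forall>z\<in>Z. f z \<le> value_at N \<phi> (\<pi> z)"
        using AE[OF a] by blast
      have "p (Scale c \<phi>) \<in> A (\<lambda>x. c * f x)"
        using \<phi> c by (intro AI formulas_intros) (auto simp: value_at_Scale)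
      then show ?thesis using types_ofD(3)[OF p \<phi>(2), of c] \<phi>(1) by (intro bexI[of _ "p (Scale c \<phi>)"]) auto
    qed
    have "p (Const 0) \<in> A (\<lambda>_. 0)" by (intro AI formulas_intros) (simp add: value_at_Const)
    then show "\<exists>a\<in>A (\<lambda>_. 0). a \<le> 0" using type_Const[OF p, of 0] by (intro bexI[of _ "p (Const 0)"]) auto
    show "0 \<le> a" if a: "a \<in> A (\<lambda>_. 0)" for a
    proof -
      obtain \<phi> where \<phi>: "a = p \<phi>" "\<phi> \<in> formulas L n" "\<forall>z\<in>Z. 0 \<le> value_at N \<phi> (\<pi> z)"
        using AE[OF a] by blast
      have "p (Const 0) \<le> p \<phi>"
      proof (rule type_mono[OF p formulas_intros(1) \<phi>(2)])
        fix as assume "as \<in> tuples N n"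
        then obtain z where "z \<in> Z" "as = \<pi> z" using onto by blast
        then show "value_at N (Const 0) as \<le> value_at N \<phi> as" using \<phi>(3) by (simp add: value_at_Const)
      qed
      then show ?thesis using type_Const[OF p, of 0] \<phi>(1) by simp
    qed
  qed
  have eq: "upper_extension L N n \<pi> Z p f = Inf (A f)" for f by (simp add: upper_extension_def A_def)
  then have eq': "upper_extension L N n \<pi> Z p = (\<lambda>f. Inf (A f))" by (rule ext)
  show "sublinear_functional V (upper_extension L N n \<pi> Z p)" unfolding eq' using * by blast
  show "upper_extension L N n \<pi> Z p f \<le> p \<psi>"
    if "f \<in> V" "\<psi> \<in> formulas L n" "\<And>z. z \<in> Z \<Longrightarrow> f z \<le> value_at N \<psi> (\<pi> z)"
    unfolding eq using * that(1) AI[OF that(2,3)] by blast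
  show "r \<le> upper_extension L N n \<pi> Z p f"
    if "f \<in> V" "\<And>\<psi>. \<psi> \<in> formulas L n \<Longrightarrow> (\<And>z. z \<in> Z \<Longrightarrow> f z \<le> value_at N \<psi> (\<pi> z)) \<Longrightarrow> r \<le> p \<psi>"
    unfolding eq
  proof (rule cInf_greatest[OF ne[OF that(1)]])
    fix a assume "a \<in> A f"
    then obtain \<psi> where "a = p \<psi>" "\<psi> \<in> formulas L n" "\<forall>z\<in>Z. f z \<le> value_at N \<psi> (\<pi> z)"
      using AE by metis
    then show "r \<le> a" using that(2) by blast
  qed
qed

section \<open>Extreme types are approximately realised in every model\<close>

lemma extreme_type_mean:
  assumes p: "p \<in> extreme_types_of L T n" and q: "q \<in> types_of L T n" "s \<in> types_of L T n"
    and u: "0 < u" "u < 1" and mix: "\<And>\<phi>. p \<phi> = (1 - u) * q \<phi> + u * s \<phi>"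
  shows "q = p"
proof -
  have "p = (\<lambda>\<phi>. (1 - u) * q \<phi> + u * s \<phi>)" using mix by (rule ext)
  then have qs: "q = s" using p q u unfolding extreme_types_of_def by blast
  have "p \<phi> = q \<phi>" for \<phi> unfolding mix qs by (simp add: algebra_simps)
  then show ?thesis by auto
qed

text \<open>Since \<open>p\<close> is extreme, \<open>\<mu>\<close> behaves like a point mass on formulas.  For \<open>0 \<le> h \<le> 1\<close> the functionals
  \<open>\<mu> (h \<phi>)\<close> and \<open>\<mu> ((1 - h) \<phi>)\<close> are multiples of types that add up to \<open>p\<close>, so both are multiples of
  \<open>p\<close> and \<open>\<mu> (h \<phi>) = \<mu> h * p \<phi>\<close>.  An affine rescaling of \<open>\<phi>\<close> itself is an admissible \<open>h\<close>, whence
  \<open>\<mu> (\<phi>\<^sup>2) = (p \<phi>)\<^sup>2\<close>.\<close>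

lemma extreme_type_extension:
  assumes p: "p \<in> extreme_types_of L T n" and B_def: "B = bounded_on (tuples N n)"
    and \<mu>: "linear_functional B \<mu>"
    and pos: "\<And>f. f \<in> B \<Longrightarrow> (\<And>z. z \<in> tuples N n \<Longrightarrow> 0 \<le> f z) \<Longrightarrow> 0 \<le> \<mu> f"
    and ext: "\<And>\<phi>. \<phi> \<in> formulas L n \<Longrightarrow> \<mu> (value_at N \<phi>) = p \<phi>"
    and \<phi>: "\<phi> \<in> formulas L n"
  shows "\<mu> (\<lambda>z. (value_at N \<phi> z - p \<phi>)\<^sup>2) = 0"
proof -
  have pt: "p \<in> types_of L T n" using p by (simp add: extreme_types_of_def)
  note B = function_space_bounded_on[of "tuples N n", folded B_def]
  note B' = function_spaceD[OF B] and \<mu>' = linear_functionalD[OF \<mu>]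
  have inB: "value_at N \<phi> \<in> B" if "\<phi> \<in> formulas L n" for \<phi>
    using value_at_bounded[OF N_structure that] unfolding B_def by (metis bounded_onI)
  have constB: "(\<lambda>_. c) \<in> B" for c unfolding B_def by (rule bounded_onI[of _ _ "\<bar>c\<bar>"]) simp
  have multB: "(\<lambda>z. f z * g z) \<in> B" if "f \<in> B" "g \<in> B" for f g
    using that unfolding B_def by (rule bounded_on_mult)
  have \<mu>c: "\<mu> (\<lambda>_. c) = c" for c
    using ext[OF formulas_intros(1), of c] type_Const[OF pt] by (simp add: value_at_Const[abs_def])
  have null: "\<mu> (\<lambda>z. h z * f z) = 0"
    if h: "h \<in> B" "\<And>z. z \<in> tuples N n \<Longrightarrow> 0 \<le> h z" "\<mu> h = 0" and f: "f \<in> B" for h f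
  proof -
    obtain b where b: "\<And>z. z \<in> tuples N n \<Longrightarrow> \<bar>f z\<bar> \<le> b" using f unfolding B_def by (metis bounded_onE)
    have le: "0 \<le> c * \<mu> (\<lambda>z. h z * f z)" if c: "\<bar>c\<bar> = 1" for c
    proof -
      have "0 \<le> \<mu> (\<lambda>z. b * h z + c * (h z * f z))"
      proof (rule pos)
        show "(\<lambda>z. b * h z + c * (h z * f z)) \<in> B" using h(1) f by (intro B' multB)
        fix z assume z: "z \<in> tuples N n"
        have "- b \<le> c * f z" using b[OF z] c by (auto simp: abs_le_iff abs_if split: if_splits)
        then have "0 \<le> h z * (b + c * f z)" using h(2)[OF z] by simp
        then show "0 \<le> b * h z + c * (h z * f z)" by (simp add: algebra_simps)
      qed
      also have "\<dots> = c * \<mu> (\<lambda>z. h z * f z)" using h(1,3) f by (simp add: \<mu>' B' multB)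
      finally show ?thesis .
    qed
    from le[of 1] le[of "-1"] show ?thesis by simp
  qed
  have mult: "\<mu> (\<lambda>z. h z * value_at N \<psi> z) = \<mu> h * p \<psi>"
    if h: "h \<in> B" "\<And>z. z \<in> tuples N n \<Longrightarrow> 0 \<le> h z" "\<And>z. z \<in> tuples N n \<Longrightarrow> h z \<le> 1"
      and \<psi>: "\<psi> \<in> formulas L n" for h \<psi>
  proof -
    let ?k = "\<lambda>z. 1 + -1 * h z"
    have k: "?k \<in> B" using h(1) by (intro B' constB)
    have \<mu>k: "\<mu> ?k = 1 - \<mu> h" 
      using \<mu>'(1)[OF constB[of 1] B'(3)[OF h(1), of "-1"]] \<mu>'(2)[OF h(1), of "-1"] \<mu>c by simp
    have split: "\<mu> (\<lambda>z. h z * value_at N \<psi> z) + \<mu> (\<lambda>z. ?k z * value_at N \<psi> z) = p \<psi>"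
      if \<psi>: "\<psi> \<in> formulas L n" for \<psi>
    proof -
      have "\<mu> (\<lambda>z. h z * value_at N \<psi> z + ?k z * value_at N \<psi> z) = p \<psi>"
        using ext[OF \<psi>] by (simp add: algebra_simps)
      then show ?thesis using \<mu>'(1)[OF multB[OF h(1) inB[OF \<psi>]] multB[OF k inB[OF \<psi>]]] by simp
    qed
    have "0 \<le> \<mu> h" by (rule pos[OF h(1,2)])
    moreover have "0 \<le> \<mu> ?k" by (rule pos[OF k]) (use h(3) in simp)
    ultimately consider "\<mu> h = 0" | "\<mu> ?k = 0" | "0 < \<mu> h" "\<mu> h < 1" using \<mu>k by linarith
    then show ?thesis
    proof cases
      case 1
      then show ?thesis using null[OF h(1,2) 1 inB[OF \<psi>]] by simp
    next
      case 2
      have "\<mu> (\<lambda>z. ?k z * value_at N \<psi> z) = 0" using h(3) by (intro null k 2 inB \<psi>) auto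
      then show ?thesis using split[OF \<psi>] 2 \<mu>k by simp
    next
      case 3
      define weighted where "weighted = (\<lambda>h \<phi>. if \<phi> \<in> formulas L n then \<mu> (\<lambda>z. h z * value_at N \<phi> z) / \<mu> h else 0)"
      have weighted: "weighted g \<in> types_of L T n"
        if g: "g \<in> B" "\<And>z. z \<in> tuples N n \<Longrightarrow> 0 \<le> g z" "0 < \<mu> g" for g
      proof (rule types_ofI)
        show "weighted g \<phi> = 0" if "\<phi> \<notin> formulas L n" for \<phi> using that by (simp add: weighted_def)
        show "weighted g (Add \<phi> \<psi>) = weighted g \<phi> + weighted g \<psi>"
          if \<phi>: "\<phi> \<in> formulas L n" and \<psi>: "\<psi> \<in> formulas L n" for \<phi> \<psi>
          using \<mu>'(1)[OF multB[OF g(1) inB[OF \<phi>]] multB[OF g(1) inB[OF \<psi>]]] \<phi> \<psi>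
          by (simp add: weighted_def formulas_intros value_at_Add distrib_left add_divide_distrib)
        show "weighted g (Scale r \<phi>) = r * weighted g \<phi>" if \<phi>: "\<phi> \<in> formulas L n" for r \<phi>
          using \<mu>'(2)[OF multB[OF g(1) inB[OF \<phi>]], of r] \<phi>
          by (simp add: weighted_def formulas_intros value_at_Scale mult.left_commute)
        show "0 \<le> weighted g \<phi>"
          if \<phi>: "\<phi> \<in> formulas L n" and nonneg: "\<And>as. as \<in> tuples N n \<Longrightarrow> 0 \<le> value_at N \<phi> as" for \<phi>
        proof -
          have "0 \<le> \<mu> (\<lambda>z. g z * value_at N \<phi> z)"
            using g(2) nonneg by (intro pos multB g(1) inB[OF \<phi>]) auto
          then show ?thesis using g(3) by (simp add: weighted_def)
        qed
        show "weighted g (Const 1) = 1"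
          using g(3) by (simp add: weighted_def formulas_intros value_at_Const)
      qed
      have "weighted h = p"
      proof (rule extreme_type_mean[OF p weighted[OF h(1,2) 3(1)] weighted[OF k]])
        show "0 \<le> ?k z" if "z \<in> tuples N n" for z using h(3)[OF that] by simp
        show "0 < \<mu> ?k" "0 < 1 - \<mu> h" "1 - \<mu> h < 1" using 3 \<mu>k by auto
        fix \<phi>
        show "p \<phi> = (1 - (1 - \<mu> h)) * weighted h \<phi> + (1 - \<mu> h) * weighted ?k \<phi>"
        proof (cases "\<phi> \<in> formulas L n")
          case True
          then show ?thesis using 3 split[OF True] \<mu>k by (simp add: weighted_def)
        next
          case False
          then show ?thesis using types_ofD(1)[OF pt False] by (simp add: weighted_def)
        qed
      qed
      then have "\<mu> (\<lambda>z. h z * value_at N \<psi> z) / \<mu> h = p \<psi>" using \<psi> by (auto simp: weighted_def)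
      then show ?thesis using 3 by (simp add: field_simps)
    qed
  qed
  obtain b where b: "0 < b" "\<And>z. z \<in> tuples N n \<Longrightarrow> \<bar>value_at N \<phi> z\<bar> \<le> b"
    using value_at_bounded[OF N_structure \<phi>] by metis
  define F where "F = value_at N \<phi>"
  have F: "F \<in> B" "(\<lambda>z. F z * F z) \<in> B" using inB[OF \<phi>] multB by (auto simp: F_def)
  have \<mu>F: "\<mu> F = p \<phi>" using ext[OF \<phi>] by (simp add: F_def)
  \<comment> \<open>The rescaling of \<open>[- b, b]\<close> to \<open>[0, 1]\<close>.\<close>
  let ?h = "\<lambda>z. 1 / 2 + 1 / (2 * b) * F z"
  have hB: "?h \<in> B" by (intro B' constB F)
  have "\<mu> (\<lambda>z. ?h z * value_at N \<phi> z) = \<mu> ?h * p \<phi>"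
  proof (rule mult[OF hB _ _ \<phi>])
    fix z assume "z \<in> tuples N n"
    then have "\<bar>F z\<bar> \<le> b" using b(2) by (simp add: F_def)
    then show "0 \<le> ?h z" "?h z \<le> 1" using b(1) by (auto simp: field_simps abs_le_iff)
  qed
  moreover have "(\<lambda>z. ?h z * value_at N \<phi> z) = (\<lambda>z. 1 / 2 * F z + 1 / (2 * b) * (F z * F z))"
    by (auto simp: F_def algebra_simps)
  moreover have "\<mu> (\<lambda>z. 1 / 2 * F z + 1 / (2 * b) * (F z * F z)) = 1 / 2 * p \<phi> + 1 / (2 * b) * \<mu> (\<lambda>z. F z * F z)"
    using \<mu>'(1)[OF B'(3)[OF F(1)] B'(3)[OF F(2)]] \<mu>'(2)[OF F(1)] \<mu>'(2)[OF F(2)] \<mu>F by (simp only:)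
  moreover have "\<mu> ?h = 1 / 2 + 1 / (2 * b) * p \<phi>"
    using \<mu>'(1)[OF constB B'(3)[OF F(1)]] \<mu>'(2)[OF F(1)] \<mu>F \<mu>c by (simp only:)
  ultimately have "1 / 2 * p \<phi> + 1 / (2 * b) * \<mu> (\<lambda>z. F z * F z) = (1 / 2 + 1 / (2 * b) * p \<phi>) * p \<phi>"
    by (simp only:)
  then have FF: "\<mu> (\<lambda>z. F z * F z) = p \<phi> * p \<phi>" using b(1) by (simp add: field_simps)
  have "(\<lambda>z. (value_at N \<phi> z - p \<phi>)\<^sup>2) = (\<lambda>z. (F z * F z + (-2 * p \<phi>) * F z) + (p \<phi>)\<^sup>2)"
    by (auto simp: F_def power2_eq_square algebra_simps)
  moreover have "\<mu> (\<lambda>z. (F z * F z + (-2 * p \<phi>) * F z) + (p \<phi>)\<^sup>2) = (p \<phi> * p \<phi> + (-2 * p \<phi>) * p \<phi>) + (p \<phi>)\<^sup>2"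
    using \<mu>'(1)[OF B'(2)[OF F(2) B'(3)[OF F(1)]] constB] \<mu>'(1)[OF F(2) B'(3)[OF F(1)]] \<mu>'(2)[OF F(1)] \<mu>F \<mu>c FF
    by (simp only:)
  ultimately show ?thesis by (simp add: power2_eq_square)
qed

text \<open>Otherwise the sum of the squares \<open>(\<phi> - p \<phi>)\<^sup>2\<close> over \<open>\<phi> \<in> \<Phi>\<close> is at least \<open>\<epsilon>\<^sup>2\<close> at all tuples,
  while a positive extension of \<open>p\<close> to the bounded functions maps it to \<open>0\<close>.\<close>

theorem extreme_type_approximately_realised:
  assumes p: "p \<in> extreme_types_of L T n" and \<Phi>: "finite \<Phi>" "\<Phi> \<subseteq> formulas L n" and \<epsilon>: "0 < \<epsilon>"
  obtains z where "z \<in> tuples N n" "\<And>\<phi>. \<phi> \<in> \<Phi> \<Longrightarrow> \<bar>value_at N \<phi> z - p \<phi>\<bar> < \<epsilon>"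
proof -
  note found = that
  have pt: "p \<in> types_of L T n" using p by (simp add: extreme_types_of_def)
  define B where "B = bounded_on (tuples N n)"
  note B = function_space_bounded_on[of "tuples N n", folded B_def]
  have id: "(\<lambda>x. x) ` tuples N n = tuples N n" "B \<subseteq> bounded_on (tuples N n)" by (auto simp: B_def)
  note U = upper_extension_sublinear[OF pt B id]
  obtain \<mu> where \<mu>: "linear_functional B \<mu>"
    and le: "\<And>f. f \<in> B \<Longrightarrow> \<mu> f \<le> upper_extension L N n (\<lambda>x. x) (tuples N n) p f"
    using hahn_banach[OF B U(1)] by metis
  have upper: "\<mu> f \<le> p \<psi>" if "f \<in> B" "\<psi> \<in> formulas L n" "\<And>z. z \<in> tuples N n \<Longrightarrow> f z \<le> value_at N \<psi> z" for f \<psi>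
    using le[OF that(1)] U(2)[OF that] by linarith
  have neg: "\<mu> (\<lambda>z. -1 * f z) = - \<mu> f" if "f \<in> B" for f
    using linear_functionalD(2)[OF \<mu> that, of "-1"] by simp
  have inB: "value_at N \<phi> \<in> B" if "\<phi> \<in> formulas L n" for \<phi>
    using value_at_bounded[OF N_structure that] unfolding B_def by (metis bounded_onI)
  have ext: "\<mu> (value_at N \<phi>) = p \<phi>" if \<phi>: "\<phi> \<in> formulas L n" for \<phi>
  proof (rule antisym)
    show "\<mu> (value_at N \<phi>) \<le> p \<phi>" by (rule upper[OF inB[OF \<phi>] \<phi>]) simp
    have "\<mu> (\<lambda>z. -1 * value_at N \<phi> z) \<le> p (Scale (-1) \<phi>)"
      by (rule upper[OF function_spaceD(3)[OF B inB[OF \<phi>]] formulas_intros(3)[OF \<phi>]]) (simp add: value_at_Scale)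
    then show "p \<phi> \<le> \<mu> (value_at N \<phi>)" using neg[OF inB[OF \<phi>]] types_ofD(3)[OF pt \<phi>, of "-1"] by simp
  qed
  have pos: "0 \<le> \<mu> f" if f: "f \<in> B" "\<And>z. z \<in> tuples N n \<Longrightarrow> 0 \<le> f z" for f
  proof -
    have "\<mu> (\<lambda>z. -1 * f z) \<le> p (Const 0)"
      by (rule upper[OF function_spaceD(3)[OF B f(1)] formulas_intros(1)]) (use f(2) in \<open>simp add: value_at_Const\<close>)
    then show ?thesis using neg[OF f(1)] type_Const[OF pt] by simp
  qed
  have sq: "\<mu> (\<lambda>z. (value_at N \<phi> z - p \<phi>)\<^sup>2) = 0" if "\<phi> \<in> formulas L n" for \<phi>
    by (rule extreme_type_extension[OF p B_def \<mu> pos ext that])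
  have sqB: "(\<lambda>z. (value_at N \<phi> z - p \<phi>)\<^sup>2) \<in> B" if \<phi>: "\<phi> \<in> formulas L n" for \<phi>
  proof -
    obtain b where b: "\<And>as. as \<in> tuples N n \<Longrightarrow> \<bar>value_at N \<phi> as\<bar> \<le> b"
      using value_at_bounded[OF N_structure \<phi>] by metis
    have "(value_at N \<phi> z - p \<phi>)\<^sup>2 \<le> (b + \<bar>p \<phi>\<bar>)\<^sup>2" if "z \<in> tuples N n" for z
      using b[OF that] by (intro power2_le_iff_abs_le[THEN iffD2]) linarith+
    then show ?thesis unfolding B_def by (intro bounded_onI) simp
  qed
  show thesis
  proof (rule ccontr)
    assume "\<not> thesis"
    then have far: "\<exists>\<phi>\<in>\<Phi>. \<epsilon> \<le> \<bar>value_at N \<phi> z - p \<phi>\<bar>" if "z \<in> tuples N n" for z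
      using found[OF that] by (meson not_le)
    let ?S = "\<lambda>z. \<Sum>\<phi>\<in>\<Phi>. (value_at N \<phi> z - p \<phi>)\<^sup>2"
    have SB: "?S \<in> B" using \<Phi> sqB by (intro function_space_sum[OF B]) auto
    have cB: "(\<lambda>_. - \<epsilon>\<^sup>2) \<in> B" unfolding B_def by (rule bounded_onI[of _ _ "\<epsilon>\<^sup>2"]) simp
    have "\<mu> ?S = (\<Sum>\<phi>\<in>\<Phi>. \<mu> (\<lambda>z. (value_at N \<phi> z - p \<phi>)\<^sup>2))"
      using \<Phi> sqB by (intro linear_functional_sum[OF B \<mu>]) auto
    also have "\<dots> = 0" using \<Phi>(2) sq by (intro sum.neutral) auto
    finally have S0: "\<mu> ?S = 0" .
    have "\<mu> (\<lambda>_. - \<epsilon>\<^sup>2) \<le> p (Const (- \<epsilon>\<^sup>2))"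
      by (rule upper[OF cB formulas_intros(1)]) (simp add: value_at_Const)
    moreover have "0 \<le> \<mu> (\<lambda>z. ?S z + - \<epsilon>\<^sup>2)"
    proof (rule pos[OF function_spaceD(2)[OF B SB cB]])
      fix z assume "z \<in> tuples N n"
      then obtain \<phi> where \<phi>: "\<phi> \<in> \<Phi>" "\<epsilon> \<le> \<bar>value_at N \<phi> z - p \<phi>\<bar>" using far by blast
      have "\<epsilon>\<^sup>2 \<le> (value_at N \<phi> z - p \<phi>)\<^sup>2" using \<phi>(2) \<epsilon> by (simp add: abs_le_square_iff[symmetric])
      also have "\<dots> \<le> ?S z" using \<phi>(1) \<Phi>(1) by (intro member_le_sum) auto
      finally show "0 \<le> ?S z + - \<epsilon>\<^sup>2" by simp
    qed
    ultimately show False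
      using linear_functionalD(1)[OF \<mu> SB cB] S0 type_Const[OF pt, of "- \<epsilon>\<^sup>2"] zero_less_power[OF \<epsilon>, of 2]
      by linarith
  qed
qed

end

section \<open>Formulas are continuous on spaces of maps into a structure\<close>

definition map_topology :: "('a, 'c, 'f, 'r) lstruct \<Rightarrow> ('i \<Rightarrow> 'a) topology" where
  "map_topology M = product_topology (\<lambda>_. mtopology_of (metr M)) UNIV"

lemma topspace_map_topology: "topspace (map_topology M) = {h. \<forall>i. h i \<in> carr M}"
  by (auto simp: map_topology_def PiE_def Pi_def)

lemma compact_map_topology: "compact_structure M \<Longrightarrow> compact_space (map_topology M)"
  by (simp add: map_topology_def compact_structure_def compact_space_product_topology)

lemma continuous_map_eval:
  assumes L: "is_language L" and M: "is_structure L M" and wf: "wf_fm L \<phi>"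
    and w: "\<And>k. continuous_map Y (mtopology_of (metr M)) (\<lambda>y. w y k)"
  shows "continuous_map Y euclideanreal (\<lambda>y. eval_fm M (w y) \<phi>)"
proof -
  interpret M: Metric_space "carr M" "mdist (metr M)" by (rule Metric_space_mspace_mdist)
  have vals: "w y \<in> valns M" if "y \<in> topspace Y" for y
    using continuous_map_image_subset_topspace[OF w] that by (auto simp: valns_def)
  obtain l where lip: "fm_lip M \<phi> l" using eval_fm_lipschitz[OF L M wf] by blast
  note l = lip_boundD[OF lip]
  have "\<exists>U. openin Y U \<and> y \<in> U \<and> (\<forall>x\<in>U. \<bar>eval_fm M (w y) \<phi> - eval_fm M (w x) \<phi>\<bar> < \<epsilon>)"
    if y: "y \<in> topspace Y" and \<epsilon>: "0 < \<epsilon>" for y \<epsilon>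
  proof -
    define \<delta> where "\<delta> = \<epsilon> / (l + 1)"
    have \<delta>: "0 < \<delta>" "l * \<delta> < \<epsilon>" using \<epsilon> l(1) by (auto simp: \<delta>_def field_simps)
    define U where "U = topspace Y \<inter> (\<Inter>k\<in>free_vars \<phi>. {x \<in> topspace Y. w x k \<in> M.mball (w y k) \<delta>})"
    have "openin Y {x \<in> topspace Y. w x k \<in> M.mball (w y k) \<delta>}" for k
      using openin_continuous_map_preimage[OF w[of k], of "M.mball (w y k) \<delta>"]
      by (simp add: mtopology_of_def)
    then have "openin Y U" unfolding U_def
      by (cases "free_vars \<phi> = {}") (auto intro!: openin_Int openin_INT finite_free_vars)
    moreover have "y \<in> U" using y vals[OF y] \<delta> by (auto simp: U_def valns_def)
    moreover have "\<bar>eval_fm M (w y) \<phi> - eval_fm M (w x) \<phi>\<bar> < \<epsilon>" if x: "x \<in> U" for x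
    proof -
      have "x \<in> topspace Y" "\<forall>k\<in>free_vars \<phi>. mdist (metr M) (w y k) (w x k) \<le> \<delta>"
        using x by (auto simp: U_def intro: less_imp_le)
      then have "\<bar>eval_fm M (w y) \<phi> - eval_fm M (w x) \<phi>\<bar> \<le> l * \<delta>"
        using l(2)[OF vals[OF y] vals, of x \<delta>] \<delta>(1) by simp
      with \<delta>(2) show ?thesis by simp
    qed
    ultimately show ?thesis by blast
  qed
  then show ?thesis
    by (simp add: Met_TC.continuous_map_to_metric[of Y, unfolded mtopology_is_euclidean mball_eq_ball]
        dist_real_def)
qed

lemma continuous_map_eval_comp:
  assumes "is_language L" "is_structure L M" "wf_fm L \<phi>"
  shows "continuous_map (map_topology M) euclideanreal (\<lambda>h. eval_fm M (h \<circ> \<sigma>) \<phi>)"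
proof (rule continuous_map_eval[OF assms])
  show "continuous_map (map_topology M) (mtopology_of (metr M)) (\<lambda>h. (h \<circ> \<sigma>) k)" for k
    unfolding map_topology_def comp_apply by (rule continuous_map_product_projection) simp
qed

section \<open>Elementary maps\<close>

text \<open>Such maps are points of the space \<open>map_topology N\<close>, whose elements are total functions;
  hence all values of \<open>h\<close>, also those outside the carrier of \<open>M\<close>, are required to lie in \<open>N\<close>.\<close>

definition elementary_map ::
  "('c, 'f, 'r) language \<Rightarrow> ('a, 'c, 'f, 'r) lstruct \<Rightarrow> ('b, 'c, 'f, 'r) lstruct \<Rightarrow> ('a \<Rightarrow> 'b) \<Rightarrow> bool" where
  "elementary_map L M N h \<longleftrightarrow> (\<forall>a. h a \<in> carr N) \<and>
     (\<forall>\<phi> v. wf_fm L \<phi> \<longrightarrow> v \<in> valns M \<longrightarrow> eval_fm N (h \<circ> v) \<phi> = eval_fm M v \<phi>)"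

lemma elementary_mapD:
  assumes "elementary_map L M N h"
  shows "h a \<in> carr N" "wf_fm L \<phi> \<Longrightarrow> v \<in> valns M \<Longrightarrow> eval_fm N (h \<circ> v) \<phi> = eval_fm M v \<phi>"
  using assms by (auto simp: elementary_map_def)

lemma elementary_map_mdist:
  assumes "elementary_map L M N h" "a \<in> carr M" "b \<in> carr M"
  shows "mdist (metr N) (h a) (h b) = mdist (metr M) a b"
proof -
  let ?v = "\<lambda>k::nat. if k = 0 then a else b"
  have "eval_fm N (h \<circ> ?v) (Dist (Var 0) (Var 1)) = eval_fm M ?v (Dist (Var 0) (Var 1))"
    using assms(2,3) by (intro elementary_mapD(2)[OF assms(1)]) (simp_all add: valns_def)
  then show ?thesis by simp
qed

text \<open>The distance of \<open>t\<close> to a fresh variable is a formula that vanishes when the variable has the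
  value of \<open>t\<close>.\<close>

lemma elementary_map_trm:
  assumes N: "is_structure L N" and M: "is_structure L M" and h: "elementary_map L M N h"
    and wf: "wf_trm L t" and v: "v \<in> valns M"
  shows "h (eval_trm M v t) = eval_trm N (h \<circ> v) t"
proof -
  obtain i where i: "i \<notin> vars_trm t" using finite_vars_trm ex_new_if_finite by (metis infinite_UNIV_nat)
  define a where "a = eval_trm M v t"
  define w where "w = v(i := a)"
  have a: "a \<in> carr M" unfolding a_def by (rule eval_trm_in[OF M wf v])
  have w: "w \<in> valns M" unfolding w_def by (rule valns_upd[OF v a])
  have hw: "h \<circ> v \<in> valns N" using h by (auto simp: elementary_map_def valns_def)
  have "eval_trm M w t = a" unfolding a_def w_def by (rule eval_trm_cong) (use i in auto)
  moreover have "eval_trm N (h \<circ> w) t = eval_trm N (h \<circ> v) t"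
    unfolding w_def by (rule eval_trm_cong) (use i in auto)
  moreover have "eval_fm N (h \<circ> w) (Dist t (Var i)) = eval_fm M w (Dist t (Var i))"
    using wf by (intro elementary_mapD(2)[OF h _ w]) simp
  ultimately have "mdist (metr N) (eval_trm N (h \<circ> v) t) (h a) = 0"
    using a by (simp add: w_def)
  then show ?thesis
    using eval_trm_in[OF N wf hw] elementary_mapD(1)[OF h] unfolding a_def by (metis mdist_zero)
qed

lemma map_valuation_of: "map (valuation_of d as) [0..<length as] = as"
  by (rule nth_equalityI) (auto simp: valuation_of_def)

lemma map_comp_valuation_of: "map (h \<circ> valuation_of d as) [0..<length as] = map h as"
  using map_valuation_of[of d as] by (metis map_map)

lemma elementary_map_isomorphism:
  assumes N: "is_structure L N" and M: "is_structure L M" and h: "elementary_map L M N h"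
    and onto: "h ` carr M = carr N"
  shows "isomorphic_structures L M N"
  unfolding isomorphic_structures_def
proof (intro exI[of _ h] conjI ballI)
  note dist = elementary_map_mdist[OF h]
  have "inj_on h (carr M)"
  proof (rule inj_onI)
    fix a b assume "a \<in> carr M" "b \<in> carr M" "h a = h b"
    moreover have "h b \<in> carr N" using h by (simp add: elementary_map_def)
    ultimately show "a = b" using dist[of a b] mdist_zero[of "h b" "metr N" "h b"] by simp
  qed
  with onto show "bij_betw h (carr M) (carr N)" by (simp add: bij_betw_def)
  show "mdist (metr N) (h a) (h b) = mdist (metr M) a b" if "a \<in> carr M" "b \<in> carr M" for a b
    using that by (rule dist)
  note b = base_point[OF M]
  show "h (const_int M c) = const_int N c" if "c \<in> const_syms L" for c
    using elementary_map_trm[OF N M h, of "Cst c" "\<lambda>_. base_point M"] that b by (simp add: valns_def)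
  have vals: "valuation_of (base_point M) as \<in> valns M" if "as \<in> tuples M n" for as n
    using that by (intro valuation_of_valns b) (simp add: tuples_def)
  show "h (fun_int M F as) = fun_int N F (map h as)"
    if F: "F \<in> fun_syms L" and as: "as \<in> tuples M (fun_arity L F)" for F as
  proof -
    let ?t = "App F (map Var [0..<length as])" and ?v = "valuation_of (base_point M) as"
    have "wf_trm L ?t" using F as by (simp add: tuples_def)
    from elementary_map_trm[OF N M h this vals[OF as]]
    have "h (fun_int M F (map ?v [0..<length as])) = fun_int N F (map (h \<circ> ?v) [0..<length as])"
      by (simp only: eval_trm.simps map_map o_def)
    then show ?thesis by (simp only: map_valuation_of map_comp_valuation_of)
  qed
  show "rel_int M R as = rel_int N R (map h as)"
    if R: "R \<in> rel_syms L" and as: "as \<in> tuples M (rel_arity L R)" for R as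
  proof -
    let ?\<phi> = "Rel R (map Var [0..<length as])" and ?v = "valuation_of (base_point M) as"
    have "wf_fm L ?\<phi>" using R as by (simp add: tuples_def)
    then have "eval_fm N (h \<circ> ?v) ?\<phi> = eval_fm M ?v ?\<phi>"
      by (rule elementary_mapD(2)[OF h _ vals[OF as]])
    then have "rel_int M R (map ?v [0..<length as]) = rel_int N R (map (h \<circ> ?v) [0..<length as])"
      by (simp only: eval_fm.simps eval_trm.simps map_map o_def)
    then show ?thesis by (simp only: map_valuation_of map_comp_valuation_of)
  qed
qed

text \<open>The finitely many points of \<open>M\<close> that occur are listed in one tuple, and the formulas are renamed
  to formulas about that tuple, whose type is extreme and therefore approximately realised.\<close>

lemma extremal_finite_approximation:
  fixes M :: "('a, 'c, 'f, 'r) lstruct" and N :: "('b, 'c, 'f, 'r) lstruct"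
  assumes L: "is_language L" and T: "is_theory L T" "complete_theory L T"
    and M: "is_model L T M" "extremal L T M" and N: "is_model L T N"
    and J: "finite J" "\<And>\<phi> \<sigma>. (\<phi>, \<sigma>) \<in> J \<Longrightarrow> wf_fm L \<phi> \<and> \<sigma> \<in> valns M" and \<epsilon>: "0 < \<epsilon>"
  obtains h where "h \<in> topspace (map_topology N)"
    "\<And>\<phi> \<sigma>. (\<phi>, \<sigma>) \<in> J \<Longrightarrow> \<bar>eval_fm N (h \<circ> \<sigma>) \<phi> - eval_fm M \<sigma> \<phi>\<bar> < \<epsilon>"
proof -
  have Ns: "is_structure L N" using N by (simp add: is_model_def)
  define S where "S = (\<Union>(\<phi>, \<sigma>)\<in>J. \<sigma> ` free_vars \<phi>)"
  have "finite S" unfolding S_def using J(1) by (auto simp: finite_free_vars)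
  then obtain as where as: "set as = S" using finite_list by blast
  have SM: "S \<subseteq> carr M" using J(2) by (auto simp: S_def valns_def)
  define pos where "pos = (\<lambda>a. SOME k. k < length as \<and> as ! k = a)"
  have pos: "pos a < length as" "as ! pos a = a" if "a \<in> S" for a
    using someI_ex[of "\<lambda>k. k < length as \<and> as ! k = a"] that
    by (auto simp: pos_def as[symmetric] in_set_conv_nth)
  let ?n = "length as"
  have tup: "as \<in> tuples M ?n" using as SM by (simp add: tuples_def)
  define \<rho> where "\<rho> = (\<lambda>(\<phi> :: ('c, 'f, 'r) fm, \<sigma>). rename (pos \<circ> \<sigma>) \<phi>)"
  have in_S: "\<sigma> k \<in> S" if "(\<phi>, \<sigma>) \<in> J" "k \<in> free_vars \<phi>" for \<phi> \<sigma> k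
    using that by (auto simp: S_def)
  have form: "\<rho> (\<phi>, \<sigma>) \<in> formulas L ?n" if "(\<phi>, \<sigma>) \<in> J" for \<phi> \<sigma>
  proof -
    have "free_vars (\<rho> (\<phi>, \<sigma>)) \<subseteq> (pos \<circ> \<sigma>) ` free_vars \<phi>"
      unfolding \<rho>_def prod.case by (rule free_vars_rename)
    also have "\<dots> \<subseteq> {..<?n}" using pos(1) in_S[OF that] by auto
    finally show ?thesis using J(2)[OF that] by (simp add: formulas_def \<rho>_def wf_rename)
  qed
  have "tp L M as \<in> extreme_types_of L T ?n" using M(2) tup unfolding extremal_def by blast
  moreover have "finite (\<rho> ` J)" "\<rho> ` J \<subseteq> formulas L ?n" using J(1) form by auto
  ultimately obtain z where z: "z \<in> tuples N ?n"
    "\<And>\<phi>. \<phi> \<in> \<rho> ` J \<Longrightarrow> \<bar>value_at N \<phi> z - tp L M as \<phi>\<bar> < \<epsilon>"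
    using extreme_type_approximately_realised[OF L T N _ _ _ \<epsilon>] by metis
  define h where "h = (\<lambda>a. if a \<in> S then z ! pos a else base_point N)"
  show thesis
  proof (rule that[of h])
    show "h \<in> topspace (map_topology N)"
      using z(1) pos(1) base_point[OF Ns] by (auto simp: topspace_map_topology h_def tuples_def)
    fix \<phi> \<sigma> assume J': "(\<phi>, \<sigma>) \<in> J"
    have "value_at N (\<rho> (\<phi>, \<sigma>)) z = eval_fm N (h \<circ> \<sigma>) \<phi>"
      unfolding value_at_def \<rho>_def prod.case eval_rename
      by (rule eval_fm_cong) (use in_S[OF J'] in \<open>simp add: h_def\<close>)
    moreover have "tp L M as (\<rho> (\<phi>, \<sigma>)) = eval_fm M \<sigma> \<phi>"
    proof -
      have "tp L M as (\<rho> (\<phi>, \<sigma>)) = value_at M (\<rho> (\<phi>, \<sigma>)) as" using form[OF J'] by (simp add: tp_def)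
      also have "\<dots> = eval_fm M \<sigma> \<phi>"
        unfolding value_at_def \<rho>_def prod.case eval_rename
        by (rule eval_fm_cong) (use in_S[OF J'] pos(2) in simp)
      finally show ?thesis .
    qed
    ultimately show "\<bar>eval_fm N (h \<circ> \<sigma>) \<phi> - eval_fm M \<sigma> \<phi>\<bar> < \<epsilon>" using z(2)[of "\<rho> (\<phi>, \<sigma>)"] J' by auto
  qed
qed

text \<open>The maps that preserve the value of one formula at one valuation up to some \<open>\<epsilon> > 0\<close> form a
  closed set.  By the finite approximations these sets have the finite intersection property in a
  space that is compact by Tychonoff's theorem.\<close>

theorem extremal_embeds_into_compact:
  fixes M :: "('a, 'c, 'f, 'r) lstruct" and N :: "('b, 'c, 'f, 'r) lstruct"
  assumes L: "is_language L" and T: "is_theory L T" "complete_theory L T"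
    and M: "is_model L T M" "extremal L T M" and N: "is_model L T N" "compact_structure N"
  obtains h where "elementary_map L M N h"
proof -
  have Ns: "is_structure L N" using N by (simp add: is_model_def)
  let ?X = "map_topology N :: ('a \<Rightarrow> 'b) topology"
  define near where "near = (\<lambda>((\<phi> :: ('c, 'f, 'r) fm, \<sigma>), \<epsilon>).
    {h \<in> topspace ?X. eval_fm N (h \<circ> \<sigma>) \<phi> \<in> {eval_fm M \<sigma> \<phi> - \<epsilon> .. eval_fm M \<sigma> \<phi> + \<epsilon>}})"
  define I where "I = ({\<phi>. wf_fm L \<phi>} \<times> valns M) \<times> {\<epsilon> :: real. 0 < \<epsilon>}"
  have "\<Inter>(near ` I) \<noteq> {}"
  proof (rule compact_map_topology[OF N(2), unfolded compact_space_fip, rule_format])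
    have "closedin ?X (near i)" if i: "i \<in> I" for i
    proof -
      obtain \<phi> \<sigma> r where i': "i = ((\<phi>, \<sigma>), r)" by (metis surj_pair)
      then have "wf_fm L \<phi>" using i by (simp add: I_def)
      then show ?thesis
        unfolding near_def i' prod.case
        by (intro closedin_continuous_map_preimage[OF continuous_map_eval_comp[OF L Ns]]) simp_all
    qed
    moreover have "\<Inter>\<F> \<noteq> {}" if \<F>: "finite \<F>" "\<F> \<subseteq> near ` I" for \<F>
    proof -
      obtain J where J: "J \<subseteq> I" "finite J" "\<F> = near ` J" using finite_subset_image[OF \<F>] by blast
      define \<epsilon> where "\<epsilon> = Min (insert 1 (snd ` J))"
      have \<epsilon>: "0 < \<epsilon>" "\<And>i. i \<in> J \<Longrightarrow> \<epsilon> \<le> snd i"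
        using J(1,2) by (auto simp: \<epsilon>_def I_def)
      obtain h where h: "h \<in> topspace ?X"
        "\<And>\<phi> \<sigma>. (\<phi>, \<sigma>) \<in> fst ` J \<Longrightarrow> \<bar>eval_fm N (h \<circ> \<sigma>) \<phi> - eval_fm M \<sigma> \<phi>\<bar> < \<epsilon>"
      proof (rule extremal_finite_approximation[OF L T M N(1) _ _ \<epsilon>(1), of "fst ` J"])
        show "finite (fst ` J)" using J(2) by simp
        show "wf_fm L \<phi> \<and> \<sigma> \<in> valns M" if "(\<phi>, \<sigma>) \<in> fst ` J" for \<phi> \<sigma>
          using that J(1) by (auto simp: I_def)
      qed blast
      have "h \<in> near i" if i: "i \<in> J" for i
      proof -
        obtain \<phi> \<sigma> r where i': "i = ((\<phi>, \<sigma>), r)" by (metis surj_pair)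
        have "(\<phi>, \<sigma>) \<in> fst ` J" using i i' by force
        then have "\<bar>eval_fm N (h \<circ> \<sigma>) \<phi> - eval_fm M \<sigma> \<phi>\<bar> < \<epsilon>" by (rule h(2))
        moreover have "\<epsilon> \<le> r" using \<epsilon>(2)[OF i] by (simp add: i')
        ultimately show ?thesis using h(1) by (auto simp: near_def i')
      qed
      then show ?thesis unfolding J(3) by blast
    qed
    ultimately show "(\<forall>C\<in>near ` I. closedin ?X C) \<and> (\<forall>\<F>. finite \<F> \<and> \<F> \<subseteq> near ` I \<longrightarrow> \<Inter>\<F> \<noteq> {})"
      by blast
  qed
  then obtain h where h: "\<And>i. i \<in> I \<Longrightarrow> h \<in> near i" by blast
  have close: "\<bar>eval_fm N (h \<circ> v) \<phi> - eval_fm M v \<phi>\<bar> \<le> \<epsilon>" "h \<in> topspace ?X"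
    if "wf_fm L \<phi>" "v \<in> valns M" "0 < \<epsilon>" for \<phi> v \<epsilon>
    using h[of "((\<phi>, v), \<epsilon>)"] that by (auto simp: near_def I_def)
  have eq: "eval_fm N (h \<circ> v) \<phi> = eval_fm M v \<phi>" if "wf_fm L \<phi>" "v \<in> valns M" for \<phi> v
  proof -
    have "\<bar>eval_fm N (h \<circ> v) \<phi> - eval_fm M v \<phi>\<bar> \<le> 0"
      by (rule field_le_epsilon) (use close(1)[OF that] in simp)
    then show ?thesis by simp
  qed
  have "is_structure L M" using M by (simp add: is_model_def)
  then have "(\<lambda>_. base_point M) \<in> valns M" using base_point by (auto simp: valns_def)
  then have "h \<in> topspace ?X" using close(2)[of "Const 0" _ 1] by simp
  then have "elementary_map L M N h"
    unfolding elementary_map_def topspace_map_topology using eq by blast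
  then show thesis by (rule that)
qed

section \<open>Isometries of compact spaces\<close>

lemma compact_structure_of_isometry:
  fixes M :: "('a, 'c, 'f, 'r) lstruct" and N :: "('b, 'c, 'f, 'r) lstruct"
  assumes M: "is_structure L M" and N: "compact_structure N"
    and h: "\<And>a. a \<in> carr M \<Longrightarrow> h a \<in> carr N"
      "\<And>a b. a \<in> carr M \<Longrightarrow> b \<in> carr M \<Longrightarrow> mdist (metr N) (h a) (h b) = mdist (metr M) a b"
  shows "compact_structure M"
proof -
  interpret M: Metric_space "carr M" "mdist (metr M)" by (rule Metric_space_mspace_mdist)
  interpret N: Metric_space "carr N" "mdist (metr N)" by (rule Metric_space_mspace_mdist)
  have N': "N.mtotally_bounded (carr N)"
    using N N.compact_space_eq_mcomplete_mtotally_bounded by (simp add: compact_structure_def mtopology_of_def)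
  have "\<exists>r. strict_mono r \<and> M.MCauchy (\<sigma> \<circ> r)" if \<sigma>: "range \<sigma> \<subseteq> carr M" for \<sigma> :: "nat \<Rightarrow> 'a"
  proof -
    have "range (h \<circ> \<sigma>) \<subseteq> carr N" using \<sigma> h(1) by auto
    then obtain r where r: "strict_mono r" "N.MCauchy ((h \<circ> \<sigma>) \<circ> r)"
      using N' unfolding N.mtotally_bounded_sequentially by blast
    have in_M: "\<sigma> k \<in> carr M" for k using \<sigma> by auto
    have "mdist (metr N) (((h \<circ> \<sigma>) \<circ> r) m) (((h \<circ> \<sigma>) \<circ> r) n) = mdist (metr M) ((\<sigma> \<circ> r) m) ((\<sigma> \<circ> r) n)" for m n
      using h(2) in_M by simp
    then have "M.MCauchy (\<sigma> \<circ> r)" using r(2) in_M unfolding M.MCauchy_def N.MCauchy_def by auto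
    with r(1) show ?thesis by blast
  qed
  then have "M.mtotally_bounded (carr M)" unfolding M.mtotally_bounded_sequentially by blast
  then show ?thesis
    using structure_mcomplete[OF M] M.compact_space_eq_mcomplete_mtotally_bounded
    by (simp add: compact_structure_def mtopology_of_def mcomplete_of_def)
qed

lemma compact_imp_separable_structure:
  assumes "compact_structure M"
  shows "separable_structure M"
proof -
  interpret M: Metric_space "carr M" "mdist (metr M)" by (rule Metric_space_mspace_mdist)
  have "M.mtotally_bounded (carr M)"
    using assms M.compact_space_eq_mcomplete_mtotally_bounded by (simp add: compact_structure_def mtopology_of_def)
  then have "\<forall>n. \<exists>K. finite K \<and> K \<subseteq> carr M \<and> carr M \<subseteq> (\<Union>x\<in>K. M.mball x (1 / Suc n))"
    unfolding M.mtotally_bounded_def by simp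
  then obtain K where K: "\<And>n. finite (K n)" "\<And>n. K n \<subseteq> carr M"
    "\<And>n. carr M \<subseteq> (\<Union>x\<in>K n. M.mball x (1 / Suc n))"
    by metis
  let ?D = "\<Union>n. K n"
  have "M.mtopology closure_of ?D = carr M"
    unfolding M.metric_closure_of
  proof (intro equalityI subsetI CollectI conjI allI impI)
    fix x r assume x: "x \<in> carr M" and "(0::real) < r"
    then obtain n where n: "1 / Suc n < r" using nat_approx_posE by blast
    obtain y where "y \<in> K n" "x \<in> M.mball y (1 / Suc n)" using K(3)[of n] x by blast
    with n show "\<exists>y\<in>?D. y \<in> M.mball x r" by (intro bexI[of _ y]) (auto simp: M.commute)
  qed auto
  moreover have "countable ?D" using K(1) by (intro countable_UN) (auto simp: countable_finite)
  moreover have "?D \<subseteq> carr M" using K(2) by blast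
  ultimately show ?thesis
    unfolding separable_structure_def separable_space_def mtopology_of_def by auto
qed

text \<open>Two members of the orbit of \<open>x\<close> are close to each other.  Cancelling the smaller number of
  iterations shows that \<open>x\<close> itself is close to the range of \<open>h\<close>; and the range is closed.\<close>

lemma isometry_onto:
  fixes N :: "('a, 'c, 'f, 'r) lstruct"
  assumes N: "compact_structure N" and h: "\<And>a. a \<in> carr N \<Longrightarrow> h a \<in> carr N"
      "\<And>a b. a \<in> carr N \<Longrightarrow> b \<in> carr N \<Longrightarrow> mdist (metr N) (h a) (h b) = mdist (metr N) a b"
  shows "h ` carr N = carr N"
proof -
  interpret N: Metric_space "carr N" "mdist (metr N)" by (rule Metric_space_mspace_mdist)
  have seq: "\<exists>l r. l \<in> carr N \<and> strict_mono r \<and> limitin N.mtopology (\<sigma> \<circ> r) l sequentially"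
    if "range \<sigma> \<subseteq> carr N" for \<sigma> :: "nat \<Rightarrow> 'a"
    using N that N.compact_space_sequentially by (simp add: compact_structure_def mtopology_of_def)
  have "x \<in> h ` carr N" if x: "x \<in> carr N" for x
  proof -
    have in_N: "(h ^^ k) a \<in> carr N" if "a \<in> carr N" for k a using that by (induction k) (auto intro: h(1))
    have iso: "mdist (metr N) ((h ^^ k) a) ((h ^^ k) b) = mdist (metr N) a b"
      if "a \<in> carr N" "b \<in> carr N" for k a b
      using that by (induction k) (auto simp: h(2) in_N)
    have dense: "\<exists>y\<in>carr N. mdist (metr N) x (h y) < \<epsilon>" if \<epsilon>: "0 < \<epsilon>" for \<epsilon>
    proof -
      obtain l r where l: "l \<in> carr N" "strict_mono r" "limitin N.mtopology ((\<lambda>k. (h ^^ k) x) \<circ> r) l sequentially"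
        using seq[of "\<lambda>k. (h ^^ k) x"] in_N[OF x] by blast
      obtain K where K: "\<And>k. K \<le> k \<Longrightarrow> mdist (metr N) ((h ^^ r k) x) l < \<epsilon> / 2"
        using l(3) \<epsilon> unfolding N.limit_metric_sequentially comp_apply by (meson half_gt_zero)
      have "r K < r (Suc K)" using l(2) by (simp add: strict_mono_def)
      then obtain k where k: "r (Suc K) = r K + Suc k" using less_imp_Suc_add by fastforce
      have "mdist (metr N) x ((h ^^ Suc k) x) = mdist (metr N) ((h ^^ r K) x) ((h ^^ r (Suc K)) x)"
        unfolding k funpow_add comp_apply using iso[OF x in_N[OF x], of "r K" "Suc k"] by simp
      also have "\<dots> \<le> mdist (metr N) ((h ^^ r K) x) l + mdist (metr N) l ((h ^^ r (Suc K)) x)"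
        using in_N[OF x] l(1) by (intro N.triangle)
      also have "\<dots> < \<epsilon>" using K[of K] K[of "Suc K"] by (simp add: N.commute)
      finally show ?thesis using in_N[OF x, of k] by (auto intro!: bexI[of _ "(h ^^ k) x"])
    qed
    have "\<forall>n. \<exists>y\<in>carr N. mdist (metr N) x (h y) < 1 / Suc n" using dense by simp
    then obtain y where y: "\<And>n. y n \<in> carr N" "\<And>n. mdist (metr N) x (h (y n)) < 1 / Suc n" by metis
    obtain l r where l: "l \<in> carr N" "strict_mono r" "limitin N.mtopology (y \<circ> r) l sequentially"
      using seq[of y] y(1) by blast
    have "mdist (metr N) x (h l) \<le> 0"
    proof (rule field_le_epsilon)
      fix \<epsilon> :: real assume \<epsilon>: "0 < \<epsilon>"
      obtain K where K: "\<And>k. K \<le> k \<Longrightarrow> mdist (metr N) (y (r k)) l < \<epsilon> / 2"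
        using l(3) \<epsilon> unfolding N.limit_metric_sequentially comp_apply by (meson half_gt_zero)
      obtain n where n: "1 / Suc n < \<epsilon> / 2" using nat_approx_posE[of "\<epsilon> / 2"] \<epsilon> by auto
      define k where "k = max K n"
      have "n \<le> r k" using seq_suble[OF l(2), of k] by (simp add: k_def)
      then have "1 / Suc (r k) \<le> 1 / Suc n" by (simp add: field_simps)
      then have "mdist (metr N) x (h (y (r k))) < \<epsilon> / 2" using y(2)[of "r k"] n by linarith
      moreover have "mdist (metr N) (h (y (r k))) (h l) < \<epsilon> / 2"
        using K[of k] h(2)[OF y(1) l(1)] by (simp add: k_def)
      moreover have "mdist (metr N) x (h l) \<le> mdist (metr N) x (h (y (r k))) + mdist (metr N) (h (y (r k))) (h l)"
        by (intro N.triangle h(1) x y(1) l(1))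
      ultimately show "mdist (metr N) x (h l) \<le> 0 + \<epsilon>" by linarith
    qed
    then have "mdist (metr N) x (h l) = 0" using mdist_nonneg[of "metr N" x "h l"] by linarith
    then have "x = h l" using x h(1)[OF l(1)] by simp
    with l(1) show ?thesis by blast
  qed
  with h(1) show ?thesis by blast
qed

section \<open>Tuples near an extreme evaluation\<close>

text \<open>The index \<open>z\<close> determines a valuation in one of the ways listed in \<open>W\<close>.  These functions form a
  vector space as soon as any two ways can be merged, because formulas may be renamed.\<close>

definition eval_space ::
  "('c, 'f, 'r) language \<Rightarrow> ('a, 'c, 'f, 'r) lstruct \<Rightarrow> ('z \<Rightarrow> nat \<Rightarrow> 'a) set \<Rightarrow> ('z \<Rightarrow> real) set" where
  "eval_space L M W = {\<lambda>z. eval_fm M (w z) \<phi> | w \<phi>. w \<in> W \<and> wf_fm L \<phi>}"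

lemma eval_spaceI: "w \<in> W \<Longrightarrow> wf_fm L \<phi> \<Longrightarrow> (\<lambda>z. eval_fm M (w z) \<phi>) \<in> eval_space L M W"
  by (auto simp: eval_space_def)

lemma eval_spaceE:
  assumes "f \<in> eval_space L M W"
  obtains w \<phi> where "w \<in> W" "wf_fm L \<phi>" "f = (\<lambda>z. eval_fm M (w z) \<phi>)"
  using assms by (auto simp: eval_space_def)

lemma function_space_eval_space:
  assumes "W \<noteq> {}"
    and merge: "\<And>w1 w2. w1 \<in> W \<Longrightarrow> w2 \<in> W \<Longrightarrow> \<exists>w\<in>W. \<exists>f1 f2. \<forall>z. w z \<circ> f1 = w1 z \<and> w z \<circ> f2 = w2 z"
  shows "function_space (eval_space L M W)"
  unfolding function_space_def
proof (intro conjI ballI allI)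
  obtain w where "w \<in> W" using assms(1) by blast
  from eval_spaceI[OF this, of L "Const 0" M] show "(\<lambda>_. 0) \<in> eval_space L M W" by simp
  fix f assume "f \<in> eval_space L M W"
  then obtain w1 \<phi> where 1: "w1 \<in> W" "wf_fm L \<phi>" "f = (\<lambda>z. eval_fm M (w1 z) \<phi>)" by (rule eval_spaceE)
  show "(\<lambda>x. c * f x) \<in> eval_space L M W" for c
    using eval_spaceI[OF 1(1), of L "Scale c \<phi>" M] 1 by simp
  fix g assume "g \<in> eval_space L M W"
  then obtain w2 \<psi> where 2: "w2 \<in> W" "wf_fm L \<psi>" "g = (\<lambda>z. eval_fm M (w2 z) \<psi>)" by (rule eval_spaceE)
  obtain w f1 f2 where w: "w \<in> W" "\<And>z. w z \<circ> f1 = w1 z" "\<And>z. w z \<circ> f2 = w2 z"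
    using merge[OF 1(1) 2(1)] by blast
  show "(\<lambda>x. f x + g x) \<in> eval_space L M W"
    using eval_spaceI[OF w(1), of L "Add (rename f1 \<phi>) (rename f2 \<psi>)" M] 1 2
    by (simp add: eval_rename w(2,3) wf_rename)
qed

text \<open>For maps \<open>g\<close> from an index set to a structure these are the formulas in finitely many of the
  variables \<open>g i\<close>.\<close>

definition reindexings :: "(('i \<Rightarrow> 'a) \<Rightarrow> nat \<Rightarrow> 'a) set" where
  "reindexings = range (\<lambda>\<sigma> g. g \<circ> \<sigma>)"

lemma function_space_reindexings:
  fixes M :: "('a, 'c, 'f, 'r) lstruct"
  shows "function_space (eval_space L M (reindexings :: (('i \<Rightarrow> 'a) \<Rightarrow> nat \<Rightarrow> 'a) set))"
proof (rule function_space_eval_space)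
  fix w1 w2 :: "('i \<Rightarrow> 'a) \<Rightarrow> nat \<Rightarrow> 'a"
  assume "w1 \<in> reindexings" "w2 \<in> reindexings"
  then obtain \<sigma>1 \<sigma>2 where w: "w1 = (\<lambda>g. g \<circ> \<sigma>1)" "w2 = (\<lambda>g. g \<circ> \<sigma>2)" by (auto simp: reindexings_def)
  let ?\<sigma> = "\<lambda>k. if even k then \<sigma>1 (k div 2) else \<sigma>2 (k div 2)"
  show "\<exists>w\<in>reindexings. \<exists>f1 f2. \<forall>z. w z \<circ> f1 = w1 z \<and> w z \<circ> f2 = w2 z"
    unfolding w
    by (intro bexI[of _ "\<lambda>g. g \<circ> ?\<sigma>"] exI[of _ "\<lambda>k. 2 * k"] exI[of _ "\<lambda>k. 2 * k + 1"])
      (auto simp: reindexings_def)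
qed (simp add: reindexings_def)

text \<open>The first \<open>n\<close> variables are read off a tuple, the others off a map.\<close>

definition mixed_valuation :: "nat \<Rightarrow> (nat \<Rightarrow> 'i) \<Rightarrow> ('i \<Rightarrow> 'a) \<times> 'a list \<Rightarrow> nat \<Rightarrow> 'a" where
  "mixed_valuation n \<sigma> z = (\<lambda>k. if k < n then snd z ! k else fst z (\<sigma> k))"

lemma function_space_mixed:
  fixes M :: "('a, 'c, 'f, 'r) lstruct"
  shows "function_space (eval_space L M
    (range (mixed_valuation n :: (nat \<Rightarrow> 'i) \<Rightarrow> ('i \<Rightarrow> 'a) \<times> 'a list \<Rightarrow> nat \<Rightarrow> 'a)))"
proof (rule function_space_eval_space)
  fix w1 w2 :: "('i \<Rightarrow> 'a) \<times> 'a list \<Rightarrow> nat \<Rightarrow> 'a"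
  assume "w1 \<in> range (mixed_valuation n)" "w2 \<in> range (mixed_valuation n)"
  then obtain \<sigma>1 \<sigma>2 where w: "w1 = mixed_valuation n \<sigma>1" "w2 = mixed_valuation n \<sigma>2" by blast
  let ?\<sigma> = "\<lambda>k. if even (k - n) then \<sigma>1 (n + (k - n) div 2) else \<sigma>2 (n + (k - n) div 2)"
  let ?f1 = "\<lambda>k. if k < n then k else n + 2 * (k - n)"
  let ?f2 = "\<lambda>k. if k < n then k else n + (2 * (k - n) + 1)"
  show "\<exists>w\<in>range (mixed_valuation n). \<exists>f1 f2. \<forall>z. w z \<circ> f1 = w1 z \<and> w z \<circ> f2 = w2 z"
    unfolding w
    by (intro bexI[of _ "mixed_valuation n ?\<sigma>"] exI[of _ ?f1] exI[of _ ?f2] allI conjI ext)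
      (auto simp: mixed_valuation_def)
qed simp

text \<open>Let the evaluation at \<open>h\<close> be extreme, and let the tuple \<open>as\<close> consist of limits of values of \<open>h\<close>.
  The type of \<open>as\<close> is then extreme.  Indeed, a decomposition of it lifts to a decomposition of the
  evaluation at the pair \<open>(h, as)\<close>; both parts restrict to the evaluation at \<open>h\<close>, by extremality; and
  both parts give small values to the distances between \<open>as\<close> and nearby values of \<open>h\<close>, because these
  distances are nonnegative and their sum under both parts is small.  Hence both parts agree with
  the evaluation also on formulas about \<open>as\<close>.

  Below, \<open>V\<close> consists of the formulas about a map in \<open>Z\<close>, and \<open>VV\<close> of the formulas about a pair in
  \<open>ZZ\<close> of a map and an \<open>n\<close>-tuple.\<close>

context
  fixes L :: "('c, 'f, 'r) language" and T and N :: "('a, 'c, 'f, 'r) lstruct"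
    and Z :: "('i \<Rightarrow> 'a) set" and n :: nat
    and V :: "(('i \<Rightarrow> 'a) \<Rightarrow> real) set" and ZZ :: "(('i \<Rightarrow> 'a) \<times> 'a list) set"
    and VV :: "(('i \<Rightarrow> 'a) \<times> 'a list \<Rightarrow> real) set"
  assumes L: "is_language L" and T: "is_theory L T" "complete_theory L T" and N: "is_model L T N"
    and Z_def: "Z = {g. \<forall>i. g i \<in> carr N}" and V_def: "V = eval_space L N reindexings"
    and ZZ_def: "ZZ = Z \<times> tuples N n" and VV_def: "VV = eval_space L N (range (mixed_valuation n))"
begin

private lemma Ns: "is_structure L N"
  using N by (simp add: is_model_def)

private lemma VV: "function_space VV"
  unfolding VV_def by (rule function_space_mixed)

private lemma mixed_valns: "z \<in> ZZ \<Longrightarrow> mixed_valuation n \<sigma> z \<in> valns N"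
  by (auto simp: ZZ_def Z_def tuples_def valns_def mixed_valuation_def subset_iff)

private lemma snd_ZZ: "snd ` ZZ = tuples N n"
proof -
  have "(\<lambda>_. base_point N) \<in> Z" using base_point[OF Ns] by (simp add: Z_def)
  then show ?thesis unfolding ZZ_def by force
qed

private lemma bounded_VV: "VV \<subseteq> bounded_on ZZ"
proof
  fix f assume "f \<in> VV"
  then obtain w \<phi> where w: "w \<in> range (mixed_valuation n)" "wf_fm L \<phi>" "f = (\<lambda>z. eval_fm N (w z) \<phi>)"
    unfolding VV_def by (rule eval_spaceE)
  obtain b where "\<forall>v\<in>valns N. \<bar>eval_fm N v \<phi>\<bar> \<le> b" using eval_fm_bounded[OF Ns w(2)] by blast
  then show "f \<in> bounded_on ZZ" using w(1,3) mixed_valns by (intro bounded_onI[of _ _ b]) auto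
qed

private lemma formula_in_VV:
  assumes \<psi>: "\<psi> \<in> formulas L n"
  shows "(\<lambda>z. value_at N \<psi> (snd z)) \<in> VV"
proof -
  have "value_at N \<psi> (snd z) = eval_fm N (mixed_valuation n undefined z) \<psi>" for z :: "('i \<Rightarrow> 'a) \<times> 'a list"
    unfolding value_at_def
    by (rule eval_fm_cong) (use \<psi> in \<open>auto simp: formulas_def mixed_valuation_def\<close>)
  then show ?thesis
    using eval_spaceI[of "mixed_valuation n undefined" "range (mixed_valuation n)" L \<psi> N] \<psi>
    by (simp add: VV_def formulas_def)
qed

private lemma lift_in_VV:
  assumes "f \<in> V"
  shows "(\<lambda>z. f (fst z)) \<in> VV"
proof -
  obtain \<sigma> \<phi> where f: "wf_fm L \<phi>" "f = (\<lambda>g. eval_fm N (g \<circ> \<sigma>) \<phi>)"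
    using assms unfolding V_def reindexings_def by (auto elim: eval_spaceE)
  have "f (fst z) = eval_fm N (mixed_valuation n (\<lambda>k. \<sigma> (k - n)) z) (rename (\<lambda>k. n + k) \<phi>)" for z
    unfolding f eval_rename by (rule eval_fm_cong) (simp add: mixed_valuation_def)
  then show ?thesis
    using eval_spaceI[of "mixed_valuation n (\<lambda>k. \<sigma> (k - n))" "range (mixed_valuation n)" L
        "rename (\<lambda>k. n + k) \<phi>" N] f(1)
    by (simp add: VV_def wf_rename)
qed

text \<open>Taking suprema over the variables that belong to the map gives the least bound only if these can
  be varied independently.  So variables on which \<open>\<sigma>\<close> agrees are identified first.\<close>

private lemma least_upper_formula:
  assumes "f \<in> VV"
  obtains \<Psi> where "\<Psi> \<in> formulas L n" "\<And>z. z \<in> ZZ \<Longrightarrow> f z \<le> value_at N \<Psi> (snd z)"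
    "\<And>\<psi> as. \<psi> \<in> formulas L n \<Longrightarrow> (\<And>z. z \<in> ZZ \<Longrightarrow> f z \<le> value_at N \<psi> (snd z)) \<Longrightarrow>
      as \<in> tuples N n \<Longrightarrow> value_at N \<Psi> as \<le> value_at N \<psi> as"
proof -
  obtain \<sigma> \<phi> where f: "wf_fm L \<phi>" "f = (\<lambda>z. eval_fm N (mixed_valuation n \<sigma> z) \<phi>)"
    using assms unfolding VV_def by (auto elim: eval_spaceE)
  define \<rho> where "\<rho> = (\<lambda>k. if k < n then k else (LEAST m. n \<le> m \<and> \<sigma> m = \<sigma> k))"
  have \<rho>: "n \<le> \<rho> k" "\<sigma> (\<rho> k) = \<sigma> k" if "n \<le> k" for k
    using LeastI[of "\<lambda>m. n \<le> m \<and> \<sigma> m = \<sigma> k" k] that by (auto simp: \<rho>_def)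
  have wf: "wf_fm L (rename \<rho> \<phi>)" using f(1) by (rule wf_rename)
  let ?\<Psi> = "sup_above n (rename \<rho> \<phi>)"
  have \<Psi>: "?\<Psi> \<in> formulas L n" by (rule sup_above_formulas[OF wf])
  show thesis
  proof (rule that[OF \<Psi>])
    fix z assume z: "z \<in> ZZ"
    let ?w = "mixed_valuation n \<sigma> z"
    have "?w \<circ> \<rho> = ?w"
    proof
      fix k show "(?w \<circ> \<rho>) k = ?w k"
      proof (cases "k < n")
        case False
        then show ?thesis using \<rho>[of k] by (simp add: mixed_valuation_def)
      qed (simp add: mixed_valuation_def \<rho>_def)
    qed
    then have "f z = eval_fm N ?w (rename \<rho> \<phi>)" by (simp add: f(2) eval_rename)
    also have "\<dots> \<le> eval_fm N ?w ?\<Psi>"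
      using mixed_valns[OF z] by (intro sup_above_upper[OF Ns wf]) auto
    also have "\<dots> = value_at N ?\<Psi> (snd z)"
      using z by (intro value_at_eval[OF \<Psi>, symmetric]) (auto simp: ZZ_def tuples_def mixed_valuation_def)
    finally show "f z \<le> value_at N ?\<Psi> (snd z)" .
  next
    fix \<psi> as assume \<psi>: "\<psi> \<in> formulas L n" "\<And>z. z \<in> ZZ \<Longrightarrow> f z \<le> value_at N \<psi> (snd z)"
      and as: "as \<in> tuples N n"
    let ?v = "valuation_of (base_point N) as"
    have v: "?v \<in> valns N"
      using as by (intro valuation_of_valns base_point[OF Ns]) (simp add: tuples_def)
    have "value_at N ?\<Psi> as = eval_fm N ?v ?\<Psi>"
      by (rule value_at_eval[OF \<Psi>]) (use as in \<open>auto simp: tuples_def valuation_of_def\<close>)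
    also have "\<dots> \<le> value_at N \<psi> as"
    proof (rule sup_above_least[OF Ns v])
      fix w assume w: "w \<in> valns N" "\<forall>i<n. ?v i = w i"
      define g where "g = (\<lambda>i. w (LEAST m. n \<le> m \<and> \<sigma> m = i))"
      have g: "(g, as) \<in> ZZ" using w(1) as by (simp add: ZZ_def Z_def g_def valns_def)
      have "w (\<rho> k) = mixed_valuation n \<sigma> (g, as) k" for k
        using w(2) as by (auto simp: mixed_valuation_def g_def \<rho>_def valuation_of_def tuples_def)
      then have "eval_fm N w (rename \<rho> \<phi>) = f (g, as)"
        unfolding eval_rename f(2) by (intro eval_fm_cong) simp
      also have "\<dots> \<le> value_at N \<psi> as" using \<psi>(2)[OF g] by simp
      finally show "eval_fm N w (rename \<rho> \<phi>) \<le> value_at N \<psi> as" .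
    qed
    finally show "value_at N ?\<Psi> as \<le> value_at N \<psi> as" .
  qed
qed

definition dominated ::
  "((('i \<Rightarrow> 'a) \<times> 'a list \<Rightarrow> real) \<Rightarrow> real) \<Rightarrow> real \<Rightarrow> (('c, 'f, 'r) fm \<Rightarrow> real) \<Rightarrow> bool" where
  "dominated p c q \<longleftrightarrow> (\<forall>f\<in>VV. \<forall>\<psi>\<in>formulas L n.
     (\<forall>z\<in>ZZ. f z \<le> value_at N \<psi> (snd z)) \<longrightarrow> p f \<le> c * q \<psi>)"

text \<open>The upper extensions of \<open>q\<close> and \<open>s\<close> are both attained at the least upper formula \<open>\<Psi>\<close> of \<open>f\<close>, and
  \<open>f (h, as) \<le> \<Psi>(as) = (1 - u) q(\<Psi>) + u s(\<Psi>)\<close>.  So the evaluation at \<open>(h, as)\<close> is below the sum of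
  two sublinear functionals and splits accordingly.  This step rests on the affine quantifiers:
  extreme points need not be mapped to extreme points by an arbitrary affine map.\<close>

private lemma decomposition_lifts:
  assumes q: "q \<in> types_of L T n" "s \<in> types_of L T n" and u: "0 < u" "u < 1"
    and as: "as \<in> tuples N n" and h: "h \<in> Z"
    and mix: "\<And>\<phi>. \<phi> \<in> formulas L n \<Longrightarrow> value_at N \<phi> as = (1 - u) * q \<phi> + u * s \<phi>"
  obtains p1 p2 where "linear_functional VV p1" "linear_functional VV p2"
    "dominated p1 (1 - u) q"
    "dominated p2 u s"
    "\<And>f. f \<in> VV \<Longrightarrow> f (h, as) = p1 f + p2 f"
proof -
  note Uq = upper_extension_sublinear[OF L T N q(1) VV snd_ZZ bounded_VV]
    and Us = upper_extension_sublinear[OF L T N q(2) VV snd_ZZ bounded_VV]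
  let ?Pq = "upper_extension L N n snd ZZ q" and ?Ps = "upper_extension L N n snd ZZ s"
  have u': "0 \<le> 1 - u" "0 \<le> u" using u by auto
  have ev: "linear_functional VV (\<lambda>f. f (h, as))" by (simp add: linear_functional_def)
  have le: "f (h, as) \<le> (1 - u) * ?Pq f + u * ?Ps f" if f: "f \<in> VV" for f
  proof -
    obtain \<Psi> where \<Psi>: "\<Psi> \<in> formulas L n" "\<And>z. z \<in> ZZ \<Longrightarrow> f z \<le> value_at N \<Psi> (snd z)"
      "\<And>\<psi> as. \<psi> \<in> formulas L n \<Longrightarrow> (\<And>z. z \<in> ZZ \<Longrightarrow> f z \<le> value_at N \<psi> (snd z)) \<Longrightarrow>
        as \<in> tuples N n \<Longrightarrow> value_at N \<Psi> as \<le> value_at N \<psi> as"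
      using least_upper_formula[OF f] by metis
    have "q \<Psi> \<le> ?Pq f"
    proof (rule Uq(3)[OF f])
      fix \<psi> assume \<psi>: "\<psi> \<in> formulas L n" "\<And>z. z \<in> ZZ \<Longrightarrow> f z \<le> value_at N \<psi> (snd z)"
      show "q \<Psi> \<le> q \<psi>" by (rule type_mono[OF L T N q(1) \<Psi>(1) \<psi>(1) \<Psi>(3)[OF \<psi>]])
    qed
    moreover have "s \<Psi> \<le> ?Ps f"
    proof (rule Us(3)[OF f])
      fix \<psi> assume \<psi>: "\<psi> \<in> formulas L n" "\<And>z. z \<in> ZZ \<Longrightarrow> f z \<le> value_at N \<psi> (snd z)"
      show "s \<Psi> \<le> s \<psi>" by (rule type_mono[OF L T N q(2) \<Psi>(1) \<psi>(1) \<Psi>(3)[OF \<psi>]])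
    qed
    ultimately have "(1 - u) * q \<Psi> + u * s \<Psi> \<le> (1 - u) * ?Pq f + u * ?Ps f"
      using u' by (intro add_mono mult_left_mono)
    moreover have "f (h, as) \<le> value_at N \<Psi> as" using \<Psi>(2)[of "(h, as)"] h as by (simp add: ZZ_def)
    ultimately show ?thesis using mix[OF \<Psi>(1)] by linarith
  qed
  obtain p1 p2 where p: "linear_functional VV p1" "linear_functional VV p2"
    "\<And>f. f \<in> VV \<Longrightarrow> p1 f \<le> (1 - u) * ?Pq f" "\<And>f. f \<in> VV \<Longrightarrow> p2 f \<le> u * ?Ps f"
    "\<And>f. f \<in> VV \<Longrightarrow> f (h, as) = p1 f + p2 f"
    using sublinear_decomposition[OF VV ev sublinear_scale[OF Uq(1) u'(1)] sublinear_scale[OF Us(1) u'(2)] le]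
    by metis
  have "p1 f \<le> (1 - u) * q \<psi>" "p2 f \<le> u * s \<psi>"
    if "f \<in> VV" "\<psi> \<in> formulas L n" "\<And>z. z \<in> ZZ \<Longrightarrow> f z \<le> value_at N \<psi> (snd z)" for f \<psi>
    using p(3,4)[OF that(1)] mult_left_mono[OF Uq(2)[OF that] u'(1)]
      mult_left_mono[OF Us(2)[OF that] u'(2)] by linarith+
  then have "dominated p1 (1 - u) q" "dominated p2 u s" by (auto simp: dominated_def)
  then show thesis by (rule that[OF p(1,2) _ _ p(5)])
qed

text \<open>Being dominated by \<open>c q\<close> is a one-sided estimate, but applied to negated formulas it becomes an
  equality, and applied to nonpositive functions it gives positivity.\<close>

private lemma lifted_part:
  assumes p: "linear_functional VV p" and q: "q \<in> types_of L T n" and c: "0 < c"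
    and dom: "dominated p c q"
  shows "f \<in> VV \<Longrightarrow> (\<And>z. z \<in> ZZ \<Longrightarrow> 0 \<le> f z) \<Longrightarrow> 0 \<le> p f"
    and "\<psi> \<in> formulas L n \<Longrightarrow> p (\<lambda>z. value_at N \<psi> (snd z)) = c * q \<psi>"
    and "state_on Z V (\<lambda>f. p (\<lambda>z. f (fst z)) / c)"
proof -
  have upper: "p f \<le> c * q \<psi>"
    if "f \<in> VV" "\<psi> \<in> formulas L n" "\<And>z. z \<in> ZZ \<Longrightarrow> f z \<le> value_at N \<psi> (snd z)" for f \<psi>
    using dom that by (auto simp: dominated_def)
  have neg: "p (\<lambda>z. -1 * f z) = - p f" if "f \<in> VV" for f
    using linear_functionalD(2)[OF p that, of "-1"] by simp
  show pos: "0 \<le> p f" if f: "f \<in> VV" "\<And>z. z \<in> ZZ \<Longrightarrow> 0 \<le> f z" for f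
  proof -
    have "p (\<lambda>z. -1 * f z) \<le> c * q (Const 0)"
      by (rule upper[OF function_spaceD(3)[OF VV f(1)] formulas_intros(1)])
        (use f(2) in \<open>simp add: value_at_Const\<close>)
    then show ?thesis using neg[OF f(1)] type_Const[OF L T N q, of 0] by simp
  qed
  show eq: "p (\<lambda>z. value_at N \<psi> (snd z)) = c * q \<psi>" if \<psi>: "\<psi> \<in> formulas L n" for \<psi>
  proof (rule antisym)
    show "p (\<lambda>z. value_at N \<psi> (snd z)) \<le> c * q \<psi>" by (rule upper[OF formula_in_VV[OF \<psi>] \<psi>]) simp
    have "p (\<lambda>z. -1 * value_at N \<psi> (snd z)) \<le> c * q (Scale (-1) \<psi>)"
      by (rule upper[OF function_spaceD(3)[OF VV formula_in_VV[OF \<psi>]] formulas_intros(3)[OF \<psi>]])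
        (simp add: value_at_Scale)
    then show "c * q \<psi> \<le> p (\<lambda>z. value_at N \<psi> (snd z))"
      using neg[OF formula_in_VV[OF \<psi>]] types_ofD(3)[OF q \<psi>, of "-1"] by simp
  qed
  show "state_on Z V (\<lambda>f. p (\<lambda>z. f (fst z)) / c)"
    unfolding state_on_def
  proof (intro conjI ballI impI)
    show "linear_functional V (\<lambda>f. p (\<lambda>z. f (fst z)) / c)"
      unfolding linear_functional_def
    proof (intro conjI ballI allI)
      fix f assume f: "f \<in> V"
      show "p (\<lambda>z. r * f (fst z)) / c = r * (p (\<lambda>z. f (fst z)) / c)" for r
        using linear_functionalD(2)[OF p lift_in_VV[OF f]] by simp
      fix g assume g: "g \<in> V"
      show "p (\<lambda>z. f (fst z) + g (fst z)) / c = p (\<lambda>z. f (fst z)) / c + p (\<lambda>z. g (fst z)) / c"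
        using linear_functionalD(1)[OF p lift_in_VV[OF f] lift_in_VV[OF g]] by (simp add: add_divide_distrib)
    qed
    show "0 \<le> p (\<lambda>z. f (fst z)) / c" if "f \<in> V" "\<forall>z\<in>Z. 0 \<le> f z" for f
      using c that by (intro divide_nonneg_pos pos lift_in_VV) (auto simp: ZZ_def)
    show "p (\<lambda>z. 1) / c = 1"
      using eq[OF formulas_intros(1), of 1] type_Const[OF L T N q, of 1] c by (simp add: value_at_Const)
  qed
qed

lemma extreme_type_near_extreme_evaluation:
  assumes h: "h \<in> Z"
    and extreme: "extreme_evaluation Z V h"
    and as: "as \<in> tuples N n" and near: "\<And>a \<delta>. a \<in> set as \<Longrightarrow> 0 < \<delta> \<Longrightarrow> \<exists>i. mdist (metr N) a (h i) < \<delta>"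
  shows "tp L N as \<in> extreme_types_of L T n"
proof -
  have len: "length as = n" using as by (simp add: tuples_def)
  have le: "q \<psi> \<le> value_at N \<psi> as"
    if q: "q \<in> types_of L T n" "s \<in> types_of L T n" and u: "0 < u" "u < 1"
      and mix: "\<And>\<phi>. \<phi> \<in> formulas L n \<Longrightarrow> value_at N \<phi> as = (1 - u) * q \<phi> + u * s \<phi>"
      and \<psi>: "\<psi> \<in> formulas L n" for q s u \<psi>
  proof -
    have u': "0 < 1 - u" using u by simp
    obtain p1 p2 where p: "linear_functional VV p1" "linear_functional VV p2"
      and up1: "dominated p1 (1 - u) q"
      and up2: "dominated p2 u s"
      and sum: "\<And>f. f \<in> VV \<Longrightarrow> f (h, as) = p1 f + p2 f"
      using decomposition_lifts[OF q u as h mix] by blast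
    note part1 = lifted_part[OF p(1) q(1) u' up1] and part2 = lifted_part[OF p(2) q(2) u(1) up2]
    have p1V: "p1 (\<lambda>z. f (fst z)) = (1 - u) * f h" if f: "f \<in> V" for f
    proof -
      have "p1 (\<lambda>z. f (fst z)) / (1 - u) = f h"
      proof (rule extreme[unfolded extreme_evaluation_def, rule_format, OF part1(3) part2(3) u _ f])
        fix f assume f: "f \<in> V"
        show "f h = (1 - u) * (p1 (\<lambda>z. f (fst z)) / (1 - u)) + u * (p2 (\<lambda>z. f (fst z)) / u)"
          using sum[OF lift_in_VV[OF f]] u by simp
      qed
      then show ?thesis using u' by (simp add: field_simps)
    qed
    have wf: "wf_fm L \<psi>" and fv: "free_vars \<psi> \<subseteq> {..<n}" using \<psi> by (auto simp: formulas_def)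
    obtain l where lip: "fm_lip N \<psi> l" using eval_fm_lipschitz[OF L Ns wf] by blast
    note l = lip_boundD[OF lip]
    \<comment> \<open>One inequality between \<open>q\<close> and the type of \<open>as\<close> suffices, as it also holds for \<open>- \<psi>\<close>.\<close>
    have bound: "(1 - u) * q \<psi> \<le> (1 - u) * value_at N \<psi> as + l * (real n + 1) * \<delta>" if \<delta>: "0 < \<delta>" for \<delta>
    proof -
      have "\<forall>k<n. \<exists>i. mdist (metr N) (as ! k) (h i) < \<delta>" using near \<delta> len by simp
      then obtain j where j: "\<And>k. k < n \<Longrightarrow> mdist (metr N) (as ! k) (h (j k)) < \<delta>" by metis
      define E where "E = (\<lambda>g :: 'i \<Rightarrow> 'a. eval_fm N (g \<circ> j) \<psi>)"
      define D where "D = (\<lambda>k (z :: ('i \<Rightarrow> 'a) \<times> 'a list). mdist (metr N) (snd z ! k) (fst z (j k)))"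
      have E: "E \<in> V" unfolding E_def V_def by (rule eval_spaceI[OF _ wf]) (auto simp: reindexings_def)
      have D: "D k \<in> VV" if "k < n" for k
        using eval_spaceI[of "mixed_valuation n (\<lambda>_. j k)" "range (mixed_valuation n)" L "Dist (Var k) (Var n)" N] that
        by (simp add: VV_def D_def mixed_valuation_def)
      have DS: "(\<lambda>z. \<Sum>k<n. D k z) \<in> VV" using D by (intro function_space_sum[OF VV]) auto
      let ?\<psi> = "\<lambda>z. value_at N \<psi> (snd z)" and ?E = "\<lambda>z. E (fst z)" and ?D = "\<lambda>z. \<Sum>k<n. D k z"
      note mem = formula_in_VV[OF \<psi>] lift_in_VV[OF E] DS
      have lD: "(\<lambda>z. l * ?D z) \<in> VV" by (rule function_spaceD(3)[OF VV DS])
      have m\<psi>: "(\<lambda>z. -1 * ?\<psi> z) \<in> VV" by (rule function_spaceD(3)[OF VV mem(1)])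
      have ElD: "(\<lambda>z. ?E z + l * ?D z) \<in> VV" by (rule function_spaceD(2)[OF VV mem(2) lD])
      \<comment> \<open>Lipschitz continuity compares \<open>\<psi>\<close> at the tuple with \<open>\<psi>\<close> at the nearby values of the map.\<close>
      have "0 \<le> p1 (\<lambda>z. (?E z + l * ?D z) + -1 * ?\<psi> z)"
      proof (rule part1(1)[OF function_spaceD(2)[OF VV ElD m\<psi>]])
        fix z assume z: "z \<in> ZZ"
        have g: "fst z \<in> Z" and x: "snd z \<in> tuples N n" using z by (auto simp: ZZ_def)
        have "?\<psi> z = eval_fm N (mixed_valuation n j z) \<psi>"
          using x by (intro value_at_eval[OF \<psi>]) (auto simp: tuples_def mixed_valuation_def)
        moreover have "\<bar>eval_fm N (mixed_valuation n j z) \<psi> - eval_fm N (fst z \<circ> j) \<psi>\<bar> \<le> l * ?D z"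
        proof (rule l(2)[OF mixed_valns[OF z]])
          show "fst z \<circ> j \<in> valns N" using g by (simp add: Z_def valns_def)
          show "0 \<le> ?D z" by (auto simp: D_def intro!: sum_nonneg)
          show "\<forall>k\<in>free_vars \<psi>. mdist (metr N) (mixed_valuation n j z k) ((fst z \<circ> j) k) \<le> ?D z"
          proof
            fix k assume "k \<in> free_vars \<psi>"
            then have k: "k < n" using fv by auto
            have "D k z \<le> ?D z" using k by (intro member_le_sum) (auto simp: D_def)
            then show "mdist (metr N) (mixed_valuation n j z k) ((fst z \<circ> j) k) \<le> ?D z"
              using k by (simp add: mixed_valuation_def D_def)
          qed
        qed
        ultimately show "0 \<le> (?E z + l * ?D z) + -1 * ?\<psi> z" by (simp add: E_def abs_le_iff)
      qed
      also have "\<dots> = (p1 ?E + l * p1 ?D) + -1 * p1 ?\<psi>"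
        using linear_functionalD(1)[OF p(1) ElD m\<psi>] linear_functionalD(1)[OF p(1) mem(2) lD]
          linear_functionalD(2)[OF p(1) mem(1), of "-1"] linear_functionalD(2)[OF p(1) DS, of l] by simp
      also have "p1 ?\<psi> = (1 - u) * q \<psi>" by (rule part1(2)[OF \<psi>])
      also have "p1 ?E = (1 - u) * E h" by (rule p1V[OF E])
      finally have *: "(1 - u) * q \<psi> \<le> (1 - u) * E h + l * p1 ?D" by simp
      have "p1 ?D = (\<Sum>k<n. p1 (D k))" using D by (intro linear_functional_sum[OF VV p(1)]) auto
      also have "\<dots> \<le> (\<Sum>k<n. \<delta>)"
      proof (rule sum_mono)
        fix k assume "k \<in> {..<n}"
        then have k: "k < n" by simp
        have "0 \<le> p2 (D k)" by (rule part2(1)[OF D[OF k]]) (simp add: D_def)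
        then have "p1 (D k) \<le> D k (h, as)" using sum[OF D[OF k]] by simp
        also have "\<dots> \<le> \<delta>" using j[OF k] by (simp add: D_def)
        finally show "p1 (D k) \<le> \<delta>" .
      qed
      finally have "l * p1 ?D \<le> l * (n * \<delta>)" using l(1) by (intro mult_left_mono) auto
      moreover have "E h \<le> value_at N \<psi> as + l * \<delta>"
      proof -
        have z: "(h, as) \<in> ZZ" using h as by (simp add: ZZ_def)
        have "value_at N \<psi> as = eval_fm N (mixed_valuation n j (h, as)) \<psi>"
          using len by (intro value_at_eval[OF \<psi>]) (auto simp: mixed_valuation_def)
        moreover have "\<bar>eval_fm N (mixed_valuation n j (h, as)) \<psi> - eval_fm N (h \<circ> j) \<psi>\<bar> \<le> l * \<delta>"
        proof (rule l(2)[OF mixed_valns[OF z]])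
          show "h \<circ> j \<in> valns N" using h by (simp add: Z_def valns_def)
          show "\<forall>k\<in>free_vars \<psi>. mdist (metr N) (mixed_valuation n j (h, as) k) ((h \<circ> j) k) \<le> \<delta>"
            using j fv by (auto simp: mixed_valuation_def intro: less_imp_le)
        qed (use \<delta> in simp)
        ultimately show ?thesis by (simp add: E_def abs_le_iff)
      qed
      then have "(1 - u) * E h \<le> (1 - u) * (value_at N \<psi> as + l * \<delta>)" using u' by (intro mult_left_mono) auto
      moreover have "(1 - u) * (l * \<delta>) \<le> 1 * (l * \<delta>)" using u l(1) \<delta> by (intro mult_right_mono) auto
      ultimately show ?thesis using * by (simp add: algebra_simps)
    qed
    have "(1 - u) * q \<psi> \<le> (1 - u) * value_at N \<psi> as"
    proof (rule field_le_epsilon)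
      fix \<epsilon> :: real assume \<epsilon>: "0 < \<epsilon>"
      define c where "c = l * (real n + 1)"
      have c: "0 \<le> c" using l(1) by (simp add: c_def)
      have "c * (\<epsilon> / (c + 1)) \<le> \<epsilon>" using c \<epsilon> by (simp add: field_simps)
      moreover have "0 < \<epsilon> / (c + 1)" using c \<epsilon> by simp
      ultimately show "(1 - u) * q \<psi> \<le> (1 - u) * value_at N \<psi> as + \<epsilon>"
        using bound[of "\<epsilon> / (c + 1)"] by (simp add: c_def)
    qed
    then show ?thesis using u' by simp
  qed
  have eq: "q = tp L N as"
    if q: "q \<in> types_of L T n" "s \<in> types_of L T n" and u: "0 < u" "u < 1"
      and mix: "tp L N as = (\<lambda>\<phi>. (1 - u) * q \<phi> + u * s \<phi>)" for q s u
  proof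
    have mix': "value_at N \<phi> as = (1 - u) * q \<phi> + u * s \<phi>" if "\<phi> \<in> formulas L n" for \<phi>
      using fun_cong[OF mix, of \<phi>] that len by (simp add: tp_def)
    fix \<phi>
    show "q \<phi> = tp L N as \<phi>"
    proof (cases "\<phi> \<in> formulas L n")
      case True
      have "q \<phi> \<le> value_at N \<phi> as" by (rule le[OF q u mix' True])
      moreover have "q (Scale (-1) \<phi>) \<le> value_at N (Scale (-1) \<phi>) as"
        by (rule le[OF q u mix' formulas_intros(3)[OF True]])
      ultimately show ?thesis using types_ofD(3)[OF q(1) True, of "-1"] True len
        by (simp add: tp_def value_at_Scale)
    next
      case False
      then show ?thesis using types_ofD(1)[OF q(1) False] len by (simp add: tp_def)
    qed
  qed
  show ?thesis
    unfolding extreme_types_of_def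
  proof (intro CollectI conjI notI)
    show "tp L N as \<in> types_of L T n" by (rule tp_type[OF L T N as])
    assume "\<exists>q\<in>types_of L T n. \<exists>s\<in>types_of L T n. \<exists>u. q \<noteq> s \<and> 0 < u \<and> u < 1 \<and>
      tp L N as = (\<lambda>\<phi>. (1 - u) * q \<phi> + u * s \<phi>)"
    then obtain q s u where q: "q \<in> types_of L T n" "s \<in> types_of L T n" "q \<noteq> s" and u: "0 < u" "u < 1"
      and mix: "tp L N as = (\<lambda>\<phi>. (1 - u) * q \<phi> + u * s \<phi>)" by blast
    have qt: "q = tp L N as" by (rule eq[OF q(1,2) u mix])
    have "s \<phi> = q \<phi>" for \<phi>
    proof -
      have "q \<phi> = (1 - u) * q \<phi> + u * s \<phi>" using fun_cong[OF mix, of \<phi>] qt by simp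
      then have "u = 0 \<or> q \<phi> = s \<phi>" by (simp add: algebra_simps)
      with u show ?thesis by simp
    qed
    with q(3) show False by auto
  qed
qed

end

section \<open>Compact models contain extremal ones\<close>

lemma elementary_submodel_model:
  assumes T: "is_theory L T" and M: "is_model L T M" and K: "elementary_submodel L K M"
  shows "is_model L T K"
  unfolding is_model_def
proof (intro conjI ballI, goal_cases)
  case 1
  show ?case using K by (simp add: elementary_submodel_def substructure_def)
next
  case (2 c)
  obtain \<sigma> \<tau> where c: "c = (\<sigma>, \<tau>)" by (cases c)
  have eq: "value_at K \<phi> [] = value_at M \<phi> []" if "\<phi> \<in> sentences L" for \<phi>
    using K that by (simp add: elementary_submodel_def tuples_def)
  have "\<sigma> \<in> sentences L" "\<tau> \<in> sentences L" using 2 T by (auto simp: c is_theory_def)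
  moreover have "value_at M \<sigma> [] \<le> value_at M \<tau> []" using M 2 by (auto simp: c is_model_def)
  ultimately show ?case by (simp add: c eq)
qed

lemma elementary_submodel_tp:
  assumes K: "elementary_submodel L K M" and as: "as \<in> tuples K n"
  shows "tp L K as = tp L M as" "as \<in> tuples M n"
proof -
  have len: "length as = n" using as by (simp add: tuples_def)
  have "\<forall>\<phi>\<in>formulas L n. value_at K \<phi> as = value_at M \<phi> as"
    using K as unfolding elementary_submodel_def by blast
  then show "tp L K as = tp L M as" unfolding tp_def len by auto
  show "as \<in> tuples M n" using K as by (auto simp: elementary_submodel_def substructure_def tuples_def)
qed

lemma compact_elementary_submodel:
  assumes K: "elementary_submodel L K M" and M: "compact_structure M"
  shows "compact_structure K"
  using K by (intro compact_structure_of_isometry[of L K M "\<lambda>a. a"] M)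
    (auto simp: elementary_submodel_def substructure_def)

text \<open>Since \<open>C\<close> is compact, suprema are attained; fix a maximum point \<open>m \<phi> \<sigma> k\<close> for each \<open>\<phi>\<close> with parameters
  \<open>\<sigma>\<close>.  A map \<open>g\<close> from \<open>C\<close> to \<open>C\<close> for which each \<open>g (m \<phi> \<sigma> k)\<close> is a maximum point of \<open>\<phi>\<close> with
  parameters \<open>g \<circ> \<sigma>\<close> has a range that passes the Tarski--Vaught test.  This condition says that
  certain nonnegative functions of \<open>g\<close> vanish, and the identity satisfies it.  So there is such a map
  whose evaluation is extreme, and the closure of its range is the required submodel.\<close>

theorem compact_model_has_extremal_submodel:
  fixes C :: "('a, 'c, 'f, 'r) lstruct"
  assumes L: "is_language L" and T: "is_theory L T" "complete_theory L T"
    and C: "is_model L T C" "compact_structure C"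
  obtains K where "elementary_submodel L K C" "extremal L T K"
proof -
  have Cs: "is_structure L C" using C by (simp add: is_model_def)
  let ?X = "map_topology C :: ('a \<Rightarrow> 'a) topology"
  let ?V = "eval_space L C reindexings :: (('a \<Rightarrow> 'a) \<Rightarrow> real) set"
  have V: "function_space ?V" by (rule function_space_reindexings)
  have in_V: "(\<lambda>g. eval_fm C (g \<circ> \<sigma>) \<phi>) \<in> ?V" if "wf_fm L \<phi>" for \<sigma> \<phi>
    by (rule eval_spaceI[OF _ that]) (auto simp: reindexings_def)
  have const: "(\<lambda>_. c) \<in> ?V" for c using in_V[of "Const c"] by simp
  have cont: "continuous_map ?X euclideanreal f" if "f \<in> ?V" for f
  proof -
    obtain \<sigma> \<phi> where "wf_fm L \<phi>" "f = (\<lambda>g. eval_fm C (g \<circ> \<sigma>) \<phi>)"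
      using \<open>f \<in> ?V\<close> by (auto simp: reindexings_def elim: eval_spaceE)
    then show ?thesis using continuous_map_eval_comp[OF L Cs] by simp
  qed
  have "\<exists>d\<in>carr C. eval_fm C (\<sigma>(k := d)) \<phi> = eval_fm C \<sigma> (SupQ k \<phi>)"
    if wf: "wf_fm L \<phi>" and \<sigma>: "\<sigma> \<in> valns C" for \<phi> \<sigma> k
  proof -
    let ?Y = "mtopology_of (metr C)"
    have cont: "continuous_map ?Y euclideanreal (\<lambda>a. eval_fm C (\<sigma>(k := a)) \<phi>)"
    proof (rule continuous_map_eval[OF L Cs wf])
      show "continuous_map ?Y ?Y (\<lambda>a. (\<sigma>(k := a)) i)" for i
        using \<sigma> by (cases "i = k") (simp_all add: valns_def)
    qed
    have "compact_space ?Y" using C(2) by (simp add: compact_structure_def)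
    moreover have "topspace ?Y \<noteq> {}" using structure_nonempty[OF Cs] by simp
    ultimately obtain d where d: "d \<in> carr C" "\<And>a. a \<in> carr C \<Longrightarrow> eval_fm C (\<sigma>(k := a)) \<phi> \<le> eval_fm C (\<sigma>(k := d)) \<phi>"
      using continuous_attains_sup_closedin[OF _ closedin_topspace _ cont] by (metis topspace_mtopology_of)
    have "eval_fm C \<sigma> (SupQ k \<phi>) \<le> eval_fm C (\<sigma>(k := d)) \<phi>" by (rule eval_SupQ_least[OF Cs d(2)])
    with eval_SupQ_upper[OF Cs wf \<sigma> d(1), of k] d(1) show ?thesis by (metis antisym)
  qed
  then obtain m where m: "\<And>\<phi> \<sigma> k. wf_fm L \<phi> \<Longrightarrow> \<sigma> \<in> valns C \<Longrightarrow> m \<phi> \<sigma> k \<in> carr C"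
    "\<And>\<phi> \<sigma> k. wf_fm L \<phi> \<Longrightarrow> \<sigma> \<in> valns C \<Longrightarrow> eval_fm C (\<sigma>(k := m \<phi> \<sigma> k)) \<phi> = eval_fm C \<sigma> (SupQ k \<phi>)"
    by metis
  define gap where "gap = (\<lambda>(\<phi>, \<sigma>, k) (g :: 'a \<Rightarrow> 'a).
    eval_fm C (g \<circ> \<sigma>) (SupQ k \<phi>) + -1 * eval_fm C (g \<circ> \<sigma>(k := m \<phi> \<sigma> k)) \<phi>)"
  define G where "G = gap ` ({\<phi>. wf_fm L \<phi>} \<times> valns C \<times> UNIV)"
  have GV: "G \<subseteq> ?V"
  proof
    fix f assume "f \<in> G"
    then obtain \<phi> \<sigma> k where "wf_fm L \<phi>"
      "f = (\<lambda>g. eval_fm C (g \<circ> \<sigma>) (SupQ k \<phi>) + -1 * eval_fm C (g \<circ> \<sigma>(k := m \<phi> \<sigma> k)) \<phi>)"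
      by (auto simp: G_def gap_def)
    then show "f \<in> ?V"
      using in_V[of "SupQ k \<phi>" \<sigma>] in_V[of \<phi> "\<sigma>(k := m \<phi> \<sigma> k)"]
      by (simp only: function_spaceD[OF V] wf_fm.simps)
  qed
  have upd: "g \<circ> \<sigma>(k := d) = (g \<circ> \<sigma>)(k := g d)" for g :: "'a \<Rightarrow> 'a" and \<sigma> :: "nat \<Rightarrow> 'a" and k d by auto
  have nonneg: "0 \<le> f g" if fG: "f \<in> G" and gX: "g \<in> topspace ?X" for f g
  proof -
    obtain \<phi> \<sigma> k where wf: "wf_fm L \<phi>" and f: "f = gap (\<phi>, \<sigma>, k)" using fG unfolding G_def by blast
    have g: "g \<circ> \<sigma> \<in> valns C" "g (m \<phi> \<sigma> k) \<in> carr C"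
      using gX by (auto simp: topspace_map_topology valns_def)
    show ?thesis
      using eval_SupQ_upper[OF Cs wf g, of k] unfolding f gap_def prod.case upd by simp
  qed
  \<comment> \<open>Maps in \<open>?X\<close> are total, so the identity is corrected outside the carrier.\<close>
  let ?id = "\<lambda>a. if a \<in> carr C then a else base_point C"
  have id: "?id \<in> topspace ?X" using base_point[OF Cs] by (simp add: topspace_map_topology)
  have zero: "f ?id = 0" if fG: "f \<in> G" for f
  proof -
    obtain \<phi> \<sigma> k where wf: "wf_fm L \<phi>" and \<sigma>: "\<sigma> \<in> valns C" and f: "f = gap (\<phi>, \<sigma>, k)"
      using fG unfolding G_def by blast
    have "?id \<circ> \<sigma> = \<sigma>" "?id (m \<phi> \<sigma> k) = m \<phi> \<sigma> k" using \<sigma> m(1)[OF wf \<sigma>] by (auto simp: valns_def)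
    then show ?thesis unfolding f gap_def prod.case upd using m(2)[OF wf \<sigma>, of k] by simp
  qed
  obtain h where h: "h \<in> topspace ?X" "\<forall>f\<in>G. f h = 0" "extreme_evaluation (topspace ?X) ?V h"
  proof (rule extreme_evaluation_exists[of ?X ?V G ?id])
    show "compact_space ?X" by (rule compact_map_topology[OF C(2)])
  qed (use V const cont GV nonneg id zero in blast)+
  have hC: "h a \<in> carr C" for a using h(1) by (simp add: topspace_map_topology)
  define D where "D = h ` carr C"
  have tv: "tarski_vaught_set L C D"
    unfolding tarski_vaught_set_def
  proof (intro conjI allI impI)
    show "D \<subseteq> carr C" "D \<noteq> {}" using hC structure_nonempty[OF Cs] by (auto simp: D_def)
    fix \<phi> :: "('c, 'f, 'r) fm" and k and v :: "nat \<Rightarrow> 'a" and \<epsilon> :: real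
    assume wf: "wf_fm L \<phi>" and v: "range v \<subseteq> D" and \<epsilon>: "0 < \<epsilon>"
    have "\<forall>i. \<exists>a. a \<in> carr C \<and> v i = h a" using v by (auto simp: D_def)
    then obtain \<sigma> where \<sigma>: "\<And>i. \<sigma> i \<in> carr C" "\<And>i. v i = h (\<sigma> i)" by metis
    have vh: "v = h \<circ> \<sigma>" using \<sigma>(2) by auto
    have \<sigma>C: "\<sigma> \<in> valns C" using \<sigma>(1) by (simp add: valns_def)
    have "gap (\<phi>, \<sigma>, k) h = 0" using wf \<sigma>C h(2) by (auto simp: G_def)
    then have "eval_fm C v (SupQ k \<phi>) = eval_fm C (v(k := h (m \<phi> \<sigma> k))) \<phi>"
      unfolding gap_def prod.case upd vh by simp
    then show "\<exists>d\<in>D. eval_fm C v (SupQ k \<phi>) - \<epsilon> \<le> eval_fm C (v(k := d)) \<phi>"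
      using m(1)[OF wf \<sigma>C] \<epsilon> by (intro bexI[of _ "h (m \<phi> \<sigma> k)"]) (auto simp: D_def)
  qed
  let ?K = "closed_substructure C D"
  have K: "elementary_submodel L ?K C" by (rule tarski_vaught[OF L Cs tv])
  have "extremal L T ?K"
    unfolding extremal_def
  proof (intro allI ballI)
    fix n as assume as: "as \<in> tuples ?K n"
    have "tp L C as \<in> extreme_types_of L T n"
    proof (rule extreme_type_near_extreme_evaluation[OF L T C(1) topspace_map_topology refl refl refl h(1,3)])
      show "as \<in> tuples C n" by (rule elementary_submodel_tp(2)[OF K as])
      fix a and \<delta> :: real assume "a \<in> set as" "0 < \<delta>"
      then have "a \<in> mtopology_of (metr C) closure_of D"
        using as by (auto simp: tuples_def carr_closed_substructure)
      then show "\<exists>i. mdist (metr C) a (h i) < \<delta>"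
        using \<open>0 < \<delta>\<close> unfolding closure_of_metric D_def by blast
    qed
    then show "tp L ?K as \<in> extreme_types_of L T n" by (simp only: elementary_submodel_tp(1)[OF K as])
  qed
  with K that show thesis by blast
qed

section \<open>The compact minimal model\<close>

lemma extremal_imp_compact:
  assumes "is_language L" "is_theory L T" "complete_theory L T"
    and M: "is_model L T M" "extremal L T M" and N: "is_model L T N" "compact_structure N"
  shows "compact_structure M"
proof -
  obtain h where h: "elementary_map L M N h"
    using extremal_embeds_into_compact[OF assms] by blast
  show ?thesis
    using M(1) elementary_mapD(1)[OF h] elementary_map_mdist[OF h]
    by (intro compact_structure_of_isometry[OF _ N(2), of L M h]) (auto simp: is_model_def)
qed

text \<open>An elementary submodel \<open>K\<close> of \<open>M\<close> is compact, so \<open>M\<close> embeds into it.  As a map from \<open>M\<close> to \<open>M\<close> the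
  embedding is an isometry of a compact space and therefore onto.\<close>

lemma extremal_compact_imp_minimal:
  assumes L: "is_language L" and T: "is_theory L T" "complete_theory L T"
    and M: "is_model L T M" "extremal L T M" "compact_structure M"
  shows "minimal_structure L M"
  unfolding minimal_structure_def
proof (rule notI, elim exE conjE)
  fix K assume K: "elementary_submodel L K M" and neq: "carr K \<noteq> carr M"
  obtain h where h: "elementary_map L M K h"
    using extremal_embeds_into_compact[OF L T M(1,2) elementary_submodel_model[OF T(1) M(1) K]
        compact_elementary_submodel[OF K M(3)]] by blast
  have sub: "carr K \<subseteq> carr M"
    and dist: "\<And>a b. a \<in> carr K \<Longrightarrow> b \<in> carr K \<Longrightarrow> mdist (metr K) a b = mdist (metr M) a b"
    using K by (auto simp: elementary_submodel_def substructure_def)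
  have "h ` carr M = carr M"
  proof (rule isometry_onto[OF M(3)])
    show "h a \<in> carr M" for a using elementary_mapD(1)[OF h] sub by blast
    show "mdist (metr M) (h a) (h b) = mdist (metr M) a b" if "a \<in> carr M" "b \<in> carr M" for a b
      using elementary_map_mdist[OF h that] dist[OF elementary_mapD(1)[OF h] elementary_mapD(1)[OF h]] by simp
  qed
  moreover have "h ` carr M \<subseteq> carr K" using elementary_mapD(1)[OF h] by blast
  ultimately have "carr M \<subseteq> carr K" by simp
  with sub neq show False by blast
qed

lemma compact_minimal_imp_extremal:
  assumes L: "is_language L" and T: "is_theory L T" "complete_theory L T"
    and M: "is_model L T M" "compact_structure M" "minimal_structure L M"
  shows "extremal L T M"
proof -
  obtain K where K: "elementary_submodel L K M" "extremal L T K"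
    using compact_model_has_extremal_submodel[OF L T M(1,2)] by blast
  have eq: "carr K = carr M" using M(3) K(1) by (auto simp: minimal_structure_def)
  have "tuples K n = tuples M n" for n by (simp add: tuples_def eq)
  then show ?thesis
    using K(2) elementary_submodel_tp(1)[OF K(1)] unfolding extremal_def by metis
qed

text \<open>Each of the two models embeds into the other, and the composition of the embeddings is onto.\<close>

lemma extremal_compact_isomorphic:
  assumes L: "is_language L" and T: "is_theory L T" "complete_theory L T"
    and M: "is_model L T M" "extremal L T M" "compact_structure M"
    and N: "is_model L T N" "extremal L T N" "compact_structure N"
  shows "isomorphic_structures L M N"
proof -
  obtain f where f: "elementary_map L M N f" using extremal_embeds_into_compact[OF L T M(1,2) N(1,3)] by blast
  obtain g where g: "elementary_map L N M g" using extremal_embeds_into_compact[OF L T N(1,2) M(1,3)] by blast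
  have "(f \<circ> g) ` carr N = carr N"
    using elementary_mapD(1)[OF f] elementary_mapD(1)[OF g] elementary_map_mdist[OF f] elementary_map_mdist[OF g]
    by (intro isometry_onto[OF N(3)]) auto
  then have "f ` (g ` carr N) = carr N" by (simp add: image_comp)
  moreover have "f ` (g ` carr N) \<subseteq> f ` carr M" using elementary_mapD(1)[OF g] by blast
  moreover have "f ` carr M \<subseteq> carr N" using elementary_mapD(1)[OF f] by blast
  ultimately have "f ` carr M = carr N" by simp
  then show ?thesis
    using M(1) N(1) f by (intro elementary_map_isomorphism) (auto simp: is_model_def)
qed

theorem corollary5p9:
  fixes L :: "('c, 'f, 'r) language"
    and T :: "(('c, 'f, 'r) fm \<times> ('c, 'f, 'r) fm) set"
    and C :: "('k, 'c, 'f, 'r) lstruct"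
  assumes "is_language L"
    and "is_theory L T"
    and "complete_theory L T"
    and "is_model L T C" and "compact_structure C"
  shows "(\<forall>M :: ('a, 'c, 'f, 'r) lstruct. is_model L T M \<longrightarrow>
            (separable_structure M \<and> extremal L T M \<longleftrightarrow>
             compact_structure M \<and> minimal_structure L M)) \<and>
         (\<exists>M :: ('k, 'c, 'f, 'r) lstruct. is_model L T M \<and>
            separable_structure M \<and> extremal L T M \<and>
            compact_structure M \<and> minimal_structure L M) \<and>
         (\<forall>(M :: ('a, 'c, 'f, 'r) lstruct) (N :: ('b, 'c, 'f, 'r) lstruct).
            is_model L T M \<and> separable_structure M \<and> extremal L T M \<and>
            is_model L T N \<and> separable_structure N \<and> extremal L T N \<longrightarrow>
            isomorphic_structures L M N)"
proof (intro conjI allI impI)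
  note LT = assms(1-3)
  fix M :: "('a, 'c, 'f, 'r) lstruct" assume M: "is_model L T M"
  show "separable_structure M \<and> extremal L T M \<longleftrightarrow> compact_structure M \<and> minimal_structure L M"
    using extremal_imp_compact[OF LT M _ assms(4,5)] extremal_compact_imp_minimal[OF LT M]
      compact_minimal_imp_extremal[OF LT M] compact_imp_separable_structure by blast
next
  note LT = assms(1-3)
  obtain K where K: "elementary_submodel L K C" "extremal L T K"
    using compact_model_has_extremal_submodel[OF LT assms(4,5)] by blast
  have model: "is_model L T K" by (rule elementary_submodel_model[OF assms(2,4) K(1)])
  have compact: "compact_structure K" by (rule compact_elementary_submodel[OF K(1) assms(5)])
  show "\<exists>M :: ('k, 'c, 'f, 'r) lstruct. is_model L T M \<and>
            separable_structure M \<and> extremal L T M \<and> compact_structure M \<and> minimal_structure L M"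
    using model K(2) compact compact_imp_separable_structure[OF compact]
      extremal_compact_imp_minimal[OF LT model K(2) compact] by blast
next
  note LT = assms(1-3)
  fix M :: "('a, 'c, 'f, 'r) lstruct" and N :: "('b, 'c, 'f, 'r) lstruct"
  assume MN: "is_model L T M \<and> separable_structure M \<and> extremal L T M \<and>
    is_model L T N \<and> separable_structure N \<and> extremal L T N"
  then have M: "is_model L T M" "extremal L T M" and N: "is_model L T N" "extremal L T N" by auto
  show "isomorphic_structures L M N"
    by (rule extremal_compact_isomorphic[OF LT M extremal_imp_compact[OF LT M assms(4,5)]
          N extremal_imp_compact[OF LT N assms(4,5)]])
qed

end
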